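(* The operator $\mathcal{H}:(cabv(T,X),\|\cdot\|_{MK})\to(cabv(T,X),\|\cdot\|_{MK})$ is linear and continuous, and its operator norm with respect to $\|\cdot\|_{MK}$ satisfies $$\|\mathcal{H}\|_{o,MK}\leq\int_\Theta\|R_\theta\|_o(1+r_\theta)\,dW(\theta).$$
   Context: $K$ is $\mathbb{R}$ or $\mathbb{C}$. $(\Theta,\Sigma,W)$ is a measure space, $(T,d)$ is a compact metric space with at least two elements, and $X$ is a non-null Hilbert space over $K$ with scalar product $(\cdot,\cdot)$, linear in the first and antilinear in the second variable. For a topological space $Z$, $\mathcal{B}_Z$ denotes its Borel $\sigma$-algebra. $\omega:T\times\Theta\to T$ is $(\mathcal{B}_T\otimes\Sigma,\mathcal{B}_T)$-measurable and $R:X\times\Theta\to X$ is $(\mathcal{B}_X\otimes\Sigma,\mathcal{B}_X)$-measurable. For $\theta\in\Theta$ put $\omega_\theta(t)=\omega(t,\theta)$ and $R_\theta(x)=R(x,\theta)$. For every $\theta\in\Theta$: $R_\theta$ is a continuous linear operator on $X$, with operator norm $\|R_\theta\|_o$; and $\omega_\theta:T\to T$ is Lipschitz with (smallest) Lipschitz constant $r_\theta=\sup_{s\ne t} d(\omega_\theta(s),\omega_\theta(t))/d(s,t)<\infty$. The function $\theta\mapsto\|R_\theta\|_o$ is assumed $\Sigma$-measurable ($\theta\mapsto r_\theta$ is then automatically $\Sigma$-measurable), and it is assumed that $\int_\Theta\|R_\theta\|_o(1+r_\theta)\,dW(\theta)<\infty$. $\mathcal{C}(T,X)$ is the Banach space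 of continuous functions $f:T\to X$ with norm $\|f\|_\infty=\sup_{t\in T}\|f(t)\|$, and $\mathcal{C}(T,X)'$ is its dual. The continuous linear operator $H_C:\mathcal{C}(T,X)\to\mathcal{C}(T,X)$ is given by the Bochner integral $H_C(f)(t)=\int_\Theta (R_\theta\circ f\circ\omega_\theta)(t)\,dW(\theta)$, and its adjoint $H_C':\mathcal{C}(T,X)'\to\mathcal{C}(T,X)'$ by $H_C'(y)=y\circ H_C$. $cabv(T,X)$ is the Banach space of $\sigma$-additive measures $\mu:\mathcal{B}_T\to X$ of finite total variation, with the variational norm $\|\mu\|=|\mu|(T)$. The (sesquilinear uniform) integral is defined as follows: for a simple function $f=\sum_{i=1}^m\varphi_{A_i}x_i$ (where $(A_i)$ is a partition of $T$ into Borel sets, $\varphi_{A_i}$ is the indicator function of $A_i$, $x_i\in X$) and $\mu\in cabv(T,X)$, $\int f\,d\mu=\sum_{i=1}^m(x_i,\mu(A_i))$; for $f$ a uniform limit of simple functions $f_m$ (in particular for every $f\in\mathcal{C}(T,X)$), $\int f\,d\mu=\lim_m\int f_m\,d\mu$. The map $\Phi:cabv(T,X)\to\mathcal{C}(T,X)'$, $\Phi(m)(f)=\int f\,dm$, is an antilinear isometric bijection. The operator $\mathcal{H}:cabv(T,X)\to cabv(T,X)$ is defined by $\mathcal{H}=\Phi^{-1}\circ H_C'\circ\Phi$. For a Lipschitz function $f:T\to X$ put $\|f\|_L=\sup_{s\neq t}\|f(s)-f(t)\|/d(s,t)$ and $\|f\|_{BL}=\|f\|_\infty+\|f\|_L$.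 The Monge-Kantorovich norm on $cabv(T,X)$ is $\|\mu\|_{MK}=\sup\{|\int f\,d\mu| : f:T\to X \text{ Lipschitz},\ \|f\|_{BL}\leq 1\}$. *)

theory Defs
  imports "HOL-Analysis.Analysis"
begin

section \<open>Hilbert spaces over the real or complex numbers\<close>

text \<open>
  The scalar field \<open>K\<close> is realised as a subfield of the complex numbers, either the real
  numbers or everything. The type class supplies the real vector space structure, the norm and
  the completeness; \<open>sc\<close> is the scalar multiplication by elements of \<open>K\<close> (its
  values at scalars outside \<open>K\<close> play no role), and \<open>ip\<close> is the scalar product.
\<close>

locale hilbert_space_over =
  fixes K :: "complex set"
    and sc :: "complex \<Rightarrow> 'x::banach \<Rightarrow> 'x"
    and ip :: "'x \<Rightarrow> 'x \<Rightarrow> complex"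
  assumes real_or_complex: "K = \<real> \<or> K = UNIV"
    and sc_of_real: "sc (of_real r) x = r *\<^sub>R x"
    and sc_add_right: "a \<in> K \<Longrightarrow> sc a (x + y) = sc a x + sc a y"
    and sc_add_left: "a \<in> K \<Longrightarrow> b \<in> K \<Longrightarrow> sc (a + b) x = sc a x + sc b x"
    and sc_sc: "a \<in> K \<Longrightarrow> b \<in> K \<Longrightarrow> sc a (sc b x) = sc (a * b) x"
    and ip_in_K: "ip x y \<in> K"
    and ip_add_left: "ip (x + y) z = ip x z + ip y z"
    and ip_sc_left: "a \<in> K \<Longrightarrow> ip (sc a x) y = a * ip x y"
    and ip_commute: "ip y x = cnj (ip x y)"
    and ip_self: "ip x x = of_real ((norm x)\<^sup>2)"

section \<open>The Bochner integral\<close>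

text \<open>
  These are the definitions of \<^const>\<open>has_bochner_integral\<close>, \<^const>\<open>integrable\<close>
  and \<^const>\<open>lebesgue_integral\<close> with the restriction to second countable codomains
  removed, because the Hilbert space need not be separable.
\<close>

definition has_bochner ::
    "'o measure \<Rightarrow> ('o \<Rightarrow> 'x::real_normed_vector) \<Rightarrow> 'x \<Rightarrow> bool" where
  "has_bochner M f x \<longleftrightarrow> f \<in> borel_measurable M \<and>
     (\<exists>s. (\<forall>i. Bochner_Integration.simple_bochner_integrable M (s i)) \<and>
          (\<lambda>i. \<integral>\<^sup>+\<theta>. ennreal (norm (f \<theta> - s i \<theta>)) \<partial>M) \<longlonglongrightarrow> 0 \<and>
          (\<lambda>i. Bochner_Integration.simple_bochner_integral M (s i)) \<longlonglongrightarrow> x)"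

definition bochner_integrable ::
    "'o measure \<Rightarrow> ('o \<Rightarrow> 'x::real_normed_vector) \<Rightarrow> bool" where
  "bochner_integrable M f \<longleftrightarrow> (\<exists>x. has_bochner M f x)"

definition bochner_integral ::
    "'o measure \<Rightarrow> ('o \<Rightarrow> 'x::real_normed_vector) \<Rightarrow> 'x" where
  "bochner_integral M f = (if bochner_integrable M f then THE x. has_bochner M f x else 0)"

lemma has_bochner_iff_has_bochner_integral:
  fixes f :: "'o \<Rightarrow> 'x::{real_normed_vector, second_countable_topology}"
  shows "has_bochner M f x \<longleftrightarrow> has_bochner_integral M f x"
  unfolding has_bochner_def has_bochner_integral.simps by auto

section \<open>Lipschitz constants and norms\<close>

text \<open>
  The smallest Lipschitz constant of a Lipschitz function. For a normed codomain it is the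
  Lipschitz seminorm. Only meaningful for Lipschitz functions on a space with two distinct points.
\<close>

definition lip_const :: "('a::metric_space \<Rightarrow> 'b::metric_space) \<Rightarrow> real" where
  "lip_const f = (SUP (s, t)\<in>{(s, t). s \<noteq> t}. dist (f s) (f t) / dist s t)"

definition sup_norm :: "('t \<Rightarrow> 'x::real_normed_vector) \<Rightarrow> real" where
  "sup_norm f = (SUP t. norm (f t))"

definition BL_norm :: "('t::metric_space \<Rightarrow> 'x::real_normed_vector) \<Rightarrow> real" where
  "BL_norm f = sup_norm f + lip_const f"

section \<open>Vector measures of bounded variation\<close>

definition variation ::
    "('t::topological_space set \<Rightarrow> 'x::real_normed_vector) \<Rightarrow> 't set \<Rightarrow> ennreal" where
  "variation \<mu> A =
     (SUP P\<in>{P. finite P \<and> P \<subseteq> sets borel \<and> disjoint P \<and> \<Union>P = A}.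
        \<Sum>B\<in>P. ennreal (norm (\<mu> B)))"

text \<open>
  A measure on the Borel sets is a total function on sets that vanishes outside the Borel sets,
  so that equal measures are equal as functions.
\<close>

definition cabv ::
    "('t::topological_space set \<Rightarrow> 'x::real_normed_vector) set" where
  "cabv = {\<mu>. (\<forall>A. A \<notin> sets borel \<longrightarrow> \<mu> A = 0) \<and>
     (\<forall>A::nat \<Rightarrow> 't set. range A \<subseteq> sets borel \<longrightarrow> disjoint_family A \<longrightarrow>
        (\<lambda>n. \<mu> (A n)) sums \<mu> (\<Union>n. A n)) \<and>
     variation \<mu> UNIV < \<infinity>}"

section \<open>The sesquilinear uniform integral\<close>

text \<open>The integral of a simple function, computed from the partition of the domain into the
  level sets of the function.\<close>

definition simple_integral ::
    "('x \<Rightarrow> 'x \<Rightarrow> complex) \<Rightarrow> ('t \<Rightarrow> 'x) \<Rightarrow> ('t set \<Rightarrow> 'x) \<Rightarrow> complex" where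
  "simple_integral ip f \<mu> = (\<Sum>x\<in>range f. ip x (\<mu> (f -` {x})))"

definition uniform_integral ::
    "('x \<Rightarrow> 'x \<Rightarrow> complex) \<Rightarrow> ('t::topological_space \<Rightarrow> 'x::real_normed_vector) \<Rightarrow>
     ('t set \<Rightarrow> 'x) \<Rightarrow> complex" where
  "uniform_integral ip f \<mu> =
     (THE L. \<exists>s. (\<forall>n::nat. simple_function borel (s n)) \<and>
                 uniform_limit UNIV s f sequentially \<and>
                 (\<lambda>n. simple_integral ip (s n) \<mu>) \<longlonglongrightarrow> L)"

definition MK_norm ::
    "('x \<Rightarrow> 'x \<Rightarrow> complex) \<Rightarrow> ('t::metric_space set \<Rightarrow> 'x::real_normed_vector) \<Rightarrow> real" where
  "MK_norm ip \<mu> =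
     (SUP f\<in>{f::'t \<Rightarrow> 'x. (\<exists>L. L-lipschitz_on UNIV f) \<and> BL_norm f \<le> 1}.
        cmod (uniform_integral ip f \<mu>))"

section \<open>The operators\<close>

text \<open>
  For compact \<open>T\<close> the space of continuous functions from \<open>T\<close> to \<open>X\<close> is the type of bounded
  continuous functions, whose norm is the supremum norm.
\<close>

definition Phi ::
    "('x \<Rightarrow> 'x \<Rightarrow> complex) \<Rightarrow> ('t::topological_space set \<Rightarrow> 'x) \<Rightarrow>
     ('t \<Rightarrow>\<^sub>C 'x::real_normed_vector) \<Rightarrow> complex" where
  "Phi ip \<mu> = (\<lambda>f. uniform_integral ip (apply_bcontfun f) \<mu>)"

definition H_C ::
    "'o measure \<Rightarrow> ('o \<Rightarrow> 't \<Rightarrow> 't) \<Rightarrow> ('o \<Rightarrow> 'x \<Rightarrow> 'x) \<Rightarrow>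
     ('t::topological_space \<Rightarrow>\<^sub>C 'x::real_normed_vector) \<Rightarrow> ('t \<Rightarrow>\<^sub>C 'x)" where
  "H_C W \<omega> R f =
     Bcontfun (\<lambda>t. bochner_integral W (\<lambda>\<theta>. R \<theta> (apply_bcontfun f (\<omega> \<theta> t))))"

definition H_C_adjoint ::
    "'o measure \<Rightarrow> ('o \<Rightarrow> 't \<Rightarrow> 't) \<Rightarrow> ('o \<Rightarrow> 'x \<Rightarrow> 'x) \<Rightarrow>
     (('t::topological_space \<Rightarrow>\<^sub>C 'x::real_normed_vector) \<Rightarrow> complex) \<Rightarrow>
     ('t \<Rightarrow>\<^sub>C 'x) \<Rightarrow> complex" where
  "H_C_adjoint W \<omega> R y = y \<circ> H_C W \<omega> R"

definition H_op ::
    "('x \<Rightarrow> 'x \<Rightarrow> complex) \<Rightarrow> 'o measure \<Rightarrow> ('o \<Rightarrow> 't \<Rightarrow> 't) \<Rightarrow> ('o \<Rightarrow> 'x \<Rightarrow> 'x) \<Rightarrow>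
     ('t::topological_space set \<Rightarrow> 'x::real_normed_vector) \<Rightarrow> ('t set \<Rightarrow> 'x)" where
  "H_op ip W \<omega> R \<mu> = inv_into cabv (Phi ip) (H_C_adjoint W \<omega> R (Phi ip \<mu>))"

section \<open>Operators on the space of measures with the Monge-Kantorovich norm\<close>

definition linear_on_cabv ::
    "complex set \<Rightarrow> (complex \<Rightarrow> 'x \<Rightarrow> 'x) \<Rightarrow>
     (('t::topological_space set \<Rightarrow> 'x::real_normed_vector) \<Rightarrow> ('t set \<Rightarrow> 'x)) \<Rightarrow> bool" where
  "linear_on_cabv K sc H \<longleftrightarrow>
     H \<in> cabv \<rightarrow> cabv \<and>
     (\<forall>\<mu>\<in>cabv. \<forall>\<nu>\<in>cabv. H (\<lambda>A. \<mu> A + \<nu> A) = (\<lambda>A. H \<mu> A + H \<nu> A)) \<and>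
     (\<forall>a\<in>K. \<forall>\<mu>\<in>cabv. H (\<lambda>A. sc a (\<mu> A)) = (\<lambda>A. sc a (H \<mu> A)))"

definition MK_continuous ::
    "('x \<Rightarrow> 'x \<Rightarrow> complex) \<Rightarrow>
     (('t::metric_space set \<Rightarrow> 'x::real_normed_vector) \<Rightarrow> ('t set \<Rightarrow> 'x)) \<Rightarrow> bool" where
  "MK_continuous ip H \<longleftrightarrow>
     (\<forall>\<mu>\<in>cabv. \<forall>\<epsilon>>0. \<exists>\<delta>>0. \<forall>\<nu>\<in>cabv.
        MK_norm ip (\<lambda>A. \<nu> A - \<mu> A) < \<delta> \<longrightarrow> MK_norm ip (\<lambda>A. H \<nu> A - H \<mu> A) < \<epsilon>)"

definition MK_onorm ::
    "('x \<Rightarrow> 'x \<Rightarrow> complex) \<Rightarrow>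
     (('t::metric_space set \<Rightarrow> 'x::real_normed_vector) \<Rightarrow> ('t set \<Rightarrow> 'x)) \<Rightarrow> ereal" where
  "MK_onorm ip H = (SUP \<mu>\<in>{\<mu>\<in>cabv. MK_norm ip \<mu> \<le> 1}. ereal (MK_norm ip (H \<mu>)))"

section \<open>Existence of the Bochner integrals defining \<open>H_C\<close>\<close>

text \<open>
  For separable \<open>X\<close> the integrals defining \<^const>\<open>H_C\<close> always exist. For
  arbitrary \<open>X\<close> their existence is part of the hypothesis that \<^const>\<open>H_C\<close> is
  given by Bochner integrals: Borel measurability alone does not provide the essentially separable
  range that Bochner integrability requires (consider a measure on all subsets of a set of
  real-valued measurable cardinality).
\<close>

lemma bochner_integrable_if_second_countable:
  fixes \<omega> :: "'o \<Rightarrow> 't::metric_space \<Rightarrow> 't"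
    and R :: "'o \<Rightarrow> 'x \<Rightarrow> 'x::{banach, second_countable_topology}"
    and f :: "'t \<Rightarrow>\<^sub>C 'x"
  assumes om: "(\<lambda>(t, \<theta>). \<omega> \<theta> t) \<in> measurable (borel \<Otimes>\<^sub>M W) borel"
    and Rm: "(\<lambda>(x, \<theta>). R \<theta> x) \<in> measurable (borel \<Otimes>\<^sub>M W) borel"
    and bl: "\<And>\<theta>. \<theta> \<in> space W \<Longrightarrow> bounded_linear (R \<theta>)"
    and lip: "\<And>\<theta>. \<theta> \<in> space W \<Longrightarrow> \<exists>L. L-lipschitz_on UNIV (\<omega> \<theta>)"
    and two: "\<exists>s t::'t. s \<noteq> t"
    and nm: "(\<lambda>\<theta>. onorm (R \<theta>)) \<in> borel_measurable W"
    and int: "integrable W (\<lambda>\<theta>. onorm (R \<theta>) * (1 + lip_const (\<omega> \<theta>)))"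
  shows "bochner_integrable W (\<lambda>\<theta>. R \<theta> (apply_bcontfun f (\<omega> \<theta> t)))"
proof -
  obtain p q :: 't where pq: "p \<noteq> q" using two by blast
  have lip0: "0 \<le> lip_const (\<omega> \<theta>)" if th: "\<theta> \<in> space W" for \<theta>
  proof -
    obtain L where L: "L-lipschitz_on UNIV (\<omega> \<theta>)" using lip[OF th] by blast
    have bdd: "bdd_above ((\<lambda>(s, t). dist (\<omega> \<theta> s) (\<omega> \<theta> t) / dist s t) ` {(s, t). s \<noteq> t})"
      using lipschitz_onD[OF L]
      by (intro bdd_aboveI[of _ L]) (auto simp: divide_le_eq)
    have "0 \<le> dist (\<omega> \<theta> p) (\<omega> \<theta> q) / dist p q" by simp
    also have "\<dots> \<le> lip_const (\<omega> \<theta>)"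
      unfolding lip_const_def using cSUP_upper[OF _ bdd, of "(p, q)"] pq by simp
    finally show ?thesis .
  qed
  have fm: "apply_bcontfun f \<in> measurable borel borel"
    by (intro borel_measurable_continuous_onI) simp
  have "(\<lambda>\<theta>. (t, \<theta>)) \<in> measurable W (borel \<Otimes>\<^sub>M W)" by simp
  from measurable_compose[OF this om]
  have "(\<lambda>\<theta>. \<omega> \<theta> t) \<in> measurable W borel" by simp
  from measurable_compose[OF this fm]
  have "(\<lambda>\<theta>. (apply_bcontfun f (\<omega> \<theta> t), \<theta>)) \<in> measurable W (borel \<Otimes>\<^sub>M W)"
    by (intro measurable_Pair) auto
  from measurable_compose[OF this Rm]
  have meas: "(\<lambda>\<theta>. R \<theta> (apply_bcontfun f (\<omega> \<theta> t))) \<in> borel_measurable W" by simp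
  have on: "integrable W (\<lambda>\<theta>. onorm (R \<theta>))"
  proof (rule Bochner_Integration.integrable_bound[OF int nm], rule AE_I2)
    fix \<theta> assume th: "\<theta> \<in> space W"
    show "norm (onorm (R \<theta>)) \<le> norm (onorm (R \<theta>) * (1 + lip_const (\<omega> \<theta>)))"
      using lip0[OF th] onorm_pos_le[OF bl[OF th]] by (simp add: abs_mult mult_le_cancel_left1)
  qed
  have "integrable W (\<lambda>\<theta>. R \<theta> (apply_bcontfun f (\<omega> \<theta> t)))"
  proof (rule Bochner_Integration.integrable_bound[OF integrable_mult_left[OF on, of "norm f"] meas],
      rule AE_I2)
    fix \<theta> assume th: "\<theta> \<in> space W"
    have "norm (R \<theta> (apply_bcontfun f (\<omega> \<theta> t))) \<le> onorm (R \<theta>) * norm (apply_bcontfun f (\<omega> \<theta> t))"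
      by (rule onorm[OF bl[OF th]])
    also have "\<dots> \<le> onorm (R \<theta>) * norm f"
      by (intro mult_left_mono norm_bounded onorm_pos_le bl th)
    finally show "norm (R \<theta> (apply_bcontfun f (\<omega> \<theta> t))) \<le> norm (onorm (R \<theta>) * norm f)" by simp
  qed
  then show ?thesis
    unfolding bochner_integrable_def has_bochner_iff_has_bochner_integral by (simp add: integrable.simps)
qed

end

theory Submission
  imports Defs
begin

text \<open>
  Write \<open>A f (t) = \<integral> R\<^sub>\<theta> (f (\<omega>\<^sub>\<theta> t)) dW(\<theta>)\<close>; this is the function \<open>avg f\<close> below, and for
  continuous \<open>f\<close> it is the value of \<^const>\<open>H_C\<close> at \<open>f\<close>. The measure \<open>H \<mu>\<close> satisfies
  \<open>\<integral> f d(H \<mu>) = \<integral> A f d\<mu>\<close>. If \<open>f\<close> is bounded by \<open>a\<close> and has Lipschitz constant \<open>b\<close>, then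
  \<open>\<parallel>R\<^sub>\<theta> (f (\<omega>\<^sub>\<theta> s)) - R\<^sub>\<theta> (f (\<omega>\<^sub>\<theta> t))\<parallel> \<le> \<parallel>R\<^sub>\<theta>\<parallel> b r\<^sub>\<theta> d(s, t)\<close>, so \<open>A f\<close> is bounded by
  \<open>a \<integral> \<parallel>R\<^sub>\<theta>\<parallel> dW\<close> and has Lipschitz constant at most \<open>b \<integral> \<parallel>R\<^sub>\<theta>\<parallel> r\<^sub>\<theta> dW\<close>. For \<open>a + b \<le> 1\<close> the sum of
  these two numbers is at most \<open>C = \<integral> \<parallel>R\<^sub>\<theta>\<parallel> (1 + r\<^sub>\<theta>) dW\<close>, whence
  \<open>\<bar>\<integral> f d(H \<mu>)\<bar> \<le> C \<parallel>\<mu>\<parallel>\<close> for the Monge-Kantorovich norm. These are the lemmas \<open>norm_avg_le\<close>,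
  \<open>norm_avg_modulus\<close> and \<open>MK_norm_H_op_le\<close>.

  As \<^const>\<open>H_op\<close> is defined through an inverse of \<^const>\<open>Phi\<close>, this argument presupposes that exactly
  one measure represents the functional \<open>f \<mapsto> \<integral> A f d\<mu>\<close>. The representation theorem for the whole
  dual of the space of continuous functions can be avoided, because here the measure can be written
  down. The function \<open>A f\<close> makes sense for every uniform limit \<open>f\<close> of simple functions and is such a
  limit again. In particular \<open>x \<mapsto> \<integral> A (1\<^sub>B x) d\<mu>\<close> is a bounded linear functional on \<open>X\<close>, and the
  theorem of Frechet and Riesz (\<open>functional_representable\<close>) turns it into a vector \<open>\<nu>(B)\<close>. Its norm
  is at most \<open>\<lambda>(B)\<close>, where \<open>\<lambda>\<close> is the image under \<open>\<omega>\<close> of the product of the variation of \<open>\<mu>\<close> and the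
  measure \<open>\<parallel>R\<^sub>\<theta>\<parallel> dW\<close> (\<open>dominating_measure\<close>). Finite additivity and this bound by a finite measure
  already make \<open>\<nu>\<close> countably additive and of bounded variation (\<open>cabvI\<close>). The identity
  \<open>\<integral> f d\<nu> = \<integral> A f d\<mu>\<close> holds for simple functions by construction and passes to uniform limits
  (\<open>transported_measure_exists\<close>). Uniqueness is \<open>Phi_injective\<close>: integrals of continuous functions
  determine a measure on closed sets, hence on all Borel sets. The same uniqueness gives linearity
  of \<open>H\<close>, as sums and multiples of representing measures represent sums and multiples.

  The space \<open>X\<close> may be non-separable, and then sums of measurable \<open>X\<close>-valued functions need not be
  measurable. Therefore \<open>A f (t)\<close> is defined as a weak integral, by its scalar products with all
  vectors, which only involves scalar integrals; it coincides with the Bochner integral whenever the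
  latter exists (\<open>bochner_integral_eq_weak_integral\<close>). Bochner integrability enters a second time
  where \<open>A (1\<^sub>B x)\<close> has to be approximated uniformly by simple functions
  (\<open>tot_measurable_avg_indicator\<close>).
\<close>

section \<open>The theorem of Frechet and Riesz\<close>

lemma linear_term_vanishes:
  fixes b c :: real
  assumes "\<And>t. 0 \<le> 2 * t * b + t\<^sup>2 * c" "0 \<le> c"
  shows "b = 0"
proof (rule ccontr)
  assume b: "b \<noteq> 0"
  \<comment> \<open>The minimiser \<open>- b / c\<close> with the denominator moved away from zero.\<close>
  have "2 * (- b / (c + 1)) * b + (- b / (c + 1))\<^sup>2 * c = - (b\<^sup>2 * (c + 2)) / (c + 1)\<^sup>2"
    using assms(2) by (simp add: divide_simps power2_eq_square) algebra
  also have "\<dots> < 0" using b assms(2) by (simp add: divide_neg_pos)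
  finally show False using assms(1)[of "- b / (c + 1)"] by simp
qed

context hilbert_space_over
begin

lemma of_real_in_K: "of_real r \<in> K"
  using real_or_complex by auto

lemma ip_add_right: "ip x (y + z) = ip x y + ip x z"
  by (metis ip_commute ip_add_left complex_cnj_add)

lemma ip_sc_right: "a \<in> K \<Longrightarrow> ip x (sc a y) = cnj a * ip x y"
  by (metis ip_commute ip_sc_left complex_cnj_mult)

lemma ip_scaleR_left: "ip (r *\<^sub>R x) y = of_real r * ip x y"
  by (metis sc_of_real ip_sc_left of_real_in_K)

lemma ip_scaleR_right: "ip x (r *\<^sub>R y) = of_real r * ip x y"
  by (metis sc_of_real ip_sc_right of_real_in_K complex_cnj_complex_of_real)

lemma ip_zero_left [simp]: "ip 0 y = 0" and ip_zero_right [simp]: "ip x 0 = 0"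
  using ip_scaleR_left[of 0 0 y] ip_scaleR_right[of x 0 0] by simp_all

lemma ip_minus_left: "ip (- x) y = - ip x y" and ip_minus_right: "ip x (- y) = - ip x y"
  using ip_scaleR_left[of "-1" x y] ip_scaleR_right[of x "-1" y] by simp_all

lemma ip_diff_left: "ip (x - y) z = ip x z - ip y z"
  using ip_add_left[of x "- y" z] by (simp add: ip_minus_left)

lemma ip_diff_right: "ip x (y - z) = ip x y - ip x z"
  using ip_add_right[of x y "- z"] by (simp add: ip_minus_right)

lemma ip_sum_right: "ip x (\<Sum>i\<in>I. f i) = (\<Sum>i\<in>I. ip x (f i))"
  by (induction I rule: infinite_finite_induct) (simp_all add: ip_add_right)

lemma norm_diff_sq: "(norm (x - y))\<^sup>2 = (norm x)\<^sup>2 - 2 * Re (ip x y) + (norm y)\<^sup>2"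
proof -
  have "of_real ((norm (x - y))\<^sup>2)
      = of_real ((norm x)\<^sup>2) - ip x y - cnj (ip x y) + (of_real ((norm y)\<^sup>2) :: complex)"
    unfolding ip_self[symmetric] ip_diff_left ip_diff_right using ip_commute[of x y] by simp
  from arg_cong[OF this, of Re] show ?thesis by simp
qed

lemma norm_add_sq: "(norm (x + y))\<^sup>2 = (norm x)\<^sup>2 + 2 * Re (ip x y) + (norm y)\<^sup>2"
  using norm_diff_sq[of x "- y"] by (simp add: ip_minus_right)

lemma norm_sc:
  assumes "a \<in> K" shows "norm (sc a x) = cmod a * norm x"
proof -
  have "of_real ((norm (sc a x))\<^sup>2) = (a * cnj a) * (of_real ((norm x)\<^sup>2) :: complex)"
    unfolding ip_self[symmetric] by (simp add: ip_sc_left ip_sc_right assms)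
  also have "\<dots> = of_real ((cmod a * norm x)\<^sup>2)"
    by (simp add: complex_norm_square[symmetric] power_mult_distrib)
  finally have "(norm (sc a x))\<^sup>2 = (cmod a * norm x)\<^sup>2"
    by (simp only: of_real_eq_iff)
  then show ?thesis by (metis norm_ge_zero power2_eq_imp_eq zero_le_mult_iff)
qed

lemma cauchy_schwarz: "cmod (ip x y) \<le> norm x * norm y"
proof (cases "y = 0")
  case False
  \<comment> \<open>The orthogonal projection of \<open>x\<close> onto the span of \<open>y\<close> is \<open>a\<close> times \<open>y\<close>.\<close>
  define a where "a = ip x y / of_real ((norm y)\<^sup>2)"
  have aK: "a \<in> K"
    using real_or_complex ip_in_K[of x y] unfolding a_def by (auto intro: Reals_divide)
  have c: "cnj a * ip x y = of_real ((cmod (ip x y))\<^sup>2 / (norm y)\<^sup>2)"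
    by (simp add: a_def complex_norm_square[symmetric] mult.commute)
  have "0 \<le> (norm (x - sc a y))\<^sup>2" by simp
  also have "\<dots> = (norm x)\<^sup>2 - 2 * ((cmod (ip x y))\<^sup>2 / (norm y)\<^sup>2) + (cmod a * norm y)\<^sup>2"
    unfolding norm_diff_sq ip_sc_right[OF aK] norm_sc[OF aK] c by (simp only: Re_complex_of_real)
  also have "(cmod a * norm y)\<^sup>2 = (cmod (ip x y))\<^sup>2 / (norm y)\<^sup>2"
    using False by (simp add: a_def norm_divide power2_eq_square norm_mult)
  finally have "(cmod (ip x y))\<^sup>2 \<le> (norm x * norm y)\<^sup>2"
    using False by (simp add: field_simps power_mult_distrib)
  then show ?thesis by (rule power2_le_imp_le) simp
qed simp

lemma bounded_linear_ip_right: "bounded_linear (ip x)"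
proof (rule bounded_linear_intro[of _ "norm x"])
  show "cmod (ip x y) \<le> norm y * norm x" for y using cauchy_schwarz[of x y] by (simp add: mult.commute)
qed (simp_all add: ip_add_right ip_scaleR_right scaleR_conv_of_real)

lemma norm_le_ip:
  assumes "\<And>z. cmod (ip z v) \<le> C * norm z" "0 \<le> C" shows "norm v \<le> C"
proof (cases "v = 0")
  case False
  have "norm v * norm v \<le> C * norm v"
    using assms(1)[of v] by (simp add: ip_self norm_power power2_eq_square norm_mult)
  with False show ?thesis by simp
qed (use assms in simp)

lemma ip_eqI:
  assumes "\<And>z. ip z u = ip z v" shows "u = v"
proof -
  have "norm (u - v) \<le> 0" by (rule norm_le_ip) (simp_all add: ip_diff_right assms)
  then show ?thesis by simp
qed

text \<open>
  The representing vector minimises \<open>q x = \<parallel>x\<parallel>\<^sup>2 - 2 G x\<close>. By the parallelogram law a minimising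
  sequence is Cauchy, and since \<open>q\<close> is stationary at the minimum \<open>v\<close>, its derivative
  \<open>2 (Re (x, v) - G x)\<close> in every direction \<open>x\<close> vanishes.
\<close>

lemma real_functional_representable:
  assumes G: "bounded_linear (G :: 'x \<Rightarrow> real)"
  shows "\<exists>v. \<forall>x. G x = Re (ip x v)"
proof -
  interpret G: bounded_linear G by (rule G)
  obtain C where C: "\<And>x. norm (G x) \<le> norm x * C" "0 \<le> C"
    using G.nonneg_bounded by blast
  define q where "q x = (norm x)\<^sup>2 - 2 * G x" for x
  have low: "- (C\<^sup>2) \<le> q x" for x
  proof -
    have "0 \<le> (norm x - C)\<^sup>2" by simp
    then show ?thesis using C(1)[of x] by (simp add: q_def power2_diff abs_le_iff)
  qed
  have bdd: "bdd_below (range q)" using low by (intro bdd_belowI[of _ "- (C\<^sup>2)"]) auto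
  define m where "m = (INF x. q x)"
  have mle: "m \<le> q x" for x unfolding m_def by (rule cINF_lower[OF bdd]) simp
  have "\<exists>x. q x < m + 1 / real (Suc n)" for n
    using cINF_less_iff[OF _ bdd, of "m + 1 / real (Suc n)"] by (auto simp: m_def)
  then obtain s where s: "\<And>n. q (s n) < m + 1 / real (Suc n)" by metis
  \<comment> \<open>The parallelogram law at the midpoint, where \<open>q\<close> is at least its infimum \<open>m\<close>.\<close>
  have par: "(norm (x - y))\<^sup>2 \<le> 2 * q x + 2 * q y - 4 * m" for x y
  proof -
    have "4 * (norm ((1/2) *\<^sub>R (x + y)))\<^sup>2 = (norm (x + y))\<^sup>2"
      by (simp only: norm_scaleR power_mult_distrib) (simp add: power2_eq_square)
    then have "4 * q ((1/2) *\<^sub>R (x + y)) = (norm (x + y))\<^sup>2 - 4 * G x - 4 * G y"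
      unfolding q_def G.scaleR G.add by (simp add: field_simps del: scaleR_add_right)
    then show ?thesis using mle[of "(1/2) *\<^sub>R (x + y)"]
      by (simp add: q_def norm_diff_sq norm_add_sq)
  qed
  have "Cauchy s"
  proof (rule CauchyI)
    fix e :: real assume e: "0 < e"
    then obtain N where N: "inverse (real (Suc N)) < e\<^sup>2 / 4"
      using reals_Archimedean[of "e\<^sup>2 / 4"] by auto
    have "norm (s i - s j) < e" if "N \<le> i" "N \<le> j" for i j
    proof -
      have "q (s k) < m + e\<^sup>2 / 4" if "N \<le> k" for k
      proof -
        have "1 / real (Suc k) \<le> 1 / real (Suc N)" using that by (simp add: frac_le)
        with s[of k] N show ?thesis by (simp add: inverse_eq_divide)
      qed
      from this[OF that(1)] this[OF that(2)] par[of "s i" "s j"]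
      have "(norm (s i - s j))\<^sup>2 < e\<^sup>2" by linarith
      then show ?thesis by (rule power2_less_imp_less) (use e in simp)
    qed
    then show "\<exists>N. \<forall>i\<ge>N. \<forall>j\<ge>N. norm (s i - s j) < e" by blast
  qed
  then obtain v where v: "s \<longlonglongrightarrow> v" using convergent_eq_Cauchy convergent_def by blast
  have "(\<lambda>n. q (s n)) \<longlonglongrightarrow> q v" unfolding q_def by (intro tendsto_intros G.tendsto v)
  moreover have "(\<lambda>n. m + 1 / real (Suc n)) \<longlonglongrightarrow> m + 0"
    by (intro tendsto_add tendsto_const LIMSEQ_inverse_real_of_nat[unfolded inverse_eq_divide])
  ultimately have qv: "q v \<le> m"
    using s by (intro LIMSEQ_le[of _ _ _ m]) (auto intro: less_imp_le)
  have "G x = Re (ip x v)" for x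
  proof -
    have "0 \<le> 2 * t * (Re (ip x v) - G x) + t\<^sup>2 * (norm x)\<^sup>2" for t :: real
    proof -
      have "q v \<le> q (t *\<^sub>R x + v)" using qv mle[of "t *\<^sub>R x + v"] by linarith
      also have "\<dots> = q v + 2 * t * (Re (ip x v) - G x) + t\<^sup>2 * (norm x)\<^sup>2"
        unfolding q_def norm_add_sq G.add G.scaleR ip_scaleR_left
        by (simp add: algebra_simps power_mult_distrib)
      finally show ?thesis by simp
    qed
    from linear_term_vanishes[OF this] show ?thesis by simp
  qed
  then show ?thesis by blast
qed

text \<open>
  The real part of a \<open>K\<close>-linear functional determines the functional: over the reals there is nothing
  else, and over the complex numbers the imaginary part at \<open>x\<close> is the real part at \<open>- \<i> x\<close>.
\<close>

lemma functional_representable: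
  assumes add: "\<And>x y. F (x + y) = F x + F y"
    and sc: "\<And>a x. a \<in> K \<Longrightarrow> F (sc a x) = a * F x"
    and FK: "\<And>x. F x \<in> K"
    and bound: "\<And>x. cmod (F x) \<le> C * norm x"
  shows "\<exists>v. \<forall>x. F x = ip x v"
proof -
  have "bounded_linear (\<lambda>x. Re (F x))"
  proof (rule bounded_linear_intro[of _ C])
    show "Re (F (r *\<^sub>R x)) = r *\<^sub>R Re (F x)" for r x
      using sc[OF of_real_in_K, of r x] by (simp add: sc_of_real)
    show "norm (Re (F x)) \<le> norm x * C" for x
      using order_trans[OF abs_Re_le_cmod bound[of x]] by (simp add: mult.commute)
  qed (simp add: add)
  from real_functional_representable[OF this] obtain v where v: "\<And>x. Re (F x) = Re (ip x v)" by blast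
  have "Im (F x) = Im (ip x v)" for x
    using real_or_complex
  proof
    assume "K = \<real>"
    then show ?thesis using FK[of x] ip_in_K[of x v] by (simp add: complex_is_Real_iff)
  next
    assume K: "K = UNIV"
    show ?thesis using v[of "sc (- \<i>) x"] sc[of "- \<i>" x] ip_sc_left[of "- \<i>" x v] K by simp
  qed
  with v show ?thesis by (metis complex_eqI)
qed

end

section \<open>The variation of a vector measure is a measure\<close>

lemma cabv_sums:
  assumes "\<mu> \<in> cabv" "range A \<subseteq> sets borel" "disjoint_family A"
  shows "(\<lambda>n. \<mu> (A n)) sums \<mu> (\<Union>n::nat. A n)"
  using assms unfolding cabv_def by blast

lemma cabv_off_borel: "\<mu> \<in> cabv \<Longrightarrow> A \<notin> sets borel \<Longrightarrow> \<mu> A = 0"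
  unfolding cabv_def by blast

lemma cabv_empty [simp]:
  assumes "\<mu> \<in> cabv" shows "\<mu> {} = 0"
proof -
  have "(\<lambda>n::nat. \<mu> {}) sums \<mu> {}"
    using cabv_sums[OF assms, of "\<lambda>_. {}"] by (simp add: disjoint_family_on_def)
  from summable_LIMSEQ_zero[OF sums_summable[OF this]] show ?thesis
    by (simp add: LIMSEQ_const_iff)
qed

lemma cabv_Un:
  assumes "\<mu> \<in> cabv" "A \<in> sets borel" "B \<in> sets borel" "A \<inter> B = {}"
  shows "\<mu> (A \<union> B) = \<mu> A + \<mu> B"
proof -
  have "(\<lambda>n. \<mu> (binaryset A B n)) sums \<mu> (\<Union>n. binaryset A B n)"
    using assms(2-4) by (intro cabv_sums[OF assms(1)])
      (auto simp: range_binaryset_eq disjoint_family_on_def binaryset_def)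
  moreover have "(\<lambda>n. \<mu> (binaryset A B n)) sums (\<mu> A + \<mu> B)"
    by (rule binaryset_sums) (simp add: assms(1))
  ultimately show ?thesis by (simp add: UN_binaryset_eq sums_unique2)
qed

lemma cabv_finite_UN:
  assumes "\<mu> \<in> cabv" "finite I" "disjoint_family_on B I" "\<And>i. i \<in> I \<Longrightarrow> B i \<in> sets borel"
  shows "\<mu> (\<Union>i\<in>I. B i) = (\<Sum>i\<in>I. \<mu> (B i))"
  using assms(2-4)
proof (induction I)
  case (insert i I)
  have "\<mu> (B i \<union> (\<Union>j\<in>I. B j)) = \<mu> (B i) + \<mu> (\<Union>j\<in>I. B j)"
    using insert.prems insert.hyps
    by (intro cabv_Un[OF assms(1)]) (auto simp: disjoint_family_on_def intro!: sets.finite_UN)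
  with insert show ?case by (simp add: disjoint_family_on_def)
qed (simp add: assms(1))

lemma sum_norm_le_variation:
  assumes "\<mu> \<in> cabv" "finite I" "disjoint_family_on B I" "\<And>i. i \<in> I \<Longrightarrow> B i \<in> sets borel"
  shows "(\<Sum>i\<in>I. ennreal (norm (\<mu> (B i)))) \<le> variation \<mu> (\<Union>i\<in>I. B i)"
proof -
  have "(\<Sum>i\<in>I. ennreal (norm (\<mu> (B i)))) = (\<Sum>C\<in>B ` I. ennreal (norm (\<mu> C)))"
  proof (rule sum.reindex_nontrivial[symmetric, unfolded comp_def])
    fix i j assume "i \<in> I" "j \<in> I" "i \<noteq> j" "B i = B j"
    with assms(3) have "B i = {}" unfolding disjoint_family_on_def by blast
    then show "ennreal (norm (\<mu> (B i))) = 0" by (simp add: assms(1))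
  qed (rule assms(2))
  also have "\<dots> \<le> variation \<mu> (\<Union>i\<in>I. B i)"
    unfolding variation_def using assms
    by (intro SUP_upper) (auto intro: disjoint_family_on_disjoint_image)
  finally show ?thesis .
qed

text \<open>
  Partitions of two disjoint sets combine to a partition of their union; only the empty set can
  belong to both of them, and it has measure zero.
\<close>

lemma variation_superadditive:
  assumes "\<mu> \<in> cabv" "A \<in> sets borel" "B \<in> sets borel" and AB: "A \<inter> B = {}"
  shows "variation \<mu> A + variation \<mu> B \<le> variation \<mu> (A \<union> B)"
proof -
  let ?S = "\<lambda>P. \<Sum>C\<in>P. ennreal (norm (\<mu> C))"
  let ?P = "\<lambda>A. {P. finite P \<and> P \<subseteq> sets borel \<and> disjoint P \<and> \<Union>P = A}"
  have single: "{C} \<in> ?P C" if "C \<in> sets borel" for C using that by simp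
  have ne: "?P A \<noteq> {}" "?P B \<noteq> {}"
    using single[OF assms(2)] single[OF assms(3)] by (metis emptyE)+
  have pq: "?S P + ?S Q \<le> variation \<mu> (A \<union> B)" if P': "P \<in> ?P A" and Q': "Q \<in> ?P B" for P Q
  proof -
    have P: "finite P" "P \<subseteq> sets borel" "disjoint P" "\<Union>P = A" using P' by simp_all
    have Q: "finite Q" "Q \<subseteq> sets borel" "disjoint Q" "\<Union>Q = B" using Q' by simp_all
    have "\<mu> C = 0" if "C \<in> P \<inter> Q" for C
    proof -
      have "C \<subseteq> A" "C \<subseteq> B" using that P(4) Q(4) by auto
      with AB have "C = {}" by blast
      then show ?thesis using assms(1) by simp
    qed
    then have "?S P + ?S Q = ?S (P \<union> Q)"
      using P(1) Q(1) by (intro sum.union_inter_neutral[symmetric]) simp_all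
    also have "\<dots> \<le> variation \<mu> (A \<union> B)"
      unfolding variation_def
    proof (rule SUP_upper, intro CollectI conjI)
      show "disjoint (P \<union> Q)" using P(3,4) Q(3,4) AB by (intro disjoint_union) simp_all
      show "\<Union>(P \<union> Q) = A \<union> B" using P(4) Q(4) by (simp only: Union_Un_distrib)
    qed (use P Q in simp_all)
    finally show ?thesis .
  qed
  have "?S P + variation \<mu> B \<le> variation \<mu> (A \<union> B)" if P: "P \<in> ?P A" for P
    unfolding variation_def[of _ B] ennreal_SUP_add_right[OF ne(2)]
    using pq[OF P] by (intro SUP_least)
  then show ?thesis
    unfolding variation_def[of _ A] ennreal_SUP_add_left[OF ne(1), symmetric] by (intro SUP_least)
qed

lemma variation_mono:
  assumes "\<mu> \<in> cabv" "A \<in> sets borel" "B \<in> sets borel" "A \<subseteq> B"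
  shows "variation \<mu> A \<le> variation \<mu> B"
proof -
  have "variation \<mu> A \<le> variation \<mu> A + variation \<mu> (B - A)" by simp
  also have "\<dots> \<le> variation \<mu> (A \<union> (B - A))"
    using assms by (intro variation_superadditive) auto
  finally show ?thesis using assms(4) by (simp add: Un_absorb1)
qed

lemma variation_empty:
  assumes "\<mu> \<in> cabv" shows "variation (\<mu> :: 'a::topological_space set \<Rightarrow> 'b::real_normed_vector) {} = 0"
proof -
  have "variation \<mu> {} \<le> 0"
    unfolding variation_def
  proof (rule SUP_least, clarify)
    fix P :: "'a set set" assume "\<Union>P = {}"
    then have "\<forall>C\<in>P. \<mu> C = 0" using assms by auto
    then show "(\<Sum>C\<in>P. ennreal (norm (\<mu> C))) \<le> 0" by simp
  qed
  then show ?thesis by simp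
qed

lemma norm_sums_le_suminf:
  fixes f :: "nat \<Rightarrow> 'x::real_normed_vector"
  assumes "f sums s"
  shows "ennreal (norm s) \<le> (\<Sum>n. ennreal (norm (f n)))"
proof (rule LIMSEQ_le_const2)
  show "(\<lambda>n. ennreal (norm (\<Sum>i<n. f i))) \<longlonglongrightarrow> ennreal (norm s)"
    using assms unfolding sums_def by (intro tendsto_ennrealI tendsto_norm)
  have "ennreal (norm (\<Sum>i<n. f i)) \<le> (\<Sum>n. ennreal (norm (f n)))" for n
  proof -
    have "ennreal (norm (\<Sum>i<n. f i)) \<le> ennreal (\<Sum>i<n. norm (f i))"
      by (intro ennreal_leI norm_sum)
    also have "\<dots> = (\<Sum>i<n. ennreal (norm (f i)))" by simp
    also have "\<dots> \<le> (\<Sum>n. ennreal (norm (f n)))" by (rule sum_le_suminf) auto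
    finally show ?thesis .
  qed
  then show "\<exists>N. \<forall>n\<ge>N. ennreal (norm (\<Sum>i<n. f i)) \<le> (\<Sum>n. ennreal (norm (f n)))" by blast
qed

text \<open>
  Superadditivity and monotonicity bound the partial sums by the variation of the union. Conversely,
  a partition of the union is cut by the sets \<open>A n\<close>, and the norm of a convergent series is at most
  the sum of the norms, so exchanging the two sums gives the other inequality.
\<close>

lemma countably_additive_variation:
  assumes mu: "\<mu> \<in> cabv"
  shows "countably_additive (sets borel) (variation \<mu>)"
  unfolding countably_additive_def
proof (intro allI impI antisym)
  fix A :: "nat \<Rightarrow> 'a set"
  assume A: "range A \<subseteq> sets borel" and dA: "disjoint_family A" and U: "(\<Union>i. A i) \<in> sets borel"
  have Ai: "A i \<in> sets borel" for i using A by blast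
  have Un: "(\<Union>i<n. A i) \<inter> A n = {}" for n
    using disjoint_family_onD[OF dA] by (auto simp: set_eq_iff) (metis UNIV_I IntI empty_iff less_irrefl)
  have part: "(\<Sum>i<n. variation \<mu> (A i)) \<le> variation \<mu> (\<Union>i<n. A i)" for n
  proof (induction n)
    case (Suc n)
    have "(\<Sum>i<Suc n. variation \<mu> (A i)) \<le> variation \<mu> (\<Union>i<n. A i) + variation \<mu> (A n)"
      using Suc by (simp add: add_right_mono)
    also have "\<dots> \<le> variation \<mu> ((\<Union>i<n. A i) \<union> A n)"
      using Ai Un[of n] by (intro variation_superadditive[OF mu]) auto
    also have "(\<Union>i<n. A i) \<union> A n = (\<Union>i<Suc n. A i)" by (auto simp: lessThan_Suc)
    finally show ?case .
  qed simp
  show "(\<Sum>i. variation \<mu> (A i)) \<le> variation \<mu> (\<Union>i. A i)"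
  proof (rule suminf_le_const)
    fix n
    have "variation \<mu> (\<Union>i<n. A i) \<le> variation \<mu> (\<Union>i. A i)"
      using Ai by (intro variation_mono[OF mu]) auto
    with part[of n] show "(\<Sum>i<n. variation \<mu> (A i)) \<le> variation \<mu> (\<Union>i. A i)" by (rule order_trans)
  qed simp
  show "variation \<mu> (\<Union>i. A i) \<le> (\<Sum>i. variation \<mu> (A i))"
    unfolding variation_def[of _ "\<Union>i. A i"]
  proof (rule SUP_least, clarify)
    fix P assume P: "finite P" "P \<subseteq> sets borel" "disjoint P" "\<Union>P = (\<Union>i. A i)"
    have dP: "C \<inter> D = {}" if "C \<in> P" "D \<in> P" "C \<noteq> D" for C D
      using P(3) that by (rule disjointD)
    have "(\<Sum>C\<in>P. ennreal (norm (\<mu> C))) \<le> (\<Sum>C\<in>P. \<Sum>n. ennreal (norm (\<mu> (C \<inter> A n))))"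
    proof (rule sum_mono)
      fix C assume C: "C \<in> P"
      have "disjoint_family (\<lambda>n. C \<inter> A n)"
        using dA unfolding disjoint_family_on_def by blast
      then have "(\<lambda>n. \<mu> (C \<inter> A n)) sums \<mu> (\<Union>n. C \<inter> A n)"
        using C P(2) Ai by (intro cabv_sums[OF mu]) auto
      moreover have "(\<Union>n. C \<inter> A n) = C" using C P(4) by auto
      ultimately show "ennreal (norm (\<mu> C)) \<le> (\<Sum>n. ennreal (norm (\<mu> (C \<inter> A n))))"
        using norm_sums_le_suminf by metis
    qed
    also have "\<dots> = (\<Sum>n. \<Sum>C\<in>P. ennreal (norm (\<mu> (C \<inter> A n))))"
      by (rule suminf_sum[symmetric]) simp
    also have "\<dots> \<le> (\<Sum>n. variation \<mu> (A n))"
    proof (rule suminf_le)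
      fix n
      have "(\<Sum>C\<in>P. ennreal (norm (\<mu> (C \<inter> A n)))) \<le> variation \<mu> (\<Union>C\<in>P. C \<inter> A n)"
      proof (rule sum_norm_le_variation[OF mu P(1)])
        show "disjoint_family_on (\<lambda>C. C \<inter> A n) P"
          unfolding disjoint_family_on_def using dP by blast
        show "C \<inter> A n \<in> sets borel" if "C \<in> P" for C using that P(2) Ai by auto
      qed
      also have "(\<Union>C\<in>P. C \<inter> A n) = A n" using P(4) by auto
      finally show "(\<Sum>C\<in>P. ennreal (norm (\<mu> (C \<inter> A n)))) \<le> variation \<mu> (A n)" .
    qed simp_all
    finally show "(\<Sum>C\<in>P. ennreal (norm (\<mu> C))) \<le> (\<Sum>n. variation \<mu> (A n))" .
  qed
qed

definition variation_measure ::
    "('t::topological_space set \<Rightarrow> 'x::real_normed_vector) \<Rightarrow> 't measure" where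
  "variation_measure \<mu> = measure_of UNIV (sets borel) (variation \<mu>)"

lemma sets_variation_measure [simp, measurable_cong]: "sets (variation_measure \<mu>) = sets borel"
  and space_variation_measure [simp]: "space (variation_measure \<mu>) = UNIV"
  using sets.space_closed[of borel]
  by (simp_all add: variation_measure_def sets.sigma_sets_eq[of borel, unfolded space_borel])

lemma emeasure_variation_measure:
  assumes "\<mu> \<in> cabv" "A \<in> sets borel"
  shows "emeasure (variation_measure \<mu>) A = variation \<mu> A"
  using assms countably_additive_variation[OF assms(1)] sets.sigma_sets_eq[of borel, unfolded space_borel]
  by (intro emeasure_measure_of[OF variation_measure_def])
    (auto simp: positive_def variation_empty)

lemma finite_variation_measure:
  assumes "\<mu> \<in> cabv" shows "finite_measure (variation_measure \<mu>)"
proof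
  show "emeasure (variation_measure \<mu>) (space (variation_measure \<mu>)) \<noteq> \<infinity>"
    using assms unfolding cabv_def by (simp add: emeasure_variation_measure[OF assms] less_imp_neq)
qed

lemma norm_le_variation_measure:
  assumes "\<mu> \<in> cabv" "A \<in> sets borel"
  shows "norm (\<mu> A) \<le> measure (variation_measure \<mu>) A"
proof -
  interpret finite_measure "variation_measure \<mu>" using assms(1) by (rule finite_variation_measure)
  have "ennreal (norm (\<mu> A)) \<le> emeasure (variation_measure \<mu>) A"
    using sum_norm_le_variation[OF assms(1), of "{A}" "\<lambda>x. x"] assms
    by (simp add: emeasure_variation_measure disjoint_family_on_def)
  then show ?thesis by (simp add: emeasure_eq_measure)
qed

text \<open>
  Domination by a finite measure turns finite into countable additivity: the remainder of the
  series is the measure of a set whose dominating measure tends to zero.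
\<close>

lemma cabvI:
  fixes \<nu> :: "'t::topological_space set \<Rightarrow> 'x::real_normed_vector"
  assumes off: "\<And>A. A \<notin> sets borel \<Longrightarrow> \<nu> A = 0"
    and add: "\<And>A B. A \<in> sets borel \<Longrightarrow> B \<in> sets borel \<Longrightarrow> A \<inter> B = {} \<Longrightarrow> \<nu> (A \<union> B) = \<nu> A + \<nu> B"
    and L: "finite_measure L" "sets L = sets borel"
    and bound: "\<And>A. A \<in> sets borel \<Longrightarrow> norm (\<nu> A) \<le> measure L A"
  shows "\<nu> \<in> cabv"
proof -
  interpret finite_measure L by (rule L)
  have empty: "\<nu> {} = 0" using add[of "{}" "{}"] by simp
  have "(\<lambda>n. \<nu> (A n)) sums \<nu> (\<Union>n. A n)"
    if A: "range A \<subseteq> sets borel" and dA: "disjoint_family A" for A :: "nat \<Rightarrow> 't set"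
  proof -
    have Ai: "A i \<in> sets borel" for i using A by blast
    have Un: "(\<Union>i<n. A i) \<inter> A n = {}" for n
      using disjoint_family_onD[OF dA] by (auto simp: set_eq_iff) (metis UNIV_I IntI empty_iff less_irrefl)
    have part: "(\<Sum>i<n. \<nu> (A i)) = \<nu> (\<Union>i<n. A i)" for n
    proof (induction n)
      case (Suc n)
      have "\<nu> ((\<Union>i<n. A i) \<union> A n) = \<nu> (\<Union>i<n. A i) + \<nu> (A n)"
        using Ai Un[of n] by (intro add) auto
      moreover have "(\<Union>i<n. A i) \<union> A n = (\<Union>i<Suc n. A i)" by (auto simp: lessThan_Suc)
      ultimately show ?case using Suc by simp
    qed (simp add: empty)
    have tail: "norm (\<nu> (\<Union>n. A n) - (\<Sum>i<n. \<nu> (A i)))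
        \<le> measure L (\<Union>n. A n) - (\<Sum>i<n. measure L (A i))" for n
    proof -
      let ?B = "\<Union>i<n. A i" and ?U = "\<Union>n. A n"
      have B: "?B \<in> sets borel" "?U \<in> sets borel" "?B \<subseteq> ?U" using Ai by auto
      have "\<nu> (?B \<union> (?U - ?B)) = \<nu> ?B + \<nu> (?U - ?B)" using B by (intro add) auto
      moreover have "?B \<union> (?U - ?B) = ?U" by auto
      ultimately have "norm (\<nu> ?U - (\<Sum>i<n. \<nu> (A i))) = norm (\<nu> (?U - ?B))" by (simp add: part)
      also have "\<dots> \<le> measure L (?U - ?B)" using B by (intro bound) auto
      also have "\<dots> = measure L ?U - measure L ?B"
        using B L(2) by (intro finite_measure_Diff) auto
      also have "measure L ?B = (\<Sum>i<n. measure L (A i))"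
        using Ai L(2) dA by (intro finite_measure_finite_Union)
          (auto simp: disjoint_family_on_def)
      finally show ?thesis .
    qed
    have "(\<lambda>i. measure L (A i)) sums measure L (\<Union>i. A i)"
      using A L(2) dA by (intro finite_measure_UNION) auto
    then have "(\<lambda>n. measure L (\<Union>n. A n) - (\<Sum>i<n. measure L (A i))) \<longlonglongrightarrow> 0"
      unfolding sums_def by (auto intro: tendsto_eq_intros)
    then have "(\<lambda>n. \<nu> (\<Union>n. A n) - (\<Sum>i<n. \<nu> (A i))) \<longlonglongrightarrow> 0"
      by (rule Lim_null_comparison[rotated]) (simp add: tail)
    from tendsto_diff[OF tendsto_const[of "\<nu> (\<Union>n. A n)"] this] show ?thesis
      unfolding sums_def by simp
  qed
  moreover have "variation \<nu> UNIV \<le> ennreal (measure L UNIV)"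
    unfolding variation_def
  proof (rule SUP_least, clarify)
    fix P :: "'t set set" assume P: "finite P" "P \<subseteq> sets borel" "disjoint P" "\<Union>P = UNIV"
    have "(\<Sum>B\<in>P. ennreal (norm (\<nu> B))) \<le> (\<Sum>B\<in>P. ennreal (measure L B))"
      using P bound by (intro sum_mono ennreal_leI) auto
    also have "\<dots> = ennreal (\<Sum>B\<in>P. measure L B)" by simp
    also have "(\<Sum>B\<in>P. measure L B) = measure L (\<Union>B\<in>P. B)"
      using P L(2) by (intro finite_measure_finite_Union[symmetric])
        (auto simp: disjoint_family_on_def disjoint_def)
    finally show "(\<Sum>B\<in>P. ennreal (norm (\<nu> B))) \<le> ennreal (measure L UNIV)" using P(4) by simp
  qed
  ultimately show ?thesis
    unfolding cabv_def using off by (auto intro: le_less_trans)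
qed

text \<open>
  The vector space operations preserve convergence of series and are dominated by the norms of their
  arguments, so this covers both sums and scalar multiples of measures.
\<close>

lemma cabv_dominated:
  fixes \<kappa> :: "'t::topological_space set \<Rightarrow> 'x::real_normed_vector"
  assumes "\<mu> \<in> cabv" "\<nu> \<in> cabv"
    and off: "\<And>A. A \<notin> sets borel \<Longrightarrow> \<kappa> A = 0"
    and sums: "\<And>A :: nat \<Rightarrow> 't set. (\<lambda>n. \<mu> (A n)) sums \<mu> (\<Union>n. A n) \<Longrightarrow>
        (\<lambda>n. \<nu> (A n)) sums \<nu> (\<Union>n. A n) \<Longrightarrow> (\<lambda>n. \<kappa> (A n)) sums \<kappa> (\<Union>n. A n)"
    and bound: "\<And>A. norm (\<kappa> A) \<le> c * (norm (\<mu> A) + norm (\<nu> A))" and c: "0 \<le> c"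
  shows "\<kappa> \<in> cabv"
proof -
  interpret V: finite_measure "variation_measure \<mu>" using assms(1) by (rule finite_variation_measure)
  interpret W: finite_measure "variation_measure \<nu>" using assms(2) by (rule finite_variation_measure)
  let ?V = "measure (variation_measure \<mu>)" and ?W = "measure (variation_measure \<nu>)"
  have "variation \<kappa> UNIV \<le> ennreal (c * (?V UNIV + ?W UNIV))"
    unfolding variation_def
  proof (rule SUP_least, clarify)
    fix P :: "'t set set" assume P: "finite P" "P \<subseteq> sets borel" "disjoint P" "\<Union>P = UNIV"
    have d: "disjoint_family_on (\<lambda>B. B) P" using P(3) by (auto simp: disjoint_family_on_def disjoint_def)
    have "norm (\<kappa> B) \<le> c * (?V B + ?W B)" if "B \<in> P" for B
      using that P(2) assms(1,2) c
      by (intro order_trans[OF bound] mult_left_mono add_mono norm_le_variation_measure) auto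
    then have "(\<Sum>B\<in>P. ennreal (norm (\<kappa> B))) \<le> (\<Sum>B\<in>P. ennreal (c * (?V B + ?W B)))"
      by (intro sum_mono ennreal_leI)
    also have "\<dots> = ennreal (c * ((\<Sum>B\<in>P. ?V B) + (\<Sum>B\<in>P. ?W B)))"
      using c by (subst sum_ennreal) (simp_all add: sum_distrib_left sum.distrib distrib_left)
    also have "(\<Sum>B\<in>P. ?V B) = ?V (\<Union>B\<in>P. B)"
      using P d by (intro V.finite_measure_finite_Union[symmetric]) auto
    also have "(\<Sum>B\<in>P. ?W B) = ?W (\<Union>B\<in>P. B)"
      using P d by (intro W.finite_measure_finite_Union[symmetric]) auto
    finally show "(\<Sum>B\<in>P. ennreal (norm (\<kappa> B))) \<le> ennreal (c * (?V UNIV + ?W UNIV))"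
      using P(4) by simp
  qed
  then have "variation \<kappa> UNIV < \<infinity>" by (rule le_less_trans) simp
  then show ?thesis
    unfolding cabv_def using off sums cabv_sums[OF assms(1)] cabv_sums[OF assms(2)] by blast
qed

lemma cabv_add:
  assumes "\<mu> \<in> cabv" "\<nu> \<in> cabv" shows "(\<lambda>A. \<mu> A + \<nu> A) \<in> cabv"
proof (rule cabv_dominated[OF assms, where c = 1])
  show "\<mu> A + \<nu> A = 0" if "A \<notin> sets borel" for A
    using cabv_off_borel[OF assms(1) that] cabv_off_borel[OF assms(2) that] by simp
  show "norm (\<mu> A + \<nu> A) \<le> 1 * (norm (\<mu> A) + norm (\<nu> A))" for A
    using norm_triangle_ineq by simp
qed (auto intro: sums_add)

section \<open>Totally measurable functions\<close>

text \<open>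
  The functions for which the uniform integral is defined. They form a vector space even if the
  sum of two Borel measurable functions into the codomain is not measurable.
\<close>

definition tot_measurable :: "('t::topological_space \<Rightarrow> 'x::real_normed_vector) \<Rightarrow> bool" where
  "tot_measurable f \<longleftrightarrow>
     (\<exists>s. (\<forall>n::nat. simple_function borel (s n)) \<and> uniform_limit UNIV s f sequentially)"

lemma tot_measurableI:
  assumes "\<And>e. 0 < e \<Longrightarrow> \<exists>s. simple_function borel s \<and> (\<forall>t. norm (f t - s t) \<le> e)"
  shows "tot_measurable f"
proof -
  have "\<exists>s. simple_function borel s \<and> (\<forall>t. norm (f t - s t) \<le> inverse (real (Suc n)))" for n
    by (rule assms) simp
  then obtain s where s: "\<And>n. simple_function borel (s n)"
      "\<And>n t. norm (f t - s n t) \<le> inverse (real (Suc n))" by metis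
  have "uniform_limit UNIV s f sequentially"
  proof (rule uniform_limitI)
    fix e :: real assume "0 < e"
    then obtain N where N: "inverse (real (Suc N)) < e" using reals_Archimedean by blast
    have "dist (s n t) (f t) < e" if "N \<le> n" for n t
    proof -
      have "inverse (real (Suc n)) \<le> inverse (real (Suc N))" using that by simp
      with s(2)[of t n] N show ?thesis by (simp only: dist_norm norm_minus_commute)
    qed
    then show "\<forall>\<^sub>F n in sequentially. \<forall>t\<in>UNIV. dist (s n t) (f t) < e"
      by (auto simp: eventually_sequentially)
  qed
  with s(1) show ?thesis unfolding tot_measurable_def by blast
qed

lemma tot_measurableD:
  assumes "tot_measurable f" "0 < e"
  obtains s where "simple_function borel s" "\<And>t. norm (f t - s t) \<le> e"
proof -
  obtain s where s: "\<And>n::nat. simple_function borel (s n)" "uniform_limit UNIV s f sequentially"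
    using assms(1) unfolding tot_measurable_def by blast
  from uniform_limitD[OF s(2) assms(2)] obtain n where "\<And>t. dist (s n t) (f t) < e"
    by (auto simp: eventually_sequentially)
  then have "norm (f t - s n t) \<le> e" for t
    by (metis dist_commute dist_norm less_imp_le)
  with s(1) that show thesis by blast
qed

lemma tot_measurable_approx:
  assumes "\<And>e. 0 < e \<Longrightarrow> \<exists>g. tot_measurable g \<and> (\<forall>t. norm (f t - g t) \<le> e)"
  shows "tot_measurable f"
proof (rule tot_measurableI)
  fix e :: real assume "0 < e"
  then have e: "0 < e / 2" by simp
  obtain g where g: "tot_measurable g" "\<And>t. norm (f t - g t) \<le> e / 2" using assms[OF e] by blast
  obtain s where s: "simple_function borel s" "\<And>t. norm (g t - s t) \<le> e / 2"
    using tot_measurableD[OF g(1) e] by blast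
  have "norm (f t - s t) \<le> e" for t
    using norm_triangle_ineq[of "f t - g t" "g t - s t"] g(2)[of t] s(2)[of t] by simp
  with s(1) show "\<exists>s. simple_function borel s \<and> (\<forall>t. norm (f t - s t) \<le> e)" by blast
qed

lemma tot_measurable_simple: "simple_function borel s \<Longrightarrow> tot_measurable s"
  by (rule tot_measurableI) (auto intro!: exI[of _ s])

lemma tot_measurable_lipschitz_compose:
  assumes "tot_measurable f" "C-lipschitz_on UNIV h"
  shows "tot_measurable (\<lambda>t. h (f t))"
proof (rule tot_measurableI)
  fix e :: real assume e: "0 < e"
  have C: "0 \<le> C" using assms(2) by (rule lipschitz_on_nonneg)
  obtain s where s: "simple_function borel s" "\<And>t. norm (f t - s t) \<le> e / (C + 1)"
    using tot_measurableD[OF assms(1), of "e / (C + 1)"] e C by auto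
  have "norm (h (f t) - h (s t)) \<le> e" for t
  proof -
    have "norm (h (f t) - h (s t)) \<le> C * norm (f t - s t)"
      using lipschitz_onD[OF assms(2), of "f t" "s t"] by (simp add: dist_norm)
    also have "\<dots> \<le> C * (e / (C + 1))" by (intro mult_left_mono s C)
    also have "\<dots> \<le> e" using C e by (simp add: field_simps)
    finally show ?thesis .
  qed
  then show "\<exists>s. simple_function borel s \<and> (\<forall>t. norm (h (f t) - s t) \<le> e)"
    using simple_function_compose1[OF s(1), of h] by (intro exI[of _ "\<lambda>t. h (s t)"]) auto
qed

lemma tot_measurable_add:
  assumes "tot_measurable f" "tot_measurable g"
  shows "tot_measurable (\<lambda>t. f t + g t)"
proof (rule tot_measurableI)
  fix e :: real assume "0 < e"
  then have e: "0 < e / 2" by simp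
  obtain s where s: "simple_function borel s" "\<And>t. norm (f t - s t) \<le> e / 2"
    using tot_measurableD[OF assms(1) e] by blast
  obtain u where u: "simple_function borel u" "\<And>t. norm (g t - u t) \<le> e / 2"
    using tot_measurableD[OF assms(2) e] by blast
  have "norm (f t + g t - (s t + u t)) \<le> e" for t
    using norm_triangle_ineq[of "f t - s t" "g t - u t"] s(2)[of t] u(2)[of t]
    by (simp add: algebra_simps)
  then show "\<exists>s. simple_function borel s \<and> (\<forall>t. norm (f t + g t - s t) \<le> e)"
    using simple_function_compose2[OF s(1) u(1), of "(+)"] by (intro exI[of _ "\<lambda>t. s t + u t"]) auto
qed

lemma tot_measurable_minus: "tot_measurable f \<Longrightarrow> tot_measurable (\<lambda>t. - f t)"
  by (rule tot_measurable_lipschitz_compose[where C = 1])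
    (auto intro!: lipschitz_onI simp: dist_norm norm_minus_commute)

lemma tot_measurable_diff:
  "tot_measurable f \<Longrightarrow> tot_measurable g \<Longrightarrow> tot_measurable (\<lambda>t. f t - g t)"
  using tot_measurable_add[OF _ tot_measurable_minus] by fastforce

lemma tot_measurable_sum:
  "(\<And>i. i \<in> I \<Longrightarrow> tot_measurable (f i)) \<Longrightarrow> tot_measurable (\<lambda>t. \<Sum>i\<in>I. f i t)"
proof (induction I rule: infinite_finite_induct)
  case (insert i I)
  then show ?case using tot_measurable_add[of "f i" "\<lambda>t. \<Sum>i\<in>I. f i t"] by simp
qed (simp_all add: tot_measurable_simple)

lemma tot_measurable_borel:
  assumes "tot_measurable f" shows "f \<in> borel_measurable borel"
proof -
  obtain s where s: "\<And>n::nat. simple_function borel (s n)" "uniform_limit UNIV s f sequentially"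
    using assms unfolding tot_measurable_def by blast
  show ?thesis
  proof (rule borel_measurable_LIMSEQ_metric)
    show "s n \<in> borel_measurable borel" for n using s(1) by (rule borel_measurable_simple_function)
    show "(\<lambda>n. s n t) \<longlonglongrightarrow> f t" for t using tendsto_uniform_limitI[OF s(2)] by simp
  qed
qed

lemma tot_measurable_bounded:
  assumes "tot_measurable f" obtains B where "0 \<le> B" "\<And>t. norm (f t) \<le> B"
proof -
  obtain s where s: "simple_function borel s" "\<And>t. norm (f t - s t) \<le> 1"
    using tot_measurableD[OF assms, of 1] by auto
  have fin: "finite (range s)" using simple_functionD(1)[OF s(1)] by simp
  have "norm (f t) \<le> 1 + (\<Sum>x\<in>range s. norm x)" for t
    using norm_triangle_ineq[of "f t - s t" "s t"] s(2)[of t]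
      member_le_sum[OF _ _ fin, of "s t" norm] by simp
  moreover have "0 \<le> 1 + (\<Sum>x\<in>range s. norm x)" by (intro add_nonneg_nonneg sum_nonneg) auto
  ultimately show thesis by (rule that[rotated])
qed

text \<open>
  Each value of the function is replaced by the first centre of a finite net of the compact set that
  is close to it; choosing the first one makes the choice measurable.
\<close>

lemma tot_measurable_compact_range:
  assumes f: "f \<in> borel_measurable borel" and C: "compact C" "range f \<subseteq> C"
  shows "tot_measurable f"
proof (rule tot_measurableI)
  fix e :: real assume e: "0 < e"
  have "C \<subseteq> (\<Union>x\<in>C. ball x e)" using e by auto
  then obtain F where F: "finite F" "C \<subseteq> (\<Union>x\<in>F. ball x e)"
    using compactE_image[OF C(1), of C "\<lambda>x. ball x e"] by (metis open_ball)
  obtain xs where xs: "set xs = F" using finite_list[OF F(1)] by blast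
  define i where "i t = (LEAST i. i < length xs \<and> f t \<in> ball (xs ! i) e)" for t
  have i: "i t < length xs" "f t \<in> ball (xs ! i t) e" for t
  proof -
    have "f t \<in> (\<Union>x\<in>set xs. ball x e)" using C(2) F(2) xs by blast
    then have "\<exists>i. i < length xs \<and> f t \<in> ball (xs ! i) e" by (auto simp: in_set_conv_nth)
    from LeastI_ex[OF this] show "i t < length xs" "f t \<in> ball (xs ! i t) e" by (auto simp: i_def)
  qed
  have "i \<in> measurable borel (count_space UNIV)"
    unfolding i_def
  proof (rule measurable_Least)
    fix k
    have "{t \<in> space borel. f t \<in> ball (xs ! k) e} \<in> sets borel"
      using measurable_sets[OF f, of "ball (xs ! k) e"] by (simp add: vimage_def)
    then have "Measurable.pred borel (\<lambda>t. f t \<in> ball (xs ! k) e)" by (simp add: pred_def)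
    then show "Measurable.pred borel (\<lambda>t. k < length xs \<and> f t \<in> ball (xs ! k) e)" by measurable
  qed
  moreover have "range i \<subseteq> {..<length xs}" using i(1) by auto
  then have "finite (range i)" by (rule finite_subset) simp
  ultimately have "simple_function borel i" by (simp add: simple_function_eq_measurable)
  then have "simple_function borel (\<lambda>t. xs ! i t)" by (rule simple_function_compose1)
  moreover have "norm (f t - xs ! i t) \<le> e" for t
    using i(2)[of t] by (simp add: dist_norm norm_minus_commute less_imp_le)
  ultimately show "\<exists>s. simple_function borel s \<and> (\<forall>t. norm (f t - s t) \<le> e)" by blast
qed

lemma tot_measurable_continuous:
  fixes f :: "'t::topological_space \<Rightarrow> 'x::real_normed_vector"
  assumes "compact (UNIV :: 't set)" "continuous_on UNIV f"
  shows "tot_measurable f"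
  using assms by (intro tot_measurable_compact_range[of f "range f"])
    (auto intro: borel_measurable_continuous_onI compact_continuous_image)

lemma tot_measurable_scaleR:
  fixes g :: "'t::topological_space \<Rightarrow> real" and x :: "'x::real_normed_vector"
  assumes g: "g \<in> borel_measurable borel" and B: "\<And>t. \<bar>g t\<bar> \<le> B"
  shows "tot_measurable (\<lambda>t. g t *\<^sub>R x)"
proof (rule tot_measurable_compact_range)
  have c: "continuous_on UNIV (\<lambda>r::real. r *\<^sub>R x)" by (intro continuous_intros)
  show "(\<lambda>t. g t *\<^sub>R x) \<in> borel_measurable borel"
    by (rule measurable_compose[OF g borel_measurable_continuous_onI[OF c]])
  show "compact ((\<lambda>r. r *\<^sub>R x) ` {- B..B})"
    by (intro compact_continuous_image continuous_on_subset[OF c] compact_Icc subset_UNIV)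
  show "range (\<lambda>t. g t *\<^sub>R x) \<subseteq> (\<lambda>r. r *\<^sub>R x) ` {- B..B}"
    using B by (auto simp: abs_le_iff) (smt (verit) B imageI atLeastAtMost_iff)
qed

lemma tot_measurable_integrable_norm:
  assumes "tot_measurable f" "finite_measure M" "sets M = sets borel"
  shows "integrable M (\<lambda>t. norm (f t))"
proof -
  interpret finite_measure M by (rule assms)
  obtain B where "\<And>t. norm (f t) \<le> B" using tot_measurable_bounded[OF assms(1)] by blast
  moreover have "f \<in> borel_measurable M"
    using tot_measurable_borel[OF assms(1)] measurable_cong_sets[OF assms(3) refl] by blast
  ultimately show ?thesis by (intro integrable_const_bound[of _ B]) auto
qed

section \<open>The sesquilinear uniform integral\<close>

context hilbert_space_over
begin

lemma bounded_linear_sc: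
  assumes "a \<in> K" shows "bounded_linear (sc a)"
proof (rule bounded_linear_intro[of _ "cmod a"])
  show "sc a (x + y) = sc a x + sc a y" for x y using assms by (rule sc_add_right)
  show "sc a (r *\<^sub>R x) = r *\<^sub>R sc a x" for r x
    using sc_sc[OF assms of_real_in_K, of r x] sc_sc[OF of_real_in_K assms, of r x]
    by (simp add: sc_of_real mult.commute)
  show "norm (sc a x) \<le> norm x * cmod a" for x by (simp add: norm_sc[OF assms] mult.commute)
qed

lemma cabv_sc:
  assumes "\<mu> \<in> cabv" "a \<in> K" shows "(\<lambda>A. sc a (\<mu> A)) \<in> cabv"
proof (rule cabv_dominated[OF assms(1) assms(1), where c = "cmod a"])
  show "sc a (\<mu> A) = 0" if "A \<notin> sets borel" for A
    using cabv_off_borel[OF assms(1) that] bounded_linear.linear[OF bounded_linear_sc[OF assms(2)]]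
    by (simp add: linear_0)
  show "norm (sc a (\<mu> A)) \<le> cmod a * (norm (\<mu> A) + norm (\<mu> A))" for A
    by (simp add: norm_sc[OF assms(2)] mult_left_mono)
qed (use bounded_linear.sums[OF bounded_linear_sc[OF assms(2)]] in auto)

lemma tot_measurable_sc:
  assumes "tot_measurable f" "a \<in> K" shows "tot_measurable (\<lambda>t. sc a (f t))"
proof (rule tot_measurable_lipschitz_compose[OF assms(1), where C = "cmod a"])
  interpret bounded_linear "sc a" using assms(2) by (rule bounded_linear_sc)
  show "(cmod a)-lipschitz_on UNIV (sc a)"
    by (rule lipschitz_onI) (simp_all add: dist_norm diff[symmetric] norm_sc[OF assms(2)])
qed

text \<open>
  The simple integral is defined by the level sets of the integrand. It can be evaluated on any finer
  partition, given by the level sets of \<open>p\<close>; with pairs of simple functions in the role of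
  \<open>p\<close> this gives additivity.
\<close>

lemma simple_integral_partition:
  fixes \<mu> :: "'t::topological_space set \<Rightarrow> 'x"
  assumes mu: "\<mu> \<in> cabv" and p: "simple_function borel p"
  shows "simple_integral ip (\<lambda>t. v (p t)) \<mu> = (\<Sum>y\<in>range p. ip (v y) (\<mu> (p -` {y})))"
proof -
  have fin: "finite (range p)" using simple_functionD(1)[OF p] by simp
  have bor: "p -` {y} \<in> sets borel" for y using simple_functionD(2)[OF p, of "{y}"] by simp
  let ?S = "\<lambda>x. {y \<in> range p. v y = x}"
  have "ip x (\<mu> ((\<lambda>t. v (p t)) -` {x})) = (\<Sum>y\<in>?S x. ip (v y) (\<mu> (p -` {y})))" for x
  proof -
    have "(\<lambda>t. v (p t)) -` {x} = (\<Union>y\<in>?S x. p -` {y})" by auto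
    moreover have "\<mu> (\<Union>y\<in>?S x. p -` {y}) = (\<Sum>y\<in>?S x. \<mu> (p -` {y}))"
      using fin bor by (intro cabv_finite_UN[OF mu]) (auto simp: disjoint_family_on_def)
    ultimately show ?thesis by (simp add: ip_sum_right)
  qed
  then have "simple_integral ip (\<lambda>t. v (p t)) \<mu>
      = (\<Sum>x\<in>range (\<lambda>t. v (p t)). \<Sum>y\<in>?S x. ip (v y) (\<mu> (p -` {y})))"
    unfolding simple_integral_def by simp
  also have "\<dots> = (\<Sum>y\<in>range p. ip (v y) (\<mu> (p -` {y})))"
    using finite_imageI[OF fin, of v] by (intro sum.group fin) (auto simp: image_image)
  finally show ?thesis .
qed

lemma simple_integral_add:
  fixes \<mu> :: "'t::topological_space set \<Rightarrow> 'x"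
  assumes mu: "\<mu> \<in> cabv" and s: "simple_function borel s" and u: "simple_function borel u"
  shows "simple_integral ip (\<lambda>t. s t + u t) \<mu> = simple_integral ip s \<mu> + simple_integral ip u \<mu>"
  using simple_integral_partition[OF mu simple_function_Pair[OF s u], of "\<lambda>(x, y). x + y"]
    simple_integral_partition[OF mu simple_function_Pair[OF s u], of fst]
    simple_integral_partition[OF mu simple_function_Pair[OF s u], of snd]
  by (simp add: case_prod_beta ip_add_left sum.distrib)

lemma simple_integral_sc:
  fixes \<mu> :: "'t::topological_space set \<Rightarrow> 'x"
  assumes mu: "\<mu> \<in> cabv" and s: "simple_function borel s" and a: "a \<in> K"
  shows "simple_integral ip (\<lambda>t. sc a (s t)) \<mu> = a * simple_integral ip s \<mu>"
  unfolding simple_integral_partition[OF mu s, of "sc a"]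
  unfolding simple_integral_def by (simp add: ip_sc_left[OF a] sum_distrib_left)

lemma simple_integral_indicator:
  fixes \<mu> :: "'t::topological_space set \<Rightarrow> 'x"
  assumes mu: "\<mu> \<in> cabv" and A: "A \<in> sets borel"
  shows "simple_integral ip (\<lambda>t. indicator A t *\<^sub>R x) \<mu> = ip x (\<mu> A)"
proof -
  let ?p = "\<lambda>t. t \<in> A"
  have "?p -` {b} = (if b then A else - A)" for b by auto
  then have p: "simple_function borel ?p"
    using A by (auto simp: simple_function_def)
  have "simple_integral ip (\<lambda>t. indicator A t *\<^sub>R x) \<mu>
      = (\<Sum>b\<in>range ?p. ip ((if b then 1 else 0) *\<^sub>R x) (\<mu> (?p -` {b})))"
    using simple_integral_partition[OF mu p, of "\<lambda>b. (if b then 1 else 0) *\<^sub>R x"]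
    by (simp add: indicator_def of_bool_def)
  also have "\<dots> = (\<Sum>b\<in>UNIV. ip ((if b then 1 else 0) *\<^sub>R x) (\<mu> (?p -` {b})))"
  proof (rule sum.mono_neutral_left)
    show "\<forall>b\<in>UNIV - range ?p. ip ((if b then 1 else 0) *\<^sub>R x) (\<mu> (?p -` {b})) = 0"
    proof
      fix b assume "b \<in> UNIV - range ?p"
      then have "?p -` {b} = {}" by auto
      then show "ip ((if b then 1 else 0) *\<^sub>R x) (\<mu> (?p -` {b})) = 0" using mu by simp
    qed
  qed auto
  also have "\<dots> = ip x (\<mu> A)" by (simp add: UNIV_bool vimage_def)
  finally show ?thesis .
qed

lemma simple_integral_le:
  fixes \<mu> :: "'t::topological_space set \<Rightarrow> 'x"
  assumes mu: "\<mu> \<in> cabv" and s: "simple_function borel s"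
  shows "cmod (simple_integral ip s \<mu>) \<le> (\<integral>t. norm (s t) \<partial>variation_measure \<mu>)"
proof -
  let ?V = "variation_measure \<mu>"
  interpret finite_measure ?V using mu by (rule finite_variation_measure)
  have fin: "finite (range s)" using simple_functionD(1)[OF s] by simp
  have bor: "s -` {x} \<in> sets borel" for x using simple_functionD(2)[OF s, of "{x}"] by simp
  have eq: "norm (s t) = (\<Sum>x\<in>range s. norm x * indicator (s -` {x}) t)" for t
    using fin by (simp add: indicator_def sum.delta' if_distrib[of "\<lambda>r. _ * r"] cong: if_cong)
  have "cmod (simple_integral ip s \<mu>) \<le> (\<Sum>x\<in>range s. cmod (ip x (\<mu> (s -` {x}))))"
    unfolding simple_integral_def by (rule norm_sum)
  also have "\<dots> \<le> (\<Sum>x\<in>range s. norm x * measure ?V (s -` {x}))"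
    using bor by (intro sum_mono order_trans[OF cauchy_schwarz] mult_left_mono
        norm_le_variation_measure mu) auto
  also have "\<dots> = (\<Sum>x\<in>range s. \<integral>t. norm x * indicator (s -` {x}) t \<partial>?V)"
    using bor by simp
  also have "\<dots> = (\<integral>t. (\<Sum>x\<in>range s. norm x * indicator (s -` {x}) t) \<partial>?V)"
    using bor by (intro Bochner_Integration.integral_sum[symmetric] integrable_mult_right)
      (simp_all add: emeasure_eq_measure integrable_indicator_iff)
  finally show ?thesis unfolding eq .
qed

lemma simple_integral_diff_le:
  fixes \<mu> :: "'t::topological_space set \<Rightarrow> 'x"
  assumes mu: "\<mu> \<in> cabv" and s: "simple_function borel s" and u: "simple_function borel u"
    and e: "\<And>t. norm (s t - u t) \<le> e"
  shows "cmod (simple_integral ip s \<mu> - simple_integral ip u \<mu>) \<le> e * measure (variation_measure \<mu>) UNIV"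
proof -
  let ?V = "variation_measure \<mu>"
  interpret finite_measure ?V using mu by (rule finite_variation_measure)
  have d: "simple_function borel (\<lambda>t. s t - u t)" using s u by (rule simple_function_compose2)
  have "simple_integral ip s \<mu> = simple_integral ip (\<lambda>t. (s t - u t) + u t) \<mu>" by simp
  also have "\<dots> = simple_integral ip (\<lambda>t. s t - u t) \<mu> + simple_integral ip u \<mu>"
    by (rule simple_integral_add[OF mu d u])
  finally have "cmod (simple_integral ip s \<mu> - simple_integral ip u \<mu>)
      \<le> (\<integral>t. norm (s t - u t) \<partial>?V)"
    using simple_integral_le[OF mu d] by simp
  also have "\<dots> \<le> (\<integral>t. e \<partial>?V)"
    using tot_measurable_integrable_norm[OF tot_measurable_simple[OF d] finite_measure_axioms]
    by (intro integral_mono e) simp_all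
  also have "\<dots> = e * measure ?V UNIV" by simp
  finally show ?thesis .
qed

text \<open>
  Uniformly close simple functions have close integrals because the variation is finite. So the
  integrals along a uniformly convergent sequence of simple functions form a Cauchy sequence, and
  two sequences with the same uniform limit lead to the same value.
\<close>

lemma uniform_integral_tendsto:
  fixes \<mu> :: "'t::topological_space set \<Rightarrow> 'x"
  assumes mu: "\<mu> \<in> cabv" and s: "\<And>n::nat. simple_function borel (s n)"
    and lim: "uniform_limit UNIV s f sequentially"
  shows "(\<lambda>n. simple_integral ip (s n) \<mu>) \<longlonglongrightarrow> uniform_integral ip f \<mu>"
proof -
  define m where "m = measure (variation_measure \<mu>) UNIV"
  have m: "0 \<le> m" by (simp add: m_def)
  have close: "\<exists>N. \<forall>i\<ge>N. \<forall>j\<ge>N. cmod (simple_integral ip (u i) \<mu> - simple_integral ip (w j) \<mu>) < e"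
    if u: "\<And>n::nat. simple_function borel (u n)" "uniform_limit UNIV u f sequentially"
      and w: "\<And>n::nat. simple_function borel (w n)" "uniform_limit UNIV w f sequentially"
      and e: "0 < e" for u w :: "nat \<Rightarrow> 't \<Rightarrow> 'x" and e :: real
  proof -
    define d where "d = e / (2 * (m + 1))"
    have d: "0 < d" using e m by (simp add: d_def)
    obtain N where N: "\<And>n t. N \<le> n \<Longrightarrow> dist (u n t) (f t) < d"
      using uniform_limitD[OF u(2) d] by (auto simp: eventually_sequentially)
    obtain M where M: "\<And>n t. M \<le> n \<Longrightarrow> dist (w n t) (f t) < d"
      using uniform_limitD[OF w(2) d] by (auto simp: eventually_sequentially)
    have "cmod (simple_integral ip (u i) \<mu> - simple_integral ip (w j) \<mu>) < e"
      if "max N M \<le> i" "max N M \<le> j" for i j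
    proof -
      have "norm (u i t - w j t) \<le> 2 * d" for t
        using dist_triangle2[of "u i t" "w j t" "f t"] N[of i t] M[of j t] that
        by (simp add: dist_norm)
      from simple_integral_diff_le[OF mu u(1) w(1) this]
      have "cmod (simple_integral ip (u i) \<mu> - simple_integral ip (w j) \<mu>) \<le> 2 * d * m"
        by (simp add: m_def)
      also have "\<dots> < e" using e m by (simp add: d_def field_simps)
      finally show ?thesis .
    qed
    then show ?thesis by blast
  qed
  have "Cauchy (\<lambda>n. simple_integral ip (s n) \<mu>)"
    using close[OF s lim s lim] by (intro CauchyI) blast
  then obtain L where L: "(\<lambda>n. simple_integral ip (s n) \<mu>) \<longlonglongrightarrow> L"
    using convergent_eq_Cauchy convergent_def by blast
  have "uniform_integral ip f \<mu> = L"
    unfolding uniform_integral_def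
  proof (rule the_equality)
    show "\<exists>s. (\<forall>n::nat. simple_function borel (s n)) \<and> uniform_limit UNIV s f sequentially \<and>
        (\<lambda>n. simple_integral ip (s n) \<mu>) \<longlonglongrightarrow> L" using s lim L by blast
  next
    fix L' assume "\<exists>s. (\<forall>n::nat. simple_function borel (s n)) \<and> uniform_limit UNIV s f sequentially \<and>
        (\<lambda>n. simple_integral ip (s n) \<mu>) \<longlonglongrightarrow> L'"
    then obtain u where u: "\<And>n::nat. simple_function borel (u n)" "uniform_limit UNIV u f sequentially"
      and L': "(\<lambda>n. simple_integral ip (u n) \<mu>) \<longlonglongrightarrow> L'" by blast
    have "(\<lambda>n. simple_integral ip (u n) \<mu> - simple_integral ip (s n) \<mu>) \<longlonglongrightarrow> 0"
    proof (rule LIMSEQ_I)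
      fix e :: real assume "0 < e"
      from close[OF u s lim this]
      show "\<exists>N. \<forall>n\<ge>N. norm (simple_integral ip (u n) \<mu> - simple_integral ip (s n) \<mu> - 0) < e"
        by (metis diff_zero)
    qed
    with tendsto_diff[OF L' L] have "L' - L = 0" by (rule LIMSEQ_unique)
    then show "L' = L" by simp
  qed
  with L show ?thesis by simp
qed

lemma uniform_integral_simple:
  fixes \<mu> :: "'t::topological_space set \<Rightarrow> 'x"
  assumes mu: "\<mu> \<in> cabv" and s: "simple_function borel s"
  shows "uniform_integral ip s \<mu> = simple_integral ip s \<mu>"
proof -
  have "uniform_limit UNIV (\<lambda>n::nat. s) s sequentially" by (rule uniform_limit_const)
  from uniform_integral_tendsto[OF mu s this] show ?thesis by (simp add: LIMSEQ_const_iff)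
qed

lemma uniform_integral_add:
  fixes \<mu> :: "'t::topological_space set \<Rightarrow> 'x"
  assumes mu: "\<mu> \<in> cabv" and f: "tot_measurable f" and g: "tot_measurable g"
  shows "uniform_integral ip (\<lambda>t. f t + g t) \<mu> = uniform_integral ip f \<mu> + uniform_integral ip g \<mu>"
proof -
  obtain s where s: "\<And>n::nat. simple_function borel (s n)" "uniform_limit UNIV s f sequentially"
    using f unfolding tot_measurable_def by blast
  obtain u where u: "\<And>n::nat. simple_function borel (u n)" "uniform_limit UNIV u g sequentially"
    using g unfolding tot_measurable_def by blast
  have "(\<lambda>n. simple_integral ip (\<lambda>t. s n t + u n t) \<mu>) \<longlonglongrightarrow> uniform_integral ip (\<lambda>t. f t + g t) \<mu>"
    using s u by (intro uniform_integral_tendsto[OF mu] uniform_limit_add) (auto intro: simple_function_compose2)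
  moreover have "(\<lambda>n. simple_integral ip (\<lambda>t. s n t + u n t) \<mu>)
      \<longlonglongrightarrow> uniform_integral ip f \<mu> + uniform_integral ip g \<mu>"
    unfolding simple_integral_add[OF mu s(1) u(1)]
    by (intro tendsto_add uniform_integral_tendsto[OF mu] s u)
  ultimately show ?thesis by (rule LIMSEQ_unique)
qed

lemma uniform_integral_sc:
  fixes \<mu> :: "'t::topological_space set \<Rightarrow> 'x"
  assumes mu: "\<mu> \<in> cabv" and f: "tot_measurable f" and a: "a \<in> K"
  shows "uniform_integral ip (\<lambda>t. sc a (f t)) \<mu> = a * uniform_integral ip f \<mu>"
proof -
  obtain s where s: "\<And>n::nat. simple_function borel (s n)" "uniform_limit UNIV s f sequentially"
    using f unfolding tot_measurable_def by blast
  have "(\<lambda>n. simple_integral ip (\<lambda>t. sc a (s n t)) \<mu>) \<longlonglongrightarrow> uniform_integral ip (\<lambda>t. sc a (f t)) \<mu>"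
    using s by (intro uniform_integral_tendsto[OF mu] bounded_linear_uniform_limit_intros
        bounded_linear.uniform_limit[OF bounded_linear_sc[OF a]]) (auto intro: simple_function_compose1)
  moreover have "(\<lambda>n. simple_integral ip (\<lambda>t. sc a (s n t)) \<mu>) \<longlonglongrightarrow> a * uniform_integral ip f \<mu>"
    unfolding simple_integral_sc[OF mu s(1) a]
    by (intro tendsto_mult tendsto_const uniform_integral_tendsto[OF mu] s)
  ultimately show ?thesis by (rule LIMSEQ_unique)
qed

lemma uniform_integral_scaleR:
  fixes \<mu> :: "'t::topological_space set \<Rightarrow> 'x"
  assumes mu: "\<mu> \<in> cabv" and f: "tot_measurable f"
  shows "uniform_integral ip (\<lambda>t. r *\<^sub>R f t) \<mu> = of_real r * uniform_integral ip f \<mu>"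
  using uniform_integral_sc[OF mu f of_real_in_K] by (simp add: sc_of_real)

lemma uniform_integral_diff:
  fixes \<mu> :: "'t::topological_space set \<Rightarrow> 'x"
  assumes mu: "\<mu> \<in> cabv" and f: "tot_measurable f" and g: "tot_measurable g"
  shows "uniform_integral ip (\<lambda>t. f t - g t) \<mu> = uniform_integral ip f \<mu> - uniform_integral ip g \<mu>"
  using uniform_integral_add[OF mu f tot_measurable_minus[OF g]] uniform_integral_scaleR[OF mu g, of "-1"]
  by simp

lemma uniform_integral_sum:
  fixes \<mu> :: "'t::topological_space set \<Rightarrow> 'x"
  assumes mu: "\<mu> \<in> cabv" and f: "\<And>i. i \<in> I \<Longrightarrow> tot_measurable (f i)"
  shows "uniform_integral ip (\<lambda>t. \<Sum>i\<in>I. f i t) \<mu> = (\<Sum>i\<in>I. uniform_integral ip (f i) \<mu>)"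
  using f
proof (induction I rule: infinite_finite_induct)
  case (insert i I)
  then show ?case using uniform_integral_add[OF mu, of "f i" "\<lambda>t. \<Sum>i\<in>I. f i t"]
    by (simp add: tot_measurable_sum)
qed (simp_all add: uniform_integral_simple[OF mu] simple_integral_def)

lemma uniform_integral_in_K:
  fixes \<mu> :: "'t::topological_space set \<Rightarrow> 'x"
  assumes mu: "\<mu> \<in> cabv" and f: "tot_measurable f"
  shows "uniform_integral ip f \<mu> \<in> K"
proof -
  obtain s where s: "\<And>n::nat. simple_function borel (s n)" "uniform_limit UNIV s f sequentially"
    using f unfolding tot_measurable_def by blast
  show ?thesis
  proof (rule Lim_in_closed_set)
    show "closed K" using real_or_complex closed_complex_Reals by auto
    show "(\<lambda>n. simple_integral ip (s n) \<mu>) \<longlonglongrightarrow> uniform_integral ip f \<mu>"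
      by (rule uniform_integral_tendsto[OF mu s])
    have "simple_integral ip (s n) \<mu> \<in> K" for n
      using real_or_complex ip_in_K unfolding simple_integral_def by (auto intro: sum_in_Reals)
    then show "\<forall>\<^sub>F n in sequentially. simple_integral ip (s n) \<mu> \<in> K" by simp
  qed simp
qed

text \<open>
  This bound by the integral of the norm is sharper than the bound by the supremum norm. It is what
  allows dominated convergence in the uniqueness proof and the comparison with a product measure in
  the construction of the transported measure.
\<close>

lemma uniform_integral_le:
  fixes \<mu> :: "'t::topological_space set \<Rightarrow> 'x"
  assumes mu: "\<mu> \<in> cabv" and f: "tot_measurable f"
  shows "cmod (uniform_integral ip f \<mu>) \<le> (\<integral>t. norm (f t) \<partial>variation_measure \<mu>)"
proof (rule field_le_epsilon)
  fix e :: real assume e: "0 < e"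
  let ?V = "variation_measure \<mu>"
  interpret finite_measure ?V using mu by (rule finite_variation_measure)
  define d where "d = e / (2 * (measure ?V UNIV + 1))"
  have d: "0 < d" using e by (simp add: d_def add_nonneg_pos)
  obtain s where s: "\<And>n::nat. simple_function borel (s n)" "uniform_limit UNIV s f sequentially"
    using f unfolding tot_measurable_def by blast
  have "\<forall>\<^sub>F n in sequentially. dist (simple_integral ip (s n) \<mu>) (uniform_integral ip f \<mu>) < e / 2"
    using e by (intro tendstoD uniform_integral_tendsto[OF mu s]) simp
  with uniform_limitD[OF s(2) d]
  have "\<forall>\<^sub>F n in sequentially. (\<forall>t\<in>UNIV. dist (s n t) (f t) < d) \<and>
      dist (simple_integral ip (s n) \<mu>) (uniform_integral ip f \<mu>) < e / 2" by eventually_elim simp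
  then obtain n where n: "\<And>t. dist (s n t) (f t) < d"
    "dist (simple_integral ip (s n) \<mu>) (uniform_integral ip f \<mu>) < e / 2"
    by (auto simp: eventually_sequentially)
  have i: "integrable ?V (\<lambda>t. norm (f t))" "integrable ?V (\<lambda>t. norm (s n t))"
    using tot_measurable_integrable_norm[OF _ finite_measure_axioms sets_variation_measure]
      f tot_measurable_simple[OF s(1)] by blast+
  have "(\<integral>t. norm (s n t) \<partial>?V) \<le> (\<integral>t. norm (f t) + d \<partial>?V)"
  proof (intro integral_mono i Bochner_Integration.integrable_add)
    show "norm (s n t) \<le> norm (f t) + d" for t
      using norm_triangle_ineq[of "f t" "s n t - f t"] n(1)[of t] by (simp add: dist_norm)
  qed simp
  also have "\<dots> = (\<integral>t. norm (f t) \<partial>?V) + d * measure ?V UNIV" using i by simp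
  also have "d * measure ?V UNIV \<le> e / 2"
    using e measure_nonneg[of ?V UNIV] unfolding d_def
    by (simp add: divide_le_eq add_nonneg_pos mult_left_mono)
  finally have "(\<integral>t. norm (s n t) \<partial>?V) \<le> (\<integral>t. norm (f t) \<partial>?V) + e / 2" by simp
  moreover have "cmod (uniform_integral ip f \<mu>) \<le> cmod (simple_integral ip (s n) \<mu>) + e / 2"
    using n(2) norm_triangle_ineq2[of "uniform_integral ip f \<mu>" "simple_integral ip (s n) \<mu>"]
    by (simp add: dist_norm norm_minus_commute)
  ultimately show "cmod (uniform_integral ip f \<mu>) \<le> (\<integral>t. norm (f t) \<partial>?V) + e"
    using simple_integral_le[OF mu s(1)[of n]] by linarith
qed

lemma uniform_integral_le_sup:
  fixes \<mu> :: "'t::topological_space set \<Rightarrow> 'x"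
  assumes mu: "\<mu> \<in> cabv" and f: "tot_measurable f" and B: "\<And>t. norm (f t) \<le> B"
  shows "cmod (uniform_integral ip f \<mu>) \<le> B * measure (variation_measure \<mu>) UNIV"
proof -
  let ?V = "variation_measure \<mu>"
  interpret finite_measure ?V using mu by (rule finite_variation_measure)
  have "cmod (uniform_integral ip f \<mu>) \<le> (\<integral>t. norm (f t) \<partial>?V)"
    using mu f by (rule uniform_integral_le)
  also have "\<dots> \<le> (\<integral>t. B \<partial>?V)"
    using tot_measurable_integrable_norm[OF f finite_measure_axioms]
    by (intro integral_mono B) simp_all
  finally show ?thesis by (simp add: mult.commute)
qed

lemma uniform_integral_measure_add:
  fixes \<mu> :: "'t::topological_space set \<Rightarrow> 'x"
  assumes mu: "\<mu> \<in> cabv" and nu: "\<nu> \<in> cabv" and f: "tot_measurable f"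
  shows "uniform_integral ip f (\<lambda>A. \<mu> A + \<nu> A) = uniform_integral ip f \<mu> + uniform_integral ip f \<nu>"
proof -
  obtain s where s: "\<And>n::nat. simple_function borel (s n)" "uniform_limit UNIV s f sequentially"
    using f unfolding tot_measurable_def by blast
  have "simple_integral ip (s n) (\<lambda>A. \<mu> A + \<nu> A) = simple_integral ip (s n) \<mu> + simple_integral ip (s n) \<nu>" for n
    by (simp add: simple_integral_def ip_add_right sum.distrib)
  then have "(\<lambda>n. simple_integral ip (s n) (\<lambda>A. \<mu> A + \<nu> A))
      \<longlonglongrightarrow> uniform_integral ip f \<mu> + uniform_integral ip f \<nu>"
    by (auto intro!: tendsto_add uniform_integral_tendsto mu nu s)
  with uniform_integral_tendsto[OF cabv_add[OF mu nu] s] show ?thesis by (rule LIMSEQ_unique)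
qed

lemma uniform_integral_measure_sc:
  fixes \<mu> :: "'t::topological_space set \<Rightarrow> 'x"
  assumes mu: "\<mu> \<in> cabv" and a: "a \<in> K" and f: "tot_measurable f"
  shows "uniform_integral ip f (\<lambda>A. sc a (\<mu> A)) = cnj a * uniform_integral ip f \<mu>"
proof -
  obtain s where s: "\<And>n::nat. simple_function borel (s n)" "uniform_limit UNIV s f sequentially"
    using f unfolding tot_measurable_def by blast
  have "simple_integral ip (s n) (\<lambda>A. sc a (\<mu> A)) = cnj a * simple_integral ip (s n) \<mu>" for n
    by (simp add: simple_integral_def ip_sc_right[OF a] sum_distrib_left)
  then have "(\<lambda>n. simple_integral ip (s n) (\<lambda>A. sc a (\<mu> A))) \<longlonglongrightarrow> cnj a * uniform_integral ip f \<mu>"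
    by (auto intro!: tendsto_mult uniform_integral_tendsto mu s)
  with uniform_integral_tendsto[OF cabv_sc[OF mu a] s] show ?thesis by (rule LIMSEQ_unique)
qed

end

section \<open>A measure is determined by its integrals of continuous functions\<close>

lemma Bcontfun_compact_inverse:
  fixes f :: "'t::topological_space \<Rightarrow> 'x::real_normed_vector"
  assumes "compact (UNIV :: 't set)" "continuous_on UNIV f"
  shows "apply_bcontfun (Bcontfun f) = f"
  using assms by (intro Bcontfun_inverse) (auto simp: bcontfun_def intro: compact_imp_bounded compact_continuous_image)

context hilbert_space_over
begin

text \<open>
  The continuous functions \<open>max 0 (1 - n d(t, C))\<close> decrease to the indicator function of \<open>C\<close>, and
  dominated convergence with respect to the variation applies.
\<close>

lemma uniform_integral_tends_to_closed:
  fixes \<mu> :: "'t::metric_space set \<Rightarrow> 'x"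
  assumes mu: "\<mu> \<in> cabv" and C: "closed C" "C \<noteq> {}"
  shows "(\<lambda>n. uniform_integral ip (\<lambda>t. max 0 (1 - real n * infdist t C) *\<^sub>R x) \<mu>) \<longlonglongrightarrow> ip x (\<mu> C)"
proof -
  let ?V = "variation_measure \<mu>"
  interpret finite_measure ?V using mu by (rule finite_variation_measure)
  define f where "f n t = max 0 (1 - real n * infdist t C)" for n and t :: 't
  have f01: "0 \<le> f n t" "f n t \<le> 1" for n t by (auto simp: f_def infdist_nonneg)
  have fb: "f n \<in> borel_measurable borel" for n
    unfolding f_def by (intro borel_measurable_continuous_onI continuous_intros)
  have Cb: "C \<in> sets borel" using C(1) by simp
  have tf: "tot_measurable (\<lambda>t. f n t *\<^sub>R x)" for n
    using fb f01 by (intro tot_measurable_scaleR[where B = 1]) simp_all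
  have si: "simple_function borel (\<lambda>t. indicator C t *\<^sub>R x)"
    by (rule simple_function_compose1[OF simple_function_indicator[OF Cb]])
  then have ti: "tot_measurable (\<lambda>t. indicator C t *\<^sub>R x)" by (rule tot_measurable_simple)
  have I: "uniform_integral ip (\<lambda>t. indicator C t *\<^sub>R x) \<mu> = ip x (\<mu> C)"
    using uniform_integral_simple[OF mu si] simple_integral_indicator[OF mu Cb] by simp
  have "(\<lambda>n. \<integral>t. norm (f n t *\<^sub>R x - indicator C t *\<^sub>R x) \<partial>?V) \<longlonglongrightarrow> (\<integral>t. 0 \<partial>?V)"
  proof (rule integral_dominated_convergence[where w = "\<lambda>_. norm x"])
    show "(\<lambda>t. norm (f n t *\<^sub>R x - indicator C t *\<^sub>R x)) \<in> borel_measurable ?V" for n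
      using tot_measurable_integrable_norm[OF tot_measurable_diff[OF tf ti] finite_measure_axioms]
      by (simp add: borel_measurable_integrable)
    show "AE t in ?V. (\<lambda>n. norm (f n t *\<^sub>R x - indicator C t *\<^sub>R x)) \<longlonglongrightarrow> 0"
    proof (rule AE_I2)
      fix t
      have "\<forall>\<^sub>F n in sequentially. f n t = indicator C t"
      proof (cases "t \<in> C")
        case True then show ?thesis by (simp add: f_def)
      next
        case False
        then have pos: "0 < infdist t C" using C in_closed_iff_infdist_zero infdist_nonneg
          by (metis order_le_less)
        obtain N :: nat where "1 / infdist t C \<le> real N" using real_arch_simple by blast
        then have N: "1 \<le> real N * infdist t C" using pos by (simp add: field_simps)
        have "f n t = indicator C t" if "N \<le> n" for n
        proof -
          have "1 \<le> real n * infdist t C"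
            by (rule order_trans[OF N mult_right_mono]) (use that pos in simp_all)
          then show ?thesis using False by (simp add: f_def)
        qed
        then show ?thesis by (auto simp: eventually_sequentially)
      qed
      then have "\<forall>\<^sub>F n in sequentially. norm (f n t *\<^sub>R x - indicator C t *\<^sub>R x) = 0"
        by eventually_elim simp
      then show "(\<lambda>n. norm (f n t *\<^sub>R x - indicator C t *\<^sub>R x)) \<longlonglongrightarrow> 0" by (rule tendsto_eventually)
    qed
    show "AE t in ?V. norm (norm (f n t *\<^sub>R x - indicator C t *\<^sub>R x)) \<le> norm x" for n
    proof (rule AE_I2)
      fix t
      have "\<bar>f n t - indicator C t\<bar> \<le> 1" using f01[of n t] by (auto simp: indicator_def)
      then have "\<bar>f n t - indicator C t\<bar> * norm x \<le> norm x" by (rule mult_left_le_one_le[rotated 2]) auto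
      then show "norm (norm (f n t *\<^sub>R x - indicator C t *\<^sub>R x)) \<le> norm x"
        by (simp add: scaleR_left_diff_distrib[symmetric])
    qed
  qed simp_all
  then have "(\<lambda>n. \<integral>t. norm (f n t *\<^sub>R x - indicator C t *\<^sub>R x) \<partial>?V) \<longlonglongrightarrow> 0" by simp
  then have "(\<lambda>n. uniform_integral ip (\<lambda>t. f n t *\<^sub>R x) \<mu> - ip x (\<mu> C)) \<longlonglongrightarrow> 0"
  proof (rule Lim_null_comparison[rotated], intro always_eventually allI)
    fix n
    show "norm (uniform_integral ip (\<lambda>t. f n t *\<^sub>R x) \<mu> - ip x (\<mu> C))
        \<le> (\<integral>t. norm (f n t *\<^sub>R x - indicator C t *\<^sub>R x) \<partial>?V)"
      unfolding I[symmetric] uniform_integral_diff[OF mu tf ti, symmetric]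
      by (rule uniform_integral_le[OF mu tot_measurable_diff[OF tf ti]])
  qed
  then show ?thesis unfolding f_def LIM_zero_iff .
qed

text \<open>
  Two measures with the same integrals of continuous functions agree on closed sets; these form an
  intersection-stable generator of the Borel sets.
\<close>

lemma Phi_injective:
  fixes \<mu> \<nu> :: "'t::metric_space set \<Rightarrow> 'x"
  assumes comp: "compact (UNIV :: 't set)" and mu: "\<mu> \<in> cabv" and nu: "\<nu> \<in> cabv"
    and eq: "Phi ip \<mu> = Phi ip \<nu>"
  shows "\<mu> = \<nu>"
proof
  fix A
  have closed_eq: "\<mu> C = \<nu> C" if C: "closed C" for C
  proof (cases "C = {}")
    case False
    show ?thesis
    proof (rule ip_eqI)
      fix x
      have "uniform_integral ip (\<lambda>t. max 0 (1 - real n * infdist t C) *\<^sub>R x) \<mu>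
          = uniform_integral ip (\<lambda>t. max 0 (1 - real n * infdist t C) *\<^sub>R x) \<nu>" for n
      proof -
        let ?f = "\<lambda>t. max 0 (1 - real n * infdist t C) *\<^sub>R x"
        have "continuous_on UNIV ?f" by (intro continuous_intros)
        then have "apply_bcontfun (Bcontfun ?f) = ?f" by (rule Bcontfun_compact_inverse[OF comp])
        with fun_cong[OF eq, of "Bcontfun ?f"] show ?thesis unfolding Phi_def by simp
      qed
      then show "ip x (\<mu> C) = ip x (\<nu> C)"
        using uniform_integral_tends_to_closed[OF mu C False, of x]
          uniform_integral_tends_to_closed[OF nu C False, of x] LIMSEQ_unique by simp
    qed
  qed (simp add: mu nu)
  have bor: "sets borel = sigma_sets UNIV {C :: 't set. closed C}"
    by (simp add: borel_eq_closed)
  show "\<mu> A = \<nu> A"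
  proof (cases "A \<in> sets borel")
    case True
    have "Int_stable {C :: 't set. closed C}" by (auto simp: Int_stable_def)
    moreover have "{C :: 't set. closed C} \<subseteq> Pow UNIV" by simp
    moreover have "A \<in> sigma_sets UNIV {C. closed C}" using True by (simp only: bor)
    ultimately show ?thesis
    proof (induction rule: sigma_sets_induct_disjoint)
      case (compl A)
      then have A: "A \<in> sets borel" by (simp add: bor)
      have "\<mu> (A \<union> (UNIV - A)) = \<mu> A + \<mu> (UNIV - A)" using A by (intro cabv_Un mu) auto
      moreover have "\<nu> (A \<union> (UNIV - A)) = \<nu> A + \<nu> (UNIV - A)" using A by (intro cabv_Un nu) auto
      ultimately show ?case using compl.IH closed_eq[OF closed_UNIV] by simp
    next
      case (union A)
      then have A: "range A \<subseteq> sets borel" by (auto simp: bor)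
      have "(\<lambda>n. \<mu> (A n)) sums \<mu> (\<Union>n. A n)" using A union by (intro cabv_sums[OF mu]) auto
      moreover have "(\<lambda>n. \<nu> (A n)) sums \<nu> (\<Union>n. A n)" using A union by (intro cabv_sums[OF nu]) auto
      ultimately show ?case using union.IH sums_unique2 by simp
    qed (auto simp: closed_eq mu nu)
  next
    case False
    then show ?thesis using cabv_off_borel[OF mu] cabv_off_borel[OF nu] by simp
  qed
qed

end

section \<open>Weak integrals of Hilbert-space-valued functions\<close>

text \<open>
  Subtracting a simple function means subtracting constants on finitely many pieces, which is
  harmless even without separability.
\<close>

lemma borel_measurable_norm_diff_simple:
  fixes f s :: "'o \<Rightarrow> 'x::real_normed_vector"
  assumes f: "f \<in> borel_measurable M" and s: "simple_function M s"
  shows "(\<lambda>\<theta>. norm (f \<theta> - s \<theta>)) \<in> borel_measurable M"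
proof (rule measurable_compose_countable'[where I = "s ` space M" and g = s])
  show "(\<lambda>\<theta>. norm (f \<theta> - x)) \<in> borel_measurable M" for x
    by (rule measurable_compose[OF f borel_measurable_continuous_onI]) (intro continuous_intros)
  show "s \<in> measurable M (count_space (s ` space M))"
    using s by (auto simp: simple_function_def measurable_count_space_eq2)
  show "countable (s ` space M)"
    using simple_functionD(1)[OF s] by (rule countable_finite)
qed

context hilbert_space_over
begin

text \<open>
  Weak measurability together with an integrable bound of the norm: enough for the integral to exist
  as a vector, and stable under sums.
\<close>

definition weakly_dominated :: "'o measure \<Rightarrow> ('o \<Rightarrow> 'x) \<Rightarrow> ('o \<Rightarrow> real) \<Rightarrow> bool" where
  "weakly_dominated W f u \<longleftrightarrow> (\<forall>z. (\<lambda>\<theta>. ip z (f \<theta>)) \<in> borel_measurable W) \<and>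
     integrable W u \<and> (\<forall>\<theta>\<in>space W. norm (f \<theta>) \<le> u \<theta>)"

definition weak_integral :: "'o measure \<Rightarrow> ('o \<Rightarrow> 'x) \<Rightarrow> 'x" where
  "weak_integral W f = (THE v. \<forall>z. ip z v = (\<integral>\<theta>. ip z (f \<theta>) \<partial>W))"

lemma weakly_dominated_integrable:
  assumes "weakly_dominated W f u" shows "integrable W (\<lambda>\<theta>. ip z (f \<theta>))"
proof (rule Bochner_Integration.integrable_bound)
  show "integrable W (\<lambda>\<theta>. norm z * u \<theta>)" using assms unfolding weakly_dominated_def by auto
  show "AE \<theta> in W. norm (ip z (f \<theta>)) \<le> norm (norm z * u \<theta>)"
  proof (rule AE_I2)
    fix \<theta> assume "\<theta> \<in> space W"
    then have "norm z * norm (f \<theta>) \<le> norm z * u \<theta>"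
      using assms unfolding weakly_dominated_def by (intro mult_left_mono) auto
    with cauchy_schwarz[of z "f \<theta>"] show "norm (ip z (f \<theta>)) \<le> norm (norm z * u \<theta>)" by simp
  qed
qed (use assms in \<open>auto simp: weakly_dominated_def\<close>)

lemma norm_integral_ip_le:
  assumes "\<And>\<theta>. \<theta> \<in> space W \<Longrightarrow> norm (f \<theta>) \<le> u \<theta>" "integrable W u"
    "integrable W (\<lambda>\<theta>. ip z (f \<theta>))"
  shows "cmod (\<integral>\<theta>. ip z (f \<theta>) \<partial>W) \<le> (\<integral>\<theta>. u \<theta> \<partial>W) * norm z"
proof -
  have "cmod (\<integral>\<theta>. ip z (f \<theta>) \<partial>W) \<le> (\<integral>\<theta>. cmod (ip z (f \<theta>)) \<partial>W)" by (rule integral_norm_bound)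
  also have "\<dots> \<le> (\<integral>\<theta>. u \<theta> * norm z \<partial>W)"
  proof (rule integral_mono)
    fix \<theta> assume "\<theta> \<in> space W"
    then have "norm (f \<theta>) * norm z \<le> u \<theta> * norm z" using assms(1) by (intro mult_right_mono) auto
    with cauchy_schwarz[of z "f \<theta>"] show "cmod (ip z (f \<theta>)) \<le> u \<theta> * norm z" by (simp add: mult.commute)
  qed (use assms in auto)
  finally show ?thesis by simp
qed

text \<open>
  The functional \<open>z \<mapsto> \<integral> (z, f) dW\<close> is linear and bounded by the integral of the dominating
  function, so a vector represents it.
\<close>

lemma ip_weak_integral:
  assumes f: "weakly_dominated W f u"
  shows "ip z (weak_integral W f) = (\<integral>\<theta>. ip z (f \<theta>) \<partial>W)"
proof -
  have u: "\<And>\<theta>. \<theta> \<in> space W \<Longrightarrow> norm (f \<theta>) \<le> u \<theta>" "integrable W u"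
    using f unfolding weakly_dominated_def by auto
  note i = weakly_dominated_integrable[OF f]
  have "\<exists>v. \<forall>z. (\<integral>\<theta>. ip z (f \<theta>) \<partial>W) = ip z v"
  proof (rule functional_representable)
    show "(\<integral>\<theta>. ip z (f \<theta>) \<partial>W) \<in> K" for z
      using real_or_complex
    proof
      assume "K = \<real>"
      then have "ip z (f \<theta>) = of_real (Re (ip z (f \<theta>)))" for \<theta> using ip_in_K[of z "f \<theta>"] by auto
      then have "(\<integral>\<theta>. ip z (f \<theta>) \<partial>W) = (\<integral>\<theta>. of_real (Re (ip z (f \<theta>))) \<partial>W)" by presburger
      also have "\<dots> \<in> \<real>" by simp
      finally show ?thesis using \<open>K = \<real>\<close> by simp
    qed simp
    show "cmod (\<integral>\<theta>. ip z (f \<theta>) \<partial>W) \<le> (\<integral>\<theta>. u \<theta> \<partial>W) * norm z" for z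
      by (rule norm_integral_ip_le[OF u i])
  qed (simp_all add: ip_add_left ip_sc_left i)
  then obtain v where v: "\<And>z. ip z v = (\<integral>\<theta>. ip z (f \<theta>) \<partial>W)" by metis
  have "weak_integral W f = v"
    unfolding weak_integral_def by (rule the_equality) (auto simp: v intro: ip_eqI)
  with v show ?thesis by simp
qed

lemma norm_weak_integral_diff_le:
  assumes f: "weakly_dominated W f u" and g: "weakly_dominated W g w"
    and b: "\<And>\<theta>. \<theta> \<in> space W \<Longrightarrow> norm (f \<theta> - g \<theta>) \<le> b \<theta>" "integrable W b"
  shows "norm (weak_integral W f - weak_integral W g) \<le> (\<integral>\<theta>. b \<theta> \<partial>W)"
proof (rule norm_le_ip)
  fix z
  note i = weakly_dominated_integrable[OF f, of z] weakly_dominated_integrable[OF g, of z]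
  have "ip z (weak_integral W f - weak_integral W g) = (\<integral>\<theta>. ip z (f \<theta> - g \<theta>) \<partial>W)"
    by (simp add: ip_diff_right ip_weak_integral[OF f] ip_weak_integral[OF g] i)
  also have "cmod \<dots> \<le> (\<integral>\<theta>. b \<theta> \<partial>W) * norm z"
    using i by (intro norm_integral_ip_le b) (simp_all add: ip_diff_right)
  finally show "cmod (ip z (weak_integral W f - weak_integral W g)) \<le> (\<integral>\<theta>. b \<theta> \<partial>W) * norm z" .
next
  show "0 \<le> (\<integral>\<theta>. b \<theta> \<partial>W)"
    using b(1) order_trans[OF norm_ge_zero] by (intro Bochner_Integration.integral_nonneg_AE AE_I2) blast
qed

text \<open>
  Scalar products with a fixed vector commute with the integral of simple functions, and by the
  inequality of Cauchy and Schwarz they preserve approximation in mean.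
\<close>

lemma has_bochner_ip:
  assumes f: "has_bochner W f v"
  shows "has_bochner_integral W (\<lambda>\<theta>. ip z (f \<theta>)) (ip z v)"
proof -
  obtain s where fm: "f \<in> borel_measurable W"
    and s: "\<And>i. Bochner_Integration.simple_bochner_integrable W (s i)"
    and l1: "(\<lambda>i. \<integral>\<^sup>+\<theta>. ennreal (norm (f \<theta> - s i \<theta>)) \<partial>W) \<longlonglongrightarrow> 0"
    and lim: "(\<lambda>i. Bochner_Integration.simple_bochner_integral W (s i)) \<longlonglongrightarrow> v"
    using f unfolding has_bochner_def by blast
  interpret z: bounded_linear "ip z" by (rule bounded_linear_ip_right)
  have ipm: "ip z \<in> borel_measurable borel"
    by (intro borel_measurable_continuous_onI linear_continuous_on bounded_linear_ip_right)
  have sz: "Bochner_Integration.simple_bochner_integrable W (\<lambda>\<theta>. ip z (s i \<theta>))" for i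
    using simple_bochner_integrable_compose2[where p = "\<lambda>x y. ip z x", OF _ s s] by simp
  show ?thesis
  proof (rule has_bochner_integral.intros[OF _ sz])
    show "(\<lambda>\<theta>. ip z (f \<theta>)) \<in> borel_measurable W" by (rule measurable_compose[OF fm ipm])
    have l2: "(\<lambda>i. ennreal (norm z) * (\<integral>\<^sup>+\<theta>. ennreal (norm (f \<theta> - s i \<theta>)) \<partial>W)) \<longlonglongrightarrow> ennreal (norm z) * 0"
      using l1 by (intro ennreal_tendsto_cmult) auto
    show "(\<lambda>i. \<integral>\<^sup>+\<theta>. ennreal (norm (ip z (f \<theta>) - ip z (s i \<theta>))) \<partial>W) \<longlonglongrightarrow> 0"
    proof (rule tendsto_sandwich[OF _ _ tendsto_const l2[simplified]])
      show "\<forall>\<^sub>F i in sequentially. (\<integral>\<^sup>+\<theta>. ennreal (norm (ip z (f \<theta>) - ip z (s i \<theta>))) \<partial>W)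
          \<le> ennreal (norm z) * (\<integral>\<^sup>+\<theta>. ennreal (norm (f \<theta> - s i \<theta>)) \<partial>W)"
      proof (intro always_eventually allI)
        fix i
        have m: "(\<lambda>\<theta>. norm (f \<theta> - s i \<theta>)) \<in> borel_measurable W"
          by (rule borel_measurable_norm_diff_simple[OF fm])
            (use s[of i] in \<open>auto elim: simple_bochner_integrable.cases\<close>)
        have "(\<integral>\<^sup>+\<theta>. ennreal (norm (ip z (f \<theta>) - ip z (s i \<theta>))) \<partial>W)
            \<le> (\<integral>\<^sup>+\<theta>. ennreal (norm z) * ennreal (norm (f \<theta> - s i \<theta>)) \<partial>W)"
          using cauchy_schwarz by (intro nn_integral_mono)
            (auto simp: ennreal_mult[symmetric] ip_diff_right[symmetric] intro!: ennreal_leI)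
        also have "\<dots> = ennreal (norm z) * (\<integral>\<^sup>+\<theta>. ennreal (norm (f \<theta> - s i \<theta>)) \<partial>W)"
          using m by (intro nn_integral_cmult) simp
        finally show "(\<integral>\<^sup>+\<theta>. ennreal (norm (ip z (f \<theta>) - ip z (s i \<theta>))) \<partial>W)
          \<le> ennreal (norm z) * (\<integral>\<^sup>+\<theta>. ennreal (norm (f \<theta> - s i \<theta>)) \<partial>W)" .
      qed
    qed simp
    have "Bochner_Integration.simple_bochner_integral W (\<lambda>\<theta>. ip z (s i \<theta>))
        = ip z (Bochner_Integration.simple_bochner_integral W (s i))" for i
      by (rule simple_bochner_integral_linear[OF z.linear s])
    with z.tendsto[OF lim] show "(\<lambda>i. Bochner_Integration.simple_bochner_integral W (\<lambda>\<theta>. ip z (s i \<theta>))) \<longlonglongrightarrow> ip z v"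
      by simp
  qed
qed

lemma bochner_integral_eq_weak_integral:
  assumes b: "bochner_integrable W f" and f: "weakly_dominated W f u"
  shows "bochner_integral W f = weak_integral W f"
proof -
  have eq: "v = weak_integral W f" if "has_bochner W f v" for v
    using has_bochner_integral_integral_eq[OF has_bochner_ip[OF that]] ip_weak_integral[OF f]
    by (intro ip_eqI) simp
  obtain v where "has_bochner W f v" using b unfolding bochner_integrable_def by blast
  with eq have "has_bochner W f (weak_integral W f)" by metis
  then have "(THE v. has_bochner W f v) = weak_integral W f" by (rule the_equality) (rule eq)
  with b show ?thesis by (simp add: bochner_integral_def)
qed

end

section \<open>Lipschitz constants and supremum norms\<close>

lemma dist_le_lip_const:
  assumes "L-lipschitz_on UNIV f"
  shows "dist (f s) (f t) \<le> lip_const f * dist s t"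
proof (cases "s = t")
  case False
  have "bdd_above ((\<lambda>(s, t). dist (f s) (f t) / dist s t) ` {(s, t). s \<noteq> t})"
    using lipschitz_onD[OF assms] by (intro bdd_aboveI[of _ L]) (auto simp: divide_le_eq)
  from cSUP_upper[OF _ this, of "(s, t)"] False
  have "dist (f s) (f t) / dist s t \<le> lip_const f" by (simp add: lip_const_def)
  with False show ?thesis by (simp add: divide_le_eq)
qed simp

lemma lip_const_nonneg:
  fixes f :: "'a::metric_space \<Rightarrow> 'b::metric_space" and p q :: 'a
  assumes "L-lipschitz_on UNIV f" "p \<noteq> q" shows "0 \<le> lip_const f"
proof -
  have "0 \<le> lip_const f * dist p q" using dist_le_lip_const[OF assms(1)] by (rule order_trans[rotated]) simp
  with assms(2) show ?thesis by (simp add: zero_le_mult_iff)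
qed

lemma lip_const_le:
  fixes f :: "'a::metric_space \<Rightarrow> 'b::metric_space" and p q :: 'a
  assumes "\<And>s t. dist (f s) (f t) \<le> C * dist s t" and "p \<noteq> q"
  shows "lip_const f \<le> C"
  unfolding lip_const_def
proof (rule cSUP_least)
  have "(p, q) \<in> {(s, t). s \<noteq> t}" using assms(2) by simp
  then show "{(s :: 'a, t). s \<noteq> t} \<noteq> {}" by blast
  show "(case x of (s, t) \<Rightarrow> dist (f s) (f t) / dist s t) \<le> C" if "x \<in> {(s, t). s \<noteq> t}" for x
    using that assms(1) by (auto simp: divide_le_eq)
qed

lemma norm_le_sup_norm:
  assumes "bounded (range f)" shows "norm (f t) \<le> sup_norm f"
proof -
  obtain B where "\<And>t. norm (f t) \<le> B" using assms by (auto simp: bounded_iff)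
  then have "bdd_above (range (\<lambda>t. norm (f t)))" by (intro bdd_aboveI[of _ B]) auto
  then show ?thesis unfolding sup_norm_def by (intro cSUP_upper) simp_all
qed

lemma sup_norm_le: "(\<And>t. norm (f t) \<le> B) \<Longrightarrow> sup_norm f \<le> B"
  unfolding sup_norm_def by (rule cSUP_least) simp_all

section \<open>Averaging along a random map\<close>

text \<open>
  The setting of the theorem: a random Lipschitz map of a compact metric space and a random bounded
  operator on a Hilbert space, whose averages exist as Bochner integrals.
\<close>

locale random_operator = hilbert_space_over K sc ip
  for K :: "complex set" and sc :: "complex \<Rightarrow> 'x::banach \<Rightarrow> 'x" and ip :: "'x \<Rightarrow> 'x \<Rightarrow> complex" +
  fixes W :: "'o measure"
    and \<omega> :: "'o \<Rightarrow> 't::metric_space \<Rightarrow> 't"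
    and R :: "'o \<Rightarrow> 'x \<Rightarrow> 'x"
  assumes compact_UNIV: "compact (UNIV :: 't set)"
    and two_points: "\<exists>s t :: 't. s \<noteq> t"
    and measurable_\<omega>: "(\<lambda>(t, \<theta>). \<omega> \<theta> t) \<in> measurable (borel \<Otimes>\<^sub>M W) borel"
    and measurable_R: "(\<lambda>(x, \<theta>). R \<theta> x) \<in> measurable (borel \<Otimes>\<^sub>M W) borel"
    and bounded_linear_R: "\<And>\<theta>. \<theta> \<in> space W \<Longrightarrow> bounded_linear (R \<theta>)"
    and R_sc: "\<And>\<theta> a x. \<theta> \<in> space W \<Longrightarrow> a \<in> K \<Longrightarrow> R \<theta> (sc a x) = sc a (R \<theta> x)"
    and lipschitz_\<omega>: "\<And>\<theta>. \<theta> \<in> space W \<Longrightarrow> \<exists>L. L-lipschitz_on UNIV (\<omega> \<theta>)"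
    and measurable_onorm: "(\<lambda>\<theta>. onorm (R \<theta>)) \<in> borel_measurable W"
    and integrable_onorm_lip: "integrable W (\<lambda>\<theta>. onorm (R \<theta>) * (1 + lip_const (\<omega> \<theta>)))"
    and strong: "\<And>(f :: 't \<Rightarrow>\<^sub>C 'x) t.
           bochner_integrable W (\<lambda>\<theta>. R \<theta> (apply_bcontfun f (\<omega> \<theta> t)))"
begin

lemma lip_nonneg: "\<theta> \<in> space W \<Longrightarrow> 0 \<le> lip_const (\<omega> \<theta>)"
  using lipschitz_\<omega> two_points lip_const_nonneg by metis

lemma dist_\<omega>_le: "\<theta> \<in> space W \<Longrightarrow> dist (\<omega> \<theta> s) (\<omega> \<theta> t) \<le> lip_const (\<omega> \<theta>) * dist s t"
  using lipschitz_\<omega> dist_le_lip_const by blast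

lemma onorm_nonneg: "\<theta> \<in> space W \<Longrightarrow> 0 \<le> onorm (R \<theta>)"
  by (rule onorm_pos_le[OF bounded_linear_R])

lemma integrable_onorm: "integrable W (\<lambda>\<theta>. onorm (R \<theta>))"
proof (rule Bochner_Integration.integrable_bound[OF integrable_onorm_lip measurable_onorm], rule AE_I2)
  fix \<theta> assume th: "\<theta> \<in> space W"
  show "norm (onorm (R \<theta>)) \<le> norm (onorm (R \<theta>) * (1 + lip_const (\<omega> \<theta>)))"
    using lip_nonneg[OF th] onorm_nonneg[OF th] by (simp add: abs_mult mult_le_cancel_left1)
qed

lemma integrable_onorm_mult_lip: "integrable W (\<lambda>\<theta>. onorm (R \<theta>) * lip_const (\<omega> \<theta>))"
  using Bochner_Integration.integrable_diff[OF integrable_onorm_lip integrable_onorm]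
  by (simp add: algebra_simps)

definition mean_onorm :: real where "mean_onorm = (\<integral>\<theta>. onorm (R \<theta>) \<partial>W)"

definition mean_lip :: real where "mean_lip = (\<integral>\<theta>. onorm (R \<theta>) * lip_const (\<omega> \<theta>) \<partial>W)"

lemma mean_onorm_nonneg: "0 \<le> mean_onorm"
  unfolding mean_onorm_def by (intro Bochner_Integration.integral_nonneg onorm_nonneg)

lemma mean_lip_nonneg: "0 \<le> mean_lip"
  unfolding mean_lip_def
  by (intro Bochner_Integration.integral_nonneg mult_nonneg_nonneg onorm_nonneg lip_nonneg)

lemma mean_sum: "(\<integral>\<theta>. onorm (R \<theta>) * (1 + lip_const (\<omega> \<theta>)) \<partial>W) = mean_onorm + mean_lip"
  using Bochner_Integration.integral_add[OF integrable_onorm integrable_onorm_mult_lip]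
  by (simp add: mean_onorm_def mean_lip_def distrib_left)

lemma measurable_\<omega>_section: "(\<lambda>\<theta>. \<omega> \<theta> t) \<in> measurable W borel"
proof -
  have "(\<lambda>\<theta>. (t, \<theta>)) \<in> measurable W (borel \<Otimes>\<^sub>M W)" by simp
  from measurable_compose[OF this measurable_\<omega>] show ?thesis by simp
qed

definition avg :: "('t \<Rightarrow> 'x) \<Rightarrow> 't \<Rightarrow> 'x" where
  "avg f t = weak_integral W (\<lambda>\<theta>. R \<theta> (f (\<omega> \<theta> t)))"

lemma weakly_dominated_avg:
  assumes f: "tot_measurable f" and B: "\<And>t. norm (f t) \<le> B"
  shows "weakly_dominated W (\<lambda>\<theta>. R \<theta> (f (\<omega> \<theta> t))) (\<lambda>\<theta>. onorm (R \<theta>) * B)"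
  unfolding weakly_dominated_def
proof (intro conjI allI ballI)
  have "(\<lambda>\<theta>. f (\<omega> \<theta> t)) \<in> measurable W borel"
    by (rule measurable_compose[OF measurable_\<omega>_section tot_measurable_borel[OF f]])
  then have "(\<lambda>\<theta>. (f (\<omega> \<theta> t), \<theta>)) \<in> measurable W (borel \<Otimes>\<^sub>M W)"
    by (intro measurable_Pair) simp_all
  from measurable_compose[OF this measurable_R]
  have m: "(\<lambda>\<theta>. R \<theta> (f (\<omega> \<theta> t))) \<in> measurable W borel" by simp
  have ipm: "ip z \<in> borel_measurable borel" for z
    by (intro borel_measurable_continuous_onI linear_continuous_on bounded_linear_ip_right)
  show "(\<lambda>\<theta>. ip z (R \<theta> (f (\<omega> \<theta> t)))) \<in> borel_measurable W" for z
    by (rule measurable_compose[OF m ipm])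
  show "integrable W (\<lambda>\<theta>. onorm (R \<theta>) * B)" using integrable_onorm by simp
  show "norm (R \<theta> (f (\<omega> \<theta> t))) \<le> onorm (R \<theta>) * B" if "\<theta> \<in> space W" for \<theta>
    using onorm[OF bounded_linear_R[OF that], of "f (\<omega> \<theta> t)"] mult_left_mono[OF B onorm_nonneg[OF that]]
    by (rule order_trans)
qed

lemma weakly_dominated_avg':
  assumes "tot_measurable f"
  obtains u where "weakly_dominated W (\<lambda>\<theta>. R \<theta> (f (\<omega> \<theta> t))) u"
proof -
  obtain B where "\<And>t. norm (f t) \<le> B" using tot_measurable_bounded[OF assms] by blast
  from that[OF weakly_dominated_avg[OF assms this]] show thesis .
qed

lemma ip_avg:
  assumes "tot_measurable f"
  shows "ip z (avg f t) = (\<integral>\<theta>. ip z (R \<theta> (f (\<omega> \<theta> t))) \<partial>W)"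
    and integrable_ip_avg: "integrable W (\<lambda>\<theta>. ip z (R \<theta> (f (\<omega> \<theta> t))))"
proof -
  obtain u where u: "weakly_dominated W (\<lambda>\<theta>. R \<theta> (f (\<omega> \<theta> t))) u"
    using weakly_dominated_avg'[OF assms] by blast
  show "ip z (avg f t) = (\<integral>\<theta>. ip z (R \<theta> (f (\<omega> \<theta> t))) \<partial>W)"
    unfolding avg_def by (rule ip_weak_integral[OF u])
  show "integrable W (\<lambda>\<theta>. ip z (R \<theta> (f (\<omega> \<theta> t))))" by (rule weakly_dominated_integrable[OF u])
qed

lemma norm_avg_diff_le:
  assumes f: "tot_measurable f" and g: "tot_measurable g"
    and b: "\<And>\<theta>. \<theta> \<in> space W \<Longrightarrow> norm (f (\<omega> \<theta> t) - g (\<omega> \<theta> s)) \<le> b \<theta>"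
    and i: "integrable W (\<lambda>\<theta>. onorm (R \<theta>) * b \<theta>)"
  shows "norm (avg f t - avg g s) \<le> (\<integral>\<theta>. onorm (R \<theta>) * b \<theta> \<partial>W)"
proof -
  obtain u where u: "weakly_dominated W (\<lambda>\<theta>. R \<theta> (f (\<omega> \<theta> t))) u"
    using weakly_dominated_avg'[OF f] by blast
  obtain w where w: "weakly_dominated W (\<lambda>\<theta>. R \<theta> (g (\<omega> \<theta> s))) w"
    using weakly_dominated_avg'[OF g] by blast
  show ?thesis
    unfolding avg_def
  proof (rule norm_weak_integral_diff_le[OF u w _ i])
    fix \<theta> assume th: "\<theta> \<in> space W"
    have "norm (R \<theta> (f (\<omega> \<theta> t)) - R \<theta> (g (\<omega> \<theta> s))) = norm (R \<theta> (f (\<omega> \<theta> t) - g (\<omega> \<theta> s)))"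
      by (simp add: linear_diff[OF bounded_linear.linear[OF bounded_linear_R[OF th]]])
    also have "\<dots> \<le> onorm (R \<theta>) * norm (f (\<omega> \<theta> t) - g (\<omega> \<theta> s))"
      by (rule onorm[OF bounded_linear_R[OF th]])
    also have "\<dots> \<le> onorm (R \<theta>) * b \<theta>" by (rule mult_left_mono[OF b[OF th] onorm_nonneg[OF th]])
    finally show "norm (R \<theta> (f (\<omega> \<theta> t)) - R \<theta> (g (\<omega> \<theta> s))) \<le> onorm (R \<theta>) * b \<theta>" .
  qed
qed

lemma tot_measurable_const: "tot_measurable (\<lambda>_ :: 't. c :: 'x)"
  by (rule tot_measurable_simple) simp

lemma avg_zero: "avg (\<lambda>_. 0) t = 0"
proof (rule ip_eqI)
  fix z
  have "ip z (avg (\<lambda>_. 0) t) = (\<integral>\<theta>. ip z (R \<theta> 0) \<partial>W)"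
    by (rule ip_avg[OF tot_measurable_const])
  also have "\<dots> = (\<integral>\<theta>. 0 \<partial>W)"
    by (rule Bochner_Integration.integral_cong)
      (simp_all add: linear_0[OF bounded_linear.linear[OF bounded_linear_R]])
  finally show "ip z (avg (\<lambda>_. 0) t) = ip z 0" by simp
qed

lemma norm_avg_close:
  assumes f: "tot_measurable f" and g: "tot_measurable g" and e: "\<And>t. norm (f t - g t) \<le> e"
  shows "norm (avg f t - avg g t) \<le> e * mean_onorm"
  using norm_avg_diff_le[OF f g, of t t "\<lambda>_. e"] e integrable_onorm
  by (simp add: mean_onorm_def mult.commute)

lemma norm_avg_le:
  assumes f: "tot_measurable f" and B: "\<And>t. norm (f t) \<le> B"
  shows "norm (avg f t) \<le> B * mean_onorm"
  using norm_avg_close[OF f tot_measurable_const[of 0], of B t] B by (simp add: avg_zero)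

text \<open>
  One estimate with two uses: \<open>a = 0\<close> gives the Lipschitz constant of the average of a Lipschitz
  function, and positive \<open>a\<close> gives continuity of the average of a continuous function.
\<close>

lemma norm_avg_modulus:
  assumes f: "tot_measurable f" and m: "\<And>u v. norm (f u - f v) \<le> a + b * dist u v" and b: "0 \<le> b"
  shows "norm (avg f t - avg f s) \<le> a * mean_onorm + b * mean_lip * dist t s"
proof -
  have "norm (avg f t - avg f s)
      \<le> (\<integral>\<theta>. onorm (R \<theta>) * (a + b * (lip_const (\<omega> \<theta>) * dist t s)) \<partial>W)"
  proof (rule norm_avg_diff_le[OF f f])
    show "norm (f (\<omega> \<theta> t) - f (\<omega> \<theta> s)) \<le> a + b * (lip_const (\<omega> \<theta>) * dist t s)"
      if "\<theta> \<in> space W" for \<theta>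
      using m[of "\<omega> \<theta> t" "\<omega> \<theta> s"] mult_left_mono[OF dist_\<omega>_le[OF that, of t s] b] by linarith
    have "integrable W (\<lambda>\<theta>. a * onorm (R \<theta>) + b * dist t s * (onorm (R \<theta>) * lip_const (\<omega> \<theta>)))"
      using integrable_onorm integrable_onorm_mult_lip by simp
    then show "integrable W (\<lambda>\<theta>. onorm (R \<theta>) * (a + b * (lip_const (\<omega> \<theta>) * dist t s)))"
      by (simp add: algebra_simps)
  qed
  also have "\<dots> = (\<integral>\<theta>. a * onorm (R \<theta>) + b * dist t s * (onorm (R \<theta>) * lip_const (\<omega> \<theta>)) \<partial>W)"
    by (simp add: algebra_simps)
  also have "\<dots> = a * mean_onorm + b * mean_lip * dist t s"
    unfolding mean_onorm_def mean_lip_def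
    using integrable_onorm integrable_onorm_mult_lip by simp
  finally show ?thesis .
qed

lemma avg_add:
  assumes f: "tot_measurable f" and g: "tot_measurable g"
  shows "avg (\<lambda>t. f t + g t) t = avg f t + avg g t"
proof (rule ip_eqI)
  fix z
  have "ip z (avg (\<lambda>t. f t + g t) t) = (\<integral>\<theta>. ip z (R \<theta> (f (\<omega> \<theta> t) + g (\<omega> \<theta> t))) \<partial>W)"
    by (rule ip_avg[OF tot_measurable_add[OF f g]])
  also have "\<dots> = (\<integral>\<theta>. ip z (R \<theta> (f (\<omega> \<theta> t))) + ip z (R \<theta> (g (\<omega> \<theta> t))) \<partial>W)"
    by (rule Bochner_Integration.integral_cong)
      (simp_all add: linear_add[OF bounded_linear.linear[OF bounded_linear_R]] ip_add_right)
  also have "\<dots> = ip z (avg f t) + ip z (avg g t)"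
    unfolding ip_avg(1)[OF f] ip_avg(1)[OF g]
    by (rule Bochner_Integration.integral_add[OF integrable_ip_avg[OF f] integrable_ip_avg[OF g]])
  finally show "ip z (avg (\<lambda>t. f t + g t) t) = ip z (avg f t + avg g t)" by (simp add: ip_add_right)
qed

lemma avg_sc:
  assumes f: "tot_measurable f" and a: "a \<in> K"
  shows "avg (\<lambda>t. sc a (f t)) t = sc a (avg f t)"
proof (rule ip_eqI)
  fix z
  have "ip z (avg (\<lambda>t. sc a (f t)) t) = (\<integral>\<theta>. ip z (R \<theta> (sc a (f (\<omega> \<theta> t)))) \<partial>W)"
    by (rule ip_avg[OF tot_measurable_sc[OF f a]])
  also have "\<dots> = (\<integral>\<theta>. cnj a * ip z (R \<theta> (f (\<omega> \<theta> t))) \<partial>W)"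
    by (rule Bochner_Integration.integral_cong) (simp_all add: R_sc a ip_sc_right)
  also have "\<dots> = cnj a * ip z (avg f t)"
    unfolding ip_avg(1)[OF f] by simp
  finally show "ip z (avg (\<lambda>t. sc a (f t)) t) = ip z (sc a (avg f t))" by (simp add: ip_sc_right a)
qed

lemma avg_sum:
  assumes f: "\<And>i. i \<in> I \<Longrightarrow> tot_measurable (f i)"
  shows "avg (\<lambda>t. \<Sum>i\<in>I. f i t) t = (\<Sum>i\<in>I. avg (f i) t)"
  using f
proof (induction I rule: infinite_finite_induct)
  case (insert i I)
  then show ?case using avg_add[of "f i" "\<lambda>t. \<Sum>i\<in>I. f i t"] by (simp add: tot_measurable_sum)
qed (simp_all add: avg_zero)

lemma tot_measurable_indicator:
  "A \<in> sets borel \<Longrightarrow> tot_measurable (\<lambda>t :: 't. indicator A t *\<^sub>R (x :: 'x))"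
  by (intro tot_measurable_simple simple_function_compose1[OF simple_function_indicator])

lemma simple_eq_sum_indicator:
  fixes s :: "'t \<Rightarrow> 'x"
  assumes "simple_function borel s"
  shows "s = (\<lambda>t. \<Sum>x\<in>range s. indicator (s -` {x}) t *\<^sub>R x)"
proof
  fix t
  have fin: "finite (range s)" using simple_functionD(1)[OF assms] by simp
  have "(\<Sum>x\<in>range s. indicator (s -` {x}) t *\<^sub>R x) = (\<Sum>x\<in>range s. if s t = x then x else 0)"
    by (rule sum.cong) (simp_all add: indicator_def)
  then show "s t = (\<Sum>x\<in>range s. indicator (s -` {x}) t *\<^sub>R x)" using fin by (simp add: sum.delta)
qed

end

section \<open>Averages are totally measurable and continuous\<close>

context random_operator
begin

text \<open>
  The mass, with respect to the finite measure \<open>u dW\<close>, of the parameters that send \<open>t\<close> into \<open>A\<close>. It is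
  a section of a product measure, which is why it depends measurably on \<open>t\<close> although \<open>W\<close> itself
  may fail to be \<open>\<sigma>\<close>-finite.
\<close>

definition weighted :: "('o \<Rightarrow> real) \<Rightarrow> 't set \<Rightarrow> 't \<Rightarrow> real" where
  "weighted u A t = (\<integral>\<theta>. u \<theta> * indicator A (\<omega> \<theta> t) \<partial>W)"

lemma integrable_weighted:
  fixes u :: "'o \<Rightarrow> real"
  assumes "integrable W u" "A \<in> sets borel"
  shows "integrable W (\<lambda>\<theta>. u \<theta> * indicator A (\<omega> \<theta> t))"
proof (rule Bochner_Integration.integrable_bound[OF assms(1)])
  have "(\<lambda>\<theta>. indicator A (\<omega> \<theta> t) :: real) \<in> borel_measurable W"
    by (rule measurable_compose[OF measurable_\<omega>_section borel_measurable_indicator[OF assms(2)]])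
  with borel_measurable_integrable[OF assms(1)]
  show "(\<lambda>\<theta>. u \<theta> * indicator A (\<omega> \<theta> t)) \<in> borel_measurable W" by (rule borel_measurable_times)
  show "AE \<theta> in W. norm (u \<theta> * indicator A (\<omega> \<theta> t)) \<le> norm (u \<theta>)"
    by (rule AE_I2) (simp add: indicator_def)
qed

lemma weighted_bounds:
  assumes u: "integrable W u" "\<And>\<theta>. \<theta> \<in> space W \<Longrightarrow> 0 \<le> u \<theta>" and A: "A \<in> sets borel"
  shows "0 \<le> weighted u A t" "weighted u A t \<le> (\<integral>\<theta>. u \<theta> \<partial>W)"
proof -
  show "0 \<le> weighted u A t"
    unfolding weighted_def using u(2) by (intro Bochner_Integration.integral_nonneg) simp
  show "weighted u A t \<le> (\<integral>\<theta>. u \<theta> \<partial>W)"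
    unfolding weighted_def
    by (rule integral_mono[OF integrable_weighted[OF u(1) A] u(1)]) (use u(2) in \<open>simp add: indicator_def\<close>)
qed

lemma finite_density:
  assumes u: "integrable W u" "\<And>\<theta>. \<theta> \<in> space W \<Longrightarrow> 0 \<le> u \<theta>"
  shows "finite_measure (density W u)"
proof
  have "emeasure (density W u) (space (density W u)) = (\<integral>\<^sup>+\<theta>. ennreal (u \<theta>) * indicator (space W) \<theta> \<partial>W)"
    using u(1) by (simp add: emeasure_density borel_measurable_integrable)
  also have "\<dots> = (\<integral>\<^sup>+\<theta>. ennreal (u \<theta>) \<partial>W)" by (rule nn_integral_cong) simp
  also have "\<dots> = ennreal (\<integral>\<theta>. u \<theta> \<partial>W)" by (rule nn_integral_eq_integral[OF u(1)]) (simp add: u(2))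
  finally show "emeasure (density W u) (space (density W u)) \<noteq> \<infinity>" by simp
qed

lemma emeasure_density_section:
  assumes u: "integrable W u" "\<And>\<theta>. \<theta> \<in> space W \<Longrightarrow> 0 \<le> u \<theta>" and A: "A \<in> sets borel"
  shows "emeasure (density W u) (Pair t -` ((\<lambda>(t, \<theta>). \<omega> \<theta> t) -` A \<inter> space (borel \<Otimes>\<^sub>M W)))
    = ennreal (weighted u A t)"
proof -
  have eq: "Pair t -` ((\<lambda>(t, \<theta>). \<omega> \<theta> t) -` A \<inter> space (borel \<Otimes>\<^sub>M W)) = (\<lambda>\<theta>. \<omega> \<theta> t) -` A \<inter> space W"
    by (auto simp: space_pair_measure)
  have m: "(\<lambda>\<theta>. \<omega> \<theta> t) -` A \<inter> space W \<in> sets W" using measurable_\<omega>_section A by (rule measurable_sets)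
  have "emeasure (density W u) ((\<lambda>\<theta>. \<omega> \<theta> t) -` A \<inter> space W)
      = (\<integral>\<^sup>+\<theta>. ennreal (u \<theta>) * indicator ((\<lambda>\<theta>. \<omega> \<theta> t) -` A \<inter> space W) \<theta> \<partial>W)"
    using u(1) m by (simp add: emeasure_density borel_measurable_integrable)
  also have "\<dots> = (\<integral>\<^sup>+\<theta>. ennreal (u \<theta> * indicator A (\<omega> \<theta> t)) \<partial>W)"
    by (rule nn_integral_cong) (simp add: indicator_def)
  also have "\<dots> = ennreal (weighted u A t)"
    unfolding weighted_def
    by (rule nn_integral_eq_integral[OF integrable_weighted[OF u(1) A]]) (simp add: u(2))
  finally show ?thesis unfolding eq .
qed

lemma measurable_weighted:
  assumes u: "integrable W u" "\<And>\<theta>. \<theta> \<in> space W \<Longrightarrow> 0 \<le> u \<theta>" and A: "A \<in> sets borel"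
  shows "weighted u A \<in> borel_measurable borel"
proof -
  interpret D: finite_measure "density W u" by (rule finite_density[OF u])
  let ?E = "(\<lambda>(t, \<theta>). \<omega> \<theta> t) -` A \<inter> space (borel \<Otimes>\<^sub>M W)"
  have "?E \<in> sets (borel \<Otimes>\<^sub>M W)" using measurable_\<omega> A by (rule measurable_sets)
  then have "?E \<in> sets (borel \<Otimes>\<^sub>M density W u)" by (simp cong: sets_pair_measure_cong)
  from D.measurable_emeasure_Pair[OF this]
  have "(\<lambda>t. ennreal (weighted u A t)) \<in> borel_measurable borel"
    by (simp only: emeasure_density_section[OF u A])
  then have "(\<lambda>t. enn2real (ennreal (weighted u A t))) \<in> borel_measurable borel" by measurable
  then show ?thesis by (simp add: weighted_bounds(1)[OF u A])
qed

lemma strong_approximation: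
  assumes "0 < e"
  obtains s where "Bochner_Integration.simple_bochner_integrable W s"
    "integrable W (\<lambda>\<theta>. norm (R \<theta> x - s \<theta>))" "(\<integral>\<theta>. norm (R \<theta> x - s \<theta>) \<partial>W) \<le> e"
proof -
  \<comment> \<open>The constant function with value \<open>x\<close> is continuous, so its average is a Bochner integral.\<close>
  have "bochner_integrable W (\<lambda>\<theta>. R \<theta> x)"
    using strong[of "const_bcontfun x"] by (simp add: const_bcontfun.rep_eq)
  then obtain s where fm: "(\<lambda>\<theta>. R \<theta> x) \<in> borel_measurable W"
    and s: "\<And>i::nat. Bochner_Integration.simple_bochner_integrable W (s i)"
    and l1: "(\<lambda>i. \<integral>\<^sup>+\<theta>. ennreal (norm (R \<theta> x - s i \<theta>)) \<partial>W) \<longlonglongrightarrow> 0"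
    unfolding bochner_integrable_def has_bochner_def by blast
  have "\<forall>\<^sub>F i in sequentially. (\<integral>\<^sup>+\<theta>. ennreal (norm (R \<theta> x - s i \<theta>)) \<partial>W) < ennreal e"
    using l1 assms by (intro order_tendstoD(2)[of _ 0]) simp_all
  then obtain i where i: "(\<integral>\<^sup>+\<theta>. ennreal (norm (R \<theta> x - s i \<theta>)) \<partial>W) < ennreal e"
    by (auto simp: eventually_sequentially)
  have "simple_function W (s i)" using s[of i] by (auto elim: simple_bochner_integrable.cases)
  from borel_measurable_norm_diff_simple[OF fm this]
  have m: "(\<lambda>\<theta>. norm (R \<theta> x - s i \<theta>)) \<in> borel_measurable W" .
  have int: "integrable W (\<lambda>\<theta>. norm (R \<theta> x - s i \<theta>))"
    using m order_less_trans[OF i] by (intro integrableI_bounded) simp_all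
  have "ennreal (\<integral>\<theta>. norm (R \<theta> x - s i \<theta>) \<partial>W) < ennreal e"
    using i nn_integral_eq_integral[OF int] by simp
  then have "(\<integral>\<theta>. norm (R \<theta> x - s i \<theta>) \<partial>W) \<le> e"
    using assms by (simp add: ennreal_less_iff)
  with s int show thesis by (rule that)
qed

text \<open>
  Approximate \<open>R\<^sub>\<theta> x\<close> in mean by a simple function of \<open>\<theta>\<close> with values \<open>y\<close>. The average is then
  uniformly close in \<open>t\<close> to a finite sum of vectors \<open>y\<close> with bounded measurable scalar coefficients,
  and such a sum is totally measurable.
\<close>

lemma tot_measurable_avg_indicator:
  assumes A: "A \<in> sets borel"
  shows "tot_measurable (avg (\<lambda>t. indicator A t *\<^sub>R x))"
proof (rule tot_measurable_approx)
  fix e :: real assume e: "0 < e"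
  let ?f = "\<lambda>t. indicator A t *\<^sub>R x"
  have f: "tot_measurable ?f" by (rule tot_measurable_indicator[OF A])
  obtain s where s: "Bochner_Integration.simple_bochner_integrable W s"
    and i: "integrable W (\<lambda>\<theta>. norm (R \<theta> x - s \<theta>))" "(\<integral>\<theta>. norm (R \<theta> x - s \<theta>) \<partial>W) \<le> e"
    using strong_approximation[OF e] by blast
  have sf: "simple_function W s" and fin: "emeasure W {\<theta> \<in> space W. s \<theta> \<noteq> 0} \<noteq> \<infinity>"
    using s by (auto elim: simple_bochner_integrable.cases)
  \<comment> \<open>The value \<open>0\<close> is left out because its level set may have infinite measure.\<close>
  define Y where "Y = s ` space W - {0}"
  have Y: "finite Y" using simple_functionD(1)[OF sf] by (simp add: Y_def)
  define c where "c y = (indicator (s -` {y} \<inter> space W) :: 'o \<Rightarrow> real)" for y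
  have Bm: "s -` {y} \<inter> space W \<in> sets W" for y using sf by (rule simple_functionD(2))
  have c: "integrable W (c y)" if "y \<in> Y" for y
  proof -
    have "emeasure W (s -` {y} \<inter> space W) \<le> emeasure W {\<theta> \<in> space W. s \<theta> \<noteq> 0}"
    proof (rule emeasure_mono)
      show "s -` {y} \<inter> space W \<subseteq> {\<theta> \<in> space W. s \<theta> \<noteq> 0}" using that by (auto simp: Y_def)
      have "{\<theta> \<in> space W. s \<theta> \<noteq> 0} = s -` (UNIV - {0}) \<inter> space W" by auto
      then show "{\<theta> \<in> space W. s \<theta> \<noteq> 0} \<in> sets W" using simple_functionD(2)[OF sf] by metis
    qed
    with fin have "emeasure W (s -` {y} \<inter> space W) < \<infinity>"
      by (metis infinity_ennreal_def le_less_trans top.not_eq_extremum)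
    with Bm show ?thesis unfolding c_def by (intro integrable_real_indicator)
  qed
  have c0: "0 \<le> c y \<theta>" for y \<theta> by (simp add: c_def)
  define k where "k t = (\<Sum>y\<in>Y. weighted (c y) A t *\<^sub>R y)" for t
  have "tot_measurable k"
    unfolding k_def
  proof (rule tot_measurable_sum)
    fix y assume "y \<in> Y"
    note cy = c[OF this]
    show "tot_measurable (\<lambda>t. weighted (c y) A t *\<^sub>R y)"
      using weighted_bounds[OF cy c0 A]
      by (intro tot_measurable_scaleR[where B = "\<integral>\<theta>. c y \<theta> \<partial>W"] measurable_weighted[OF cy c0 A]) simp
  qed
  moreover have "norm (avg ?f t - k t) \<le> e" for t
  proof (rule norm_le_ip)
    fix z
    let ?a = "\<lambda>\<theta>. indicator A (\<omega> \<theta> t) :: real"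
    have s_eq: "s \<theta> = (\<Sum>y\<in>Y. c y \<theta> *\<^sub>R y)" if th: "\<theta> \<in> space W" for \<theta>
    proof -
      have "(\<Sum>y\<in>Y. c y \<theta> *\<^sub>R y) = (\<Sum>y\<in>Y. if s \<theta> = y then y else 0)"
        using th by (intro sum.cong) (simp_all add: c_def indicator_def)
      also have "\<dots> = s \<theta>" using Y th by (simp add: sum.delta) (simp add: Y_def)
      finally show ?thesis by simp
    qed
    have ck: "integrable W (\<lambda>\<theta>. (c y \<theta> * ?a \<theta>) *\<^sub>R ip z y)" if "y \<in> Y" for y
      by (rule integrable_scaleR_left) (rule integrable_weighted[OF c[OF that] A])
    have "ip z (k t) = (\<Sum>y\<in>Y. \<integral>\<theta>. (c y \<theta> * ?a \<theta>) *\<^sub>R ip z y \<partial>W)"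
      unfolding k_def ip_sum_right weighted_def
    proof (rule sum.cong[OF refl])
      fix y assume "y \<in> Y"
      show "ip z ((\<integral>\<theta>. c y \<theta> * ?a \<theta> \<partial>W) *\<^sub>R y) = (\<integral>\<theta>. (c y \<theta> * ?a \<theta>) *\<^sub>R ip z y \<partial>W)"
        using integral_scaleR_left[OF integrable_weighted[OF c[OF \<open>y \<in> Y\<close>] A], of t "ip z y"]
        by (simp only: ip_scaleR_right scaleR_conv_of_real)
    qed
    also have "\<dots> = (\<integral>\<theta>. (\<Sum>y\<in>Y. (c y \<theta> * ?a \<theta>) *\<^sub>R ip z y) \<partial>W)"
      by (rule Bochner_Integration.integral_sum[symmetric]) (rule ck)
    finally have k: "ip z (k t) = (\<integral>\<theta>. (\<Sum>y\<in>Y. (c y \<theta> * ?a \<theta>) *\<^sub>R ip z y) \<partial>W)" .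
    have ik: "integrable W (\<lambda>\<theta>. \<Sum>y\<in>Y. (c y \<theta> * ?a \<theta>) *\<^sub>R ip z y)"
      by (rule Bochner_Integration.integrable_sum) (rule ck)
    have eq: "ip z (R \<theta> (?f (\<omega> \<theta> t))) - (\<Sum>y\<in>Y. (c y \<theta> * ?a \<theta>) *\<^sub>R ip z y)
        = ip z (?a \<theta> *\<^sub>R (R \<theta> x - s \<theta>))" if th: "\<theta> \<in> space W" for \<theta>
    proof -
      have "R \<theta> (?f (\<omega> \<theta> t)) = ?a \<theta> *\<^sub>R R \<theta> x"
        by (rule linear_scale[OF bounded_linear.linear[OF bounded_linear_R[OF th]]])
      moreover have "(\<Sum>y\<in>Y. (c y \<theta> * ?a \<theta>) *\<^sub>R ip z y) = ip z (?a \<theta> *\<^sub>R s \<theta>)"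
        unfolding s_eq[OF th] scaleR_sum_right ip_sum_right
        by (rule sum.cong) (simp_all add: ip_scaleR_right scaleR_conv_of_real mult_ac)
      ultimately show ?thesis by (simp add: scaleR_diff_right ip_diff_right)
    qed
    have id: "integrable W (\<lambda>\<theta>. ip z (?a \<theta> *\<^sub>R (R \<theta> x - s \<theta>)))"
      using Bochner_Integration.integrable_diff[OF integrable_ip_avg[OF f, of z t] ik]
      by (subst Bochner_Integration.integrable_cong[OF refl eq[symmetric]])
    have "ip z (avg ?f t - k t) = (\<integral>\<theta>. ip z (R \<theta> (?f (\<omega> \<theta> t))) - (\<Sum>y\<in>Y. (c y \<theta> * ?a \<theta>) *\<^sub>R ip z y) \<partial>W)"
      unfolding ip_diff_right k ip_avg(1)[OF f]
      by (rule Bochner_Integration.integral_diff[symmetric, OF integrable_ip_avg[OF f] ik])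
    also have "\<dots> = (\<integral>\<theta>. ip z (?a \<theta> *\<^sub>R (R \<theta> x - s \<theta>)) \<partial>W)"
      by (rule Bochner_Integration.integral_cong[OF refl eq])
    finally have "cmod (ip z (avg ?f t - k t)) \<le> (\<integral>\<theta>. norm (R \<theta> x - s \<theta>) \<partial>W) * norm z"
      using norm_integral_ip_le[OF _ i(1) id] by (simp add: indicator_def)
    also have "\<dots> \<le> e * norm z" by (rule mult_right_mono[OF i(2)]) simp
    finally show "cmod (ip z (avg ?f t - k t)) \<le> e * norm z" .
  qed (use e in simp)
  ultimately show "\<exists>g. tot_measurable g \<and> (\<forall>t. norm (avg ?f t - g t) \<le> e)" by blast
qed

lemma avg_simple:
  assumes s: "simple_function borel s"
  shows "avg s t = (\<Sum>x\<in>range s. avg (\<lambda>t. indicator (s -` {x}) t *\<^sub>R x) t)"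
proof -
  have bor: "s -` {x} \<in> sets borel" for x using simple_functionD(2)[OF s, of "{x}"] by simp
  have "avg s t = avg (\<lambda>t. \<Sum>x\<in>range s. indicator (s -` {x}) t *\<^sub>R x) t"
    using simple_eq_sum_indicator[OF s] by (rule arg_cong)
  also have "\<dots> = (\<Sum>x\<in>range s. avg (\<lambda>t. indicator (s -` {x}) t *\<^sub>R x) t)"
    by (rule avg_sum) (rule tot_measurable_indicator[OF bor])
  finally show ?thesis .
qed

lemma tot_measurable_avg:
  assumes f: "tot_measurable f" shows "tot_measurable (avg f)"
proof (rule tot_measurable_approx)
  fix e :: real assume e: "0 < e"
  obtain s where s: "simple_function borel s" "\<And>t. norm (f t - s t) \<le> e / (mean_onorm + 1)"
    using tot_measurableD[OF f, of "e / (mean_onorm + 1)"] e mean_onorm_nonneg by auto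
  have bor: "s -` {x} \<in> sets borel" for x using simple_functionD(2)[OF s(1), of "{x}"] by simp
  have "tot_measurable (avg s)"
    unfolding avg_simple[OF s(1), abs_def]
    by (intro tot_measurable_sum tot_measurable_avg_indicator bor)
  moreover have "norm (avg f t - avg s t) \<le> e" for t
  proof -
    have "norm (avg f t - avg s t) \<le> e / (mean_onorm + 1) * mean_onorm"
      by (rule norm_avg_close[OF f tot_measurable_simple[OF s(1)] s(2)])
    also have "\<dots> \<le> e" using e mean_onorm_nonneg by (simp add: field_simps)
    finally show ?thesis .
  qed
  ultimately show "\<exists>g. tot_measurable g \<and> (\<forall>t. norm (avg f t - g t) \<le> e)" by blast
qed

text \<open>
  A uniformly continuous function bounded by \<open>B\<close> satisfies
  \<open>\<parallel>f u - f v\<parallel> \<le> \<epsilon> + (2 B / \<delta>) d(u, v)\<close>, where \<open>\<delta>\<close> belongs to \<open>\<epsilon>\<close>. This makes the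
  integrability of \<open>\<parallel>R\<^sub>\<theta>\<parallel> r\<^sub>\<theta>\<close> available for all continuous functions.
\<close>

lemma continuous_avg:
  assumes cont: "continuous_on UNIV f" shows "continuous_on UNIV (avg f)"
  unfolding continuous_on_iff
proof (intro ballI allI impI)
  fix t :: 't and e :: real assume e: "0 < e"
  have f: "tot_measurable f" by (rule tot_measurable_continuous[OF compact_UNIV cont])
  obtain B where B: "0 \<le> B" "\<And>t. norm (f t) \<le> B" using tot_measurable_bounded[OF f] by blast
  define e' where "e' = e / (2 * (mean_onorm + 1))"
  have e': "0 < e'" using e mean_onorm_nonneg by (simp add: e'_def)
  have "uniformly_continuous_on UNIV f"
    using cont compact_UNIV by (rule compact_uniformly_continuous)
  then obtain d where d: "0 < d" "\<And>u v. dist u v < d \<Longrightarrow> dist (f u) (f v) < e'"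
    using e' unfolding uniformly_continuous_on_def by (metis UNIV_I)
  define b where "b = 2 * B / d"
  have b: "0 \<le> b" using B d by (simp add: b_def)
  have mod: "norm (f u - f v) \<le> e' + b * dist u v" for u v
  proof (cases "dist u v < d")
    case True
    have "0 \<le> b * dist u v" using b by simp
    with d(2)[OF True] show ?thesis by (simp add: dist_norm)
  next
    case False
    have "norm (f u - f v) \<le> 2 * B" using norm_triangle_ineq4[of "f u" "f v"] B(2)[of u] B(2)[of v] by simp
    also have "\<dots> = b * d" using d by (simp add: b_def)
    also have "\<dots> \<le> b * dist u v" using False b by (intro mult_left_mono) simp_all
    finally show ?thesis using e' by simp
  qed
  let ?D = "e / (2 * (b * mean_lip + 1))"
  have m: "0 \<le> b * mean_lip" using b mean_lip_nonneg by simp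
  have "dist (avg f s) (avg f t) < e" if "dist s t < ?D" for s
  proof -
    have "dist (avg f s) (avg f t) \<le> e' * mean_onorm + b * mean_lip * dist s t"
      unfolding dist_norm by (rule norm_avg_modulus[OF f mod b, unfolded dist_norm])
    also have "e' * mean_onorm < e / 2" using e mean_onorm_nonneg by (simp add: e'_def field_simps)
    also have "b * mean_lip * dist s t \<le> b * mean_lip * ?D"
      using that m by (intro mult_left_mono) simp_all
    also have "b * mean_lip * ?D \<le> e / 2" using e m by (simp add: field_simps)
    finally show ?thesis by simp
  qed
  moreover have "0 < ?D" using e m by simp
  ultimately show "\<exists>d>0. \<forall>s\<in>UNIV. dist s t < d \<longrightarrow> dist (avg f s) (avg f t) < e" by blast
qed

lemma apply_H_C: "apply_bcontfun (H_C W \<omega> R f) = avg (apply_bcontfun f)"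
proof -
  have cont: "continuous_on UNIV (apply_bcontfun f)" by simp
  have f: "tot_measurable (apply_bcontfun f)" by (rule tot_measurable_continuous[OF compact_UNIV cont])
  have "bochner_integral W (\<lambda>\<theta>. R \<theta> (apply_bcontfun f (\<omega> \<theta> t))) = avg (apply_bcontfun f) t" for t
  proof -
    obtain u where "weakly_dominated W (\<lambda>\<theta>. R \<theta> (apply_bcontfun f (\<omega> \<theta> t))) u"
      using weakly_dominated_avg'[OF f] by blast
    from bochner_integral_eq_weak_integral[OF strong this] show ?thesis by (simp add: avg_def)
  qed
  then have "H_C W \<omega> R f = Bcontfun (avg (apply_bcontfun f))" by (simp add: H_C_def)
  then show ?thesis using Bcontfun_compact_inverse[OF compact_UNIV continuous_avg[OF cont]] by simp
qed

end

section \<open>The transported measure\<close>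

context random_operator
begin

text \<open>
  The measure is the image under \<open>\<omega>\<close> of the product of the variation of \<open>\<mu>\<close> and the finite measure
  \<open>\<parallel>R\<^sub>\<theta>\<parallel> dW\<close>: the average of \<open>1\<^sub>A x\<close> at \<open>t\<close> has norm at most \<open>\<parallel>x\<parallel>\<close> times the mass of the
  section at \<open>t\<close>, and integrating the sections over \<open>t\<close> gives the product measure.
\<close>

lemma dominating_measure:
  fixes \<mu> :: "'t set \<Rightarrow> 'x"
  assumes mu: "\<mu> \<in> cabv"
  obtains L where "finite_measure L" "sets L = sets (borel :: 't measure)"
    "\<And>A x. A \<in> sets borel \<Longrightarrow>
      cmod (uniform_integral ip (avg (\<lambda>t. indicator A t *\<^sub>R x)) \<mu>) \<le> measure L A * norm x"
proof -
  let ?V = "variation_measure \<mu>" and ?u = "\<lambda>\<theta>. onorm (R \<theta>)"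
  let ?D = "density W ?u"
  note u = integrable_onorm onorm_nonneg
  interpret V: finite_measure ?V using mu by (rule finite_variation_measure)
  interpret D: finite_measure ?D by (rule finite_density[OF u])
  define L where "L = distr (?V \<Otimes>\<^sub>M ?D) borel (\<lambda>(t, \<theta>). \<omega> \<theta> t)"
  have sets_VD: "sets (?V \<Otimes>\<^sub>M ?D) = sets (borel \<Otimes>\<^sub>M W)" by (intro sets_pair_measure_cong) simp_all
  have space_VD: "space (?V \<Otimes>\<^sub>M ?D) = space (borel \<Otimes>\<^sub>M W)" by (simp add: space_pair_measure)
  have meas: "(\<lambda>(t, \<theta>). \<omega> \<theta> t) \<in> measurable (?V \<Otimes>\<^sub>M ?D) borel"
    using measurable_\<omega> by (simp only: measurable_cong_sets[OF sets_VD refl])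
  have wV: "weighted ?u A \<in> borel_measurable ?V" if A: "A \<in> sets borel" for A
    using measurable_weighted[OF u A] by (simp only: measurable_cong_sets[OF sets_variation_measure refl])
  have wi: "integrable ?V (weighted ?u A)" if A: "A \<in> sets borel" for A
    using weighted_bounds[OF u A] wV[OF A]
    by (intro V.integrable_const_bound[where B = "\<integral>\<theta>. onorm (R \<theta>) \<partial>W"]) simp_all
  have em: "emeasure L A = ennreal (\<integral>t. weighted ?u A t \<partial>?V)" if A: "A \<in> sets borel" for A
  proof -
    let ?E = "(\<lambda>(t, \<theta>). \<omega> \<theta> t) -` A \<inter> space (borel \<Otimes>\<^sub>M W)"
    have "?E \<in> sets (borel \<Otimes>\<^sub>M W)" using measurable_\<omega> A by (rule measurable_sets)
    then have E: "?E \<in> sets (?V \<Otimes>\<^sub>M ?D)" by (simp only: sets_VD)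
    have "emeasure L A = emeasure (?V \<Otimes>\<^sub>M ?D) ?E"
      unfolding L_def using meas A by (simp add: emeasure_distr space_VD)
    also have "\<dots> = (\<integral>\<^sup>+t. ennreal (weighted ?u A t) \<partial>?V)"
      by (simp only: D.emeasure_pair_measure_alt[OF E] emeasure_density_section[OF u A])
    also have "\<dots> = ennreal (\<integral>t. weighted ?u A t \<partial>?V)"
      by (rule nn_integral_eq_integral[OF wi[OF A]]) (simp add: weighted_bounds[OF u A])
    finally show ?thesis .
  qed
  have ms: "measure L A = (\<integral>t. weighted ?u A t \<partial>?V)" if A: "A \<in> sets borel" for A
    unfolding measure_def em[OF A]
    by (rule enn2real_ennreal) (intro Bochner_Integration.integral_nonneg weighted_bounds(1)[OF u A])
  show thesis
  proof (rule that)
    show "sets L = sets borel" by (simp add: L_def)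
    show "finite_measure L"
    proof
      show "emeasure L (space L) \<noteq> \<infinity>" using em[of UNIV] by (simp add: L_def)
    qed
    fix A :: "'t set" and x :: 'x assume A: "A \<in> sets borel"
    let ?f = "\<lambda>t. indicator A t *\<^sub>R x"
    have f: "tot_measurable ?f" by (rule tot_measurable_indicator[OF A])
    have a: "norm (avg ?f t) \<le> weighted ?u A t * norm x" for t
    proof -
      have i: "integrable W (\<lambda>\<theta>. onorm (R \<theta>) * indicator A (\<omega> \<theta> t) * norm x)"
        by (intro integrable_mult_left) (intro impI integrable_weighted integrable_onorm A)
      have "norm (avg ?f t - avg (\<lambda>_. 0) t) \<le> (\<integral>\<theta>. onorm (R \<theta>) * (indicator A (\<omega> \<theta> t) * norm x) \<partial>W)"
        by (rule norm_avg_diff_le[OF f tot_measurable_const]) (use i in \<open>simp_all add: mult.assoc\<close>)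
      also have "\<dots> = weighted ?u A t * norm x"
        by (simp add: weighted_def mult.assoc[symmetric])
      finally show ?thesis by (simp add: avg_zero)
    qed
    have "cmod (uniform_integral ip (avg ?f) \<mu>) \<le> (\<integral>t. norm (avg ?f t) \<partial>?V)"
      by (rule uniform_integral_le[OF mu tot_measurable_avg[OF f]])
    also have "\<dots> \<le> (\<integral>t. weighted ?u A t * norm x \<partial>?V)"
    proof (rule integral_mono)
      show "integrable ?V (\<lambda>t. norm (avg ?f t))"
        by (rule tot_measurable_integrable_norm[OF tot_measurable_avg[OF f] V.finite_measure_axioms]) simp
      show "integrable ?V (\<lambda>t. weighted ?u A t * norm x)" using wi[OF A] by simp
    qed (rule a)
    finally show "cmod (uniform_integral ip (avg ?f) \<mu>) \<le> measure L A * norm x"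
      by (simp add: ms[OF A])
  qed
qed

text \<open>
  On indicator functions the required identity prescribes the scalar products of \<open>\<nu>(A)\<close> with all
  vectors, so it can be taken as the definition of \<open>\<nu>\<close>. It extends to simple functions by linearity
  and to all totally measurable functions because both sides are continuous under uniform limits.
\<close>

lemma transported_measure_exists:
  fixes \<mu> :: "'t set \<Rightarrow> 'x"
  assumes mu: "\<mu> \<in> cabv"
  obtains \<nu> :: "'t set \<Rightarrow> 'x" where "\<nu> \<in> cabv"
    "\<And>f. tot_measurable f \<Longrightarrow> uniform_integral ip f \<nu> = uniform_integral ip (avg f) \<mu>"
proof -
  obtain L where L: "finite_measure L" "sets L = sets (borel :: 't measure)"
    and dom: "\<And>A x. A \<in> sets borel \<Longrightarrow>
      cmod (uniform_integral ip (avg (\<lambda>t. indicator A t *\<^sub>R x)) \<mu>) \<le> measure L A * norm x"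
    using dominating_measure[OF mu] by blast
  define J where "J A x = uniform_integral ip (avg (\<lambda>t. indicator A t *\<^sub>R x)) \<mu>" for A and x :: 'x
  note ti = tot_measurable_indicator and ta = tot_measurable_avg
  have "\<exists>v. \<forall>x. J A x = ip x v" if A: "A \<in> sets borel" for A
  proof (rule functional_representable)
    show "J A (x + y) = J A x + J A y" for x y
    proof -
      have "avg (\<lambda>t. indicator A t *\<^sub>R (x + y))
          = (\<lambda>t. avg (\<lambda>t. indicator A t *\<^sub>R x) t + avg (\<lambda>t. indicator A t *\<^sub>R y) t)"
        using avg_add[OF ti[OF A] ti[OF A], of x y] by (simp add: scaleR_add_right fun_eq_iff)
      then show ?thesis
        unfolding J_def using uniform_integral_add[OF mu ta[OF ti[OF A]] ta[OF ti[OF A]]] by simp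
    qed
    show "J A (sc a x) = a * J A x" if a: "a \<in> K" for a x
    proof -
      interpret bounded_linear "sc a" using a by (rule bounded_linear_sc)
      have "avg (\<lambda>t. indicator A t *\<^sub>R sc a x) = (\<lambda>t. sc a (avg (\<lambda>t. indicator A t *\<^sub>R x) t))"
        using avg_sc[OF ti[OF A] a, of x] by (simp add: scaleR fun_eq_iff)
      then show ?thesis unfolding J_def using uniform_integral_sc[OF mu ta[OF ti[OF A]] a] by simp
    qed
    show "J A x \<in> K" for x unfolding J_def by (rule uniform_integral_in_K[OF mu ta[OF ti[OF A]]])
    show "cmod (J A x) \<le> measure L A * norm x" for x unfolding J_def by (rule dom[OF A])
  qed
  then obtain v where v: "\<And>A x. A \<in> sets borel \<Longrightarrow> J A x = ip x (v A)" by metis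
  define \<nu> where "\<nu> A = (if A \<in> sets borel then v A else 0)" for A
  have nu_J: "ip x (\<nu> A) = J A x" if "A \<in> sets borel" for A x using v[OF that] that by (simp add: \<nu>_def)
  have nu: "\<nu> \<in> cabv"
  proof (rule cabvI[OF _ _ L])
    show "\<nu> A = 0" if "A \<notin> sets borel" for A using that by (simp add: \<nu>_def)
    show "norm (\<nu> A) \<le> measure L A" if A: "A \<in> sets borel" for A
      by (rule norm_le_ip) (simp_all add: nu_J[OF A] J_def dom[OF A])
    show "\<nu> (A \<union> B) = \<nu> A + \<nu> B" if A: "A \<in> sets borel" and B: "B \<in> sets borel" and AB: "A \<inter> B = {}" for A B
    proof (rule ip_eqI)
      fix z :: 'x
      have "indicator (A \<union> B) t *\<^sub>R z = indicator A t *\<^sub>R z + indicator B t *\<^sub>R z" for t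
        using AB by (auto simp: indicator_def)
      then have "avg (\<lambda>t. indicator (A \<union> B) t *\<^sub>R z)
          = (\<lambda>t. avg (\<lambda>t. indicator A t *\<^sub>R z) t + avg (\<lambda>t. indicator B t *\<^sub>R z) t)"
        using avg_add[OF ti[OF A] ti[OF B], of z z] by (simp add: fun_eq_iff)
      then have "J (A \<union> B) z = J A z + J B z"
        unfolding J_def using uniform_integral_add[OF mu ta[OF ti[OF A]] ta[OF ti[OF B]]] by simp
      then show "ip z (\<nu> (A \<union> B)) = ip z (\<nu> A + \<nu> B)"
        using nu_J[OF A] nu_J[OF B] nu_J[OF sets.Un[OF A B]] by (simp add: ip_add_right)
    qed
  qed
  have simple: "simple_integral ip s \<nu> = uniform_integral ip (avg s) \<mu>"
    if s: "simple_function borel s" for s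
  proof -
    have bor: "s -` {x} \<in> sets borel" for x using simple_functionD(2)[OF s, of "{x}"] by simp
    have "simple_integral ip s \<nu> = (\<Sum>x\<in>range s. J (s -` {x}) x)"
      unfolding simple_integral_def by (simp add: nu_J[OF bor])
    also have "\<dots> = uniform_integral ip (\<lambda>t. \<Sum>x\<in>range s. avg (\<lambda>t. indicator (s -` {x}) t *\<^sub>R x) t) \<mu>"
      unfolding J_def by (rule uniform_integral_sum[OF mu, symmetric]) (rule ta[OF ti[OF bor]])
    also have "\<dots> = uniform_integral ip (avg s) \<mu>" by (simp add: avg_simple[OF s, abs_def])
    finally show ?thesis .
  qed
  have "uniform_integral ip f \<nu> = uniform_integral ip (avg f) \<mu>" if f: "tot_measurable f" for f
  proof -
    obtain s where s: "\<And>n::nat. simple_function borel (s n)" and lim: "uniform_limit UNIV s f sequentially"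
      using f unfolding tot_measurable_def by blast
    let ?c = "mean_onorm * measure (variation_measure \<mu>) UNIV"
    have c: "0 \<le> ?c" using mean_onorm_nonneg by simp
    have "(\<lambda>n. uniform_integral ip (avg (s n)) \<mu>) \<longlonglongrightarrow> uniform_integral ip (avg f) \<mu>"
    proof (rule tendstoI)
      fix e :: real assume e: "0 < e"
      define d where "d = e / (?c + 1)"
      have d: "0 < d" using e c by (simp add: d_def)
      from uniform_limitD[OF lim d]
      show "\<forall>\<^sub>F n in sequentially. dist (uniform_integral ip (avg (s n)) \<mu>) (uniform_integral ip (avg f) \<mu>) < e"
      proof eventually_elim
        case (elim n)
        note sn = tot_measurable_simple[OF s[of n]]
        have "norm (s n t - f t) \<le> d" for t using elim by (simp add: dist_norm less_imp_le)
        then have "norm (avg (s n) t - avg f t) \<le> d * mean_onorm" for t by (rule norm_avg_close[OF sn f])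
        from uniform_integral_le_sup[OF mu tot_measurable_diff[OF ta[OF sn] ta[OF f]] this]
        have "dist (uniform_integral ip (avg (s n)) \<mu>) (uniform_integral ip (avg f) \<mu>) \<le> d * ?c"
          unfolding uniform_integral_diff[OF mu ta[OF sn] ta[OF f]] dist_norm by (simp add: mult.assoc)
        also have "d * ?c < d * (?c + 1)" using d by (intro mult_strict_left_mono) simp_all
        also have "\<dots> = e" using c by (simp add: d_def)
        finally show ?case .
      qed
    qed
    moreover have "(\<lambda>n. uniform_integral ip (avg (s n)) \<mu>) \<longlonglongrightarrow> uniform_integral ip f \<nu>"
      using uniform_integral_tendsto[OF nu s lim] by (simp add: simple[OF s])
    ultimately show ?thesis by (rule LIMSEQ_unique[rotated])
  qed
  with nu show thesis by (rule that)
qed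

lemma H_op_eqI:
  fixes \<mu> \<nu> :: "'t set \<Rightarrow> 'x"
  assumes mu: "\<mu> \<in> cabv" and nu: "\<nu> \<in> cabv"
    and eq: "\<And>f. tot_measurable f \<Longrightarrow> uniform_integral ip f \<nu> = uniform_integral ip (avg f) \<mu>"
  shows "H_op ip W \<omega> R \<mu> = \<nu>"
  unfolding H_op_def
proof (rule inv_into_f_eq)
  show "inj_on (Phi ip :: _ \<Rightarrow> ('t \<Rightarrow>\<^sub>C 'x) \<Rightarrow> complex) cabv"
    by (rule inj_onI) (rule Phi_injective[OF compact_UNIV])
  show "Phi ip \<nu> = H_C_adjoint W \<omega> R (Phi ip \<mu>)"
  proof
    fix f :: "'t \<Rightarrow>\<^sub>C 'x"
    have "tot_measurable (apply_bcontfun f)" by (rule tot_measurable_continuous[OF compact_UNIV]) simp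
    from eq[OF this] show "Phi ip \<nu> f = H_C_adjoint W \<omega> R (Phi ip \<mu>) f"
      by (simp add: Phi_def H_C_adjoint_def apply_H_C)
  qed
qed (rule nu)

lemma H_op_in_cabv: "H_op ip W \<omega> R \<mu> \<in> cabv"
  and uniform_integral_H_op:
    "tot_measurable f \<Longrightarrow> uniform_integral ip f (H_op ip W \<omega> R \<mu>) = uniform_integral ip (avg f) \<mu>"
  if mu: "\<mu> \<in> cabv" for \<mu> :: "'t set \<Rightarrow> 'x"
proof -
  obtain \<nu> :: "'t set \<Rightarrow> 'x" where nu: "\<nu> \<in> cabv"
    "\<And>f. tot_measurable f \<Longrightarrow> uniform_integral ip f \<nu> = uniform_integral ip (avg f) \<mu>"
    using transported_measure_exists[OF mu] by blast
  have "H_op ip W \<omega> R \<mu> = \<nu>" by (rule H_op_eqI[OF mu nu])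
  with nu show "H_op ip W \<omega> R \<mu> \<in> cabv"
    "tot_measurable f \<Longrightarrow> uniform_integral ip f (H_op ip W \<omega> R \<mu>) = uniform_integral ip (avg f) \<mu>"
    by simp_all
qed

lemma H_op_add:
  fixes \<mu> \<nu> :: "'t set \<Rightarrow> 'x"
  assumes "\<mu> \<in> cabv" "\<nu> \<in> cabv"
  shows "H_op ip W \<omega> R (\<lambda>A. \<mu> A + \<nu> A) = (\<lambda>A. H_op ip W \<omega> R \<mu> A + H_op ip W \<omega> R \<nu> A)"
  using assms
  by (intro H_op_eqI cabv_add H_op_in_cabv)
    (simp_all add: uniform_integral_measure_add H_op_in_cabv uniform_integral_H_op tot_measurable_avg)

lemma H_op_sc:
  fixes \<mu> :: "'t set \<Rightarrow> 'x"
  assumes "\<mu> \<in> cabv" "a \<in> K"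
  shows "H_op ip W \<omega> R (\<lambda>A. sc a (\<mu> A)) = (\<lambda>A. sc a (H_op ip W \<omega> R \<mu> A))"
  using assms
  by (intro H_op_eqI cabv_sc H_op_in_cabv)
    (simp_all add: uniform_integral_measure_sc H_op_in_cabv uniform_integral_H_op tot_measurable_avg)

end

section \<open>The Monge-Kantorovich estimate\<close>

context random_operator
begin

lemma tot_measurable_lipschitz:
  fixes f :: "'t \<Rightarrow> 'x"
  assumes "L-lipschitz_on UNIV f" shows "tot_measurable f"
  by (rule tot_measurable_continuous[OF compact_UNIV lipschitz_on_continuous_on[OF assms]])

lemma BL_norm_bounds:
  fixes f :: "'t \<Rightarrow> 'x"
  assumes L: "L-lipschitz_on UNIV f" and BL: "BL_norm f \<le> 1"
  shows "norm (f t) \<le> sup_norm f" "dist (f s) (f t) \<le> lip_const f * dist s t"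
    "0 \<le> sup_norm f" "0 \<le> lip_const f" "sup_norm f + lip_const f \<le> 1"
proof -
  have "bounded (range f)"
    using lipschitz_on_continuous_on[OF L] compact_UNIV by (intro compact_imp_bounded compact_continuous_image)
  then show sup: "norm (f t) \<le> sup_norm f" for t by (rule norm_le_sup_norm)
  show "dist (f s) (f t) \<le> lip_const f * dist s t" using L by (rule dist_le_lip_const)
  show "0 \<le> sup_norm f" using sup order_trans[OF norm_ge_zero] by blast
  show "0 \<le> lip_const f" using lip_const_nonneg[OF L] two_points by blast
  show "sup_norm f + lip_const f \<le> 1" using BL by (simp add: BL_norm_def)
qed

lemma uniform_integral_le_MK_norm_unit:
  fixes \<mu> :: "'t set \<Rightarrow> 'x"
  assumes mu: "\<mu> \<in> cabv" and f: "L-lipschitz_on UNIV f" "BL_norm f \<le> 1"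
  shows "cmod (uniform_integral ip f \<mu>) \<le> MK_norm ip \<mu>"
  unfolding MK_norm_def
proof (rule cSUP_upper)
  show "bdd_above ((\<lambda>f. cmod (uniform_integral ip f \<mu>)) ` {f. (\<exists>L. L-lipschitz_on UNIV f) \<and> BL_norm f \<le> 1})"
  proof (rule bdd_aboveI2)
    fix g :: "'t \<Rightarrow> 'x" assume "g \<in> {f. (\<exists>L. L-lipschitz_on UNIV f) \<and> BL_norm f \<le> 1}"
    then obtain L where g: "L-lipschitz_on UNIV g" "BL_norm g \<le> 1" by blast
    have "norm (g t) \<le> 1" for t using BL_norm_bounds(1)[OF g, of t] BL_norm_bounds(4,5)[OF g] by linarith
    from uniform_integral_le_sup[OF mu tot_measurable_lipschitz[OF g(1)] this]
    show "cmod (uniform_integral ip g \<mu>) \<le> 1 * measure (variation_measure \<mu>) UNIV" .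
  qed
qed (use f in blast)

text \<open>
  Scaling \<open>f\<close> by \<open>1 / c\<close> brings it into the unit ball of the norm \<^const>\<open>BL_norm\<close>.
\<close>

lemma uniform_integral_le_MK_norm:
  fixes \<mu> :: "'t set \<Rightarrow> 'x" and f :: "'t \<Rightarrow> 'x"
  assumes mu: "\<mu> \<in> cabv" and a: "\<And>t. norm (f t) \<le> a" and b: "\<And>s t. dist (f s) (f t) \<le> b * dist s t"
    and c: "a + b \<le> c"
  shows "cmod (uniform_integral ip f \<mu>) \<le> c * MK_norm ip \<mu>"
proof -
  obtain p q :: 't where pq: "p \<noteq> q" using two_points by blast
  have a0: "0 \<le> a" using a order_trans[OF norm_ge_zero] by blast
  have "0 \<le> b * dist p q" using b order_trans[OF zero_le_dist] by blast
  with pq have b0: "0 \<le> b" by (simp add: zero_le_mult_iff)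
  have L: "b-lipschitz_on UNIV f" using b b0 by (intro lipschitz_onI)
  show ?thesis
  proof (cases "c = 0")
    case True
    \<comment> \<open>Scaling by \<open>1 / c\<close> is impossible, but then \<open>f\<close> vanishes.\<close>
    with a0 b0 c have "a = 0" by simp
    with uniform_integral_le_sup[OF mu tot_measurable_lipschitz[OF L] a] True show ?thesis by simp
  next
    case False
    with a0 b0 c have c0: "0 < c" by simp
    define g where "g t = (1 / c) *\<^sub>R f t" for t
    have gd: "dist (g s) (g t) \<le> b / c * dist s t" for s t
    proof -
      have "dist (g s) (g t) = dist (f s) (f t) / c"
        using c0 by (simp add: g_def dist_norm scaleR_diff_right[symmetric] divide_inverse mult.commute)
      then show ?thesis using divide_right_mono[OF b[of s t], of c] c0 by simp
    qed
    have "(b / c)-lipschitz_on UNIV g" using gd b0 c0 by (intro lipschitz_onI) simp_all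
    moreover have "BL_norm g \<le> 1"
    proof -
      have "sup_norm g \<le> a / c"
        using a c0 by (intro sup_norm_le) (simp add: g_def divide_right_mono)
      moreover have "lip_const g \<le> b / c" using gd pq by (rule lip_const_le)
      moreover have "a / c + b / c \<le> 1" using c c0 by (simp add: add_divide_distrib[symmetric])
      ultimately show ?thesis unfolding BL_norm_def by linarith
    qed
    ultimately have "cmod (uniform_integral ip g \<mu>) \<le> MK_norm ip \<mu>"
      by (rule uniform_integral_le_MK_norm_unit[OF mu])
    moreover have "uniform_integral ip g \<mu> = of_real (1 / c) * uniform_integral ip f \<mu>"
      unfolding g_def by (rule uniform_integral_scaleR[OF mu tot_measurable_lipschitz[OF L]])
    ultimately show ?thesis using c0 by (simp add: norm_mult norm_divide field_simps)
  qed
qed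

text \<open>
  If \<open>sup_norm f + lip_const f \<le> 1\<close>, then both numbers are at most \<open>1\<close>, so the bounds for the average
  of \<open>f\<close> add up to at most the sum of the two means.
\<close>

lemma MK_norm_H_op_le:
  fixes \<mu> :: "'t set \<Rightarrow> 'x"
  assumes mu: "\<mu> \<in> cabv"
  shows "MK_norm ip (H_op ip W \<omega> R \<mu>) \<le> (mean_onorm + mean_lip) * MK_norm ip \<mu>"
  unfolding MK_norm_def[of ip "H_op ip W \<omega> R \<mu>"]
proof (rule cSUP_least)
  obtain p q :: 't where pq: "p \<noteq> q" using two_points by blast
  have "0-lipschitz_on UNIV (\<lambda>_ :: 't. 0 :: 'x)" by (rule lipschitz_onI) simp_all
  moreover have "BL_norm (\<lambda>_ :: 't. 0 :: 'x) \<le> 0 + 0"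
    unfolding BL_norm_def by (intro add_mono sup_norm_le lip_const_le[OF _ pq]) simp_all
  ultimately show "{f :: 't \<Rightarrow> 'x. (\<exists>L. L-lipschitz_on UNIV f) \<and> BL_norm f \<le> 1} \<noteq> {}"
    by (intro ex_in_conv[THEN iffD1] exI[of _ "\<lambda>_. 0"]) auto
next
  fix f :: "'t \<Rightarrow> 'x" assume "f \<in> {f. (\<exists>L. L-lipschitz_on UNIV f) \<and> BL_norm f \<le> 1}"
  then obtain L where f: "L-lipschitz_on UNIV f" "BL_norm f \<le> 1" by blast
  note tf = tot_measurable_lipschitz[OF f(1)]
  let ?a = "sup_norm f" and ?b = "lip_const f"
  note ab = BL_norm_bounds[OF f]
  have "cmod (uniform_integral ip (avg f) \<mu>) \<le> (mean_onorm + mean_lip) * MK_norm ip \<mu>"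
  proof (rule uniform_integral_le_MK_norm[OF mu])
    show "norm (avg f t) \<le> ?a * mean_onorm" for t by (rule norm_avg_le[OF tf ab(1)])
    show "dist (avg f s) (avg f t) \<le> ?b * mean_lip * dist s t" for s t
      using norm_avg_modulus[OF tf, of 0 ?b s t] ab(2,4) by (simp add: dist_norm)
    have "?a \<le> 1" "?b \<le> 1" using ab(3-5) by simp_all
    then show "?a * mean_onorm + ?b * mean_lip \<le> mean_onorm + mean_lip"
      using mean_onorm_nonneg mean_lip_nonneg ab(3,4) by (intro add_mono mult_left_le_one_le)
  qed
  then show "cmod (uniform_integral ip f (H_op ip W \<omega> R \<mu>)) \<le> (mean_onorm + mean_lip) * MK_norm ip \<mu>"
    by (simp add: uniform_integral_H_op[OF mu tf])
qed

end

section \<open>Linearity, continuity and operator norm\<close>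

context random_operator
begin

lemma linear_on_cabv_H_op: "linear_on_cabv K sc (H_op ip W \<omega> R :: ('t set \<Rightarrow> 'x) \<Rightarrow> _)"
  unfolding linear_on_cabv_def by (simp add: H_op_in_cabv H_op_add H_op_sc)

lemma MK_continuous_H_op: "MK_continuous ip (H_op ip W \<omega> R :: ('t set \<Rightarrow> 'x) \<Rightarrow> _)"
  unfolding MK_continuous_def
proof (intro ballI allI impI)
  fix \<mu> :: "'t set \<Rightarrow> 'x" and e :: real assume mu: "\<mu> \<in> cabv" and e: "0 < e"
  let ?C = "mean_onorm + mean_lip"
  have C: "0 \<le> ?C" using mean_onorm_nonneg mean_lip_nonneg by simp
  \<comment> \<open>Differences of measures are sums with the multiple by \<open>-1\<close>, so linearity applies to them.\<close>
  have m1: "sc (-1) x = - x" for x using sc_of_real[of "-1" x] by simp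
  have m1K: "-1 \<in> K" using of_real_in_K[of "-1"] by simp
  have "MK_norm ip (\<lambda>A. H_op ip W \<omega> R \<nu> A - H_op ip W \<omega> R \<mu> A) < e"
    if nu: "\<nu> \<in> cabv" and d: "MK_norm ip (\<lambda>A. \<nu> A - \<mu> A) < e / (?C + 1)" for \<nu>
  proof -
    have neg: "(\<lambda>A. - \<mu> A) \<in> cabv" using cabv_sc[OF mu m1K] by (simp add: m1)
    have diff: "(\<lambda>A. \<nu> A - \<mu> A) \<in> cabv" using cabv_add[OF nu neg] by simp
    have "(\<lambda>A. H_op ip W \<omega> R \<nu> A - H_op ip W \<omega> R \<mu> A) = H_op ip W \<omega> R (\<lambda>A. \<nu> A - \<mu> A)"
      using H_op_add[OF nu neg] H_op_sc[OF mu m1K] by (simp add: m1)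
    then have "MK_norm ip (\<lambda>A. H_op ip W \<omega> R \<nu> A - H_op ip W \<omega> R \<mu> A) \<le> ?C * MK_norm ip (\<lambda>A. \<nu> A - \<mu> A)"
      using MK_norm_H_op_le[OF diff] by simp
    also have "\<dots> \<le> ?C * (e / (?C + 1))" using d C by (intro mult_left_mono) simp_all
    also have "\<dots> < e" using C e by (simp add: field_simps)
    finally show ?thesis .
  qed
  moreover have "0 < e / (?C + 1)" using C e by simp
  ultimately show "\<exists>\<delta>>0. \<forall>\<nu>\<in>cabv. MK_norm ip (\<lambda>A. \<nu> A - \<mu> A) < \<delta> \<longrightarrow>
      MK_norm ip (\<lambda>A. H_op ip W \<omega> R \<nu> A - H_op ip W \<omega> R \<mu> A) < e" by blast
qed

lemma MK_onorm_H_op_le: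
  "MK_onorm ip (H_op ip W \<omega> R :: ('t set \<Rightarrow> 'x) \<Rightarrow> _)
    \<le> ereal (\<integral>\<theta>. onorm (R \<theta>) * (1 + lip_const (\<omega> \<theta>)) \<partial>W)"
  unfolding MK_onorm_def mean_sum
proof (rule SUP_least)
  fix \<mu> :: "'t set \<Rightarrow> 'x" assume "\<mu> \<in> {\<mu> \<in> cabv. MK_norm ip \<mu> \<le> 1}"
  then have mu: "\<mu> \<in> cabv" "MK_norm ip \<mu> \<le> 1" by simp_all
  have "(mean_onorm + mean_lip) * MK_norm ip \<mu> \<le> (mean_onorm + mean_lip) * 1"
    using mean_onorm_nonneg mean_lip_nonneg by (intro mult_left_mono mu) simp
  with MK_norm_H_op_le[OF mu(1)]
  show "ereal (MK_norm ip (H_op ip W \<omega> R \<mu>)) \<le> ereal (mean_onorm + mean_lip)" by simp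
qed

end

theorem theorem4p5:
  fixes K :: "complex set"
    and sc :: "complex \<Rightarrow> 'x::banach \<Rightarrow> 'x"
    and ip :: "'x \<Rightarrow> 'x \<Rightarrow> complex"
    and W :: "'o measure"
    and \<omega> :: "'o \<Rightarrow> 't::metric_space \<Rightarrow> 't"
    and R :: "'o \<Rightarrow> 'x \<Rightarrow> 'x"
  assumes "hilbert_space_over K sc ip"
    and "\<exists>x::'x. x \<noteq> 0"
    and "compact (UNIV :: 't set)"
    and "\<exists>s t :: 't. s \<noteq> t"
    and "(\<lambda>(t, \<theta>). \<omega> \<theta> t) \<in> measurable (borel \<Otimes>\<^sub>M W) borel"
    and "(\<lambda>(x, \<theta>). R \<theta> x) \<in> measurable (borel \<Otimes>\<^sub>M W) borel"
    and "\<And>\<theta>. \<theta> \<in> space W \<Longrightarrow> bounded_linear (R \<theta>)"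
    and "\<And>\<theta> a x. \<theta> \<in> space W \<Longrightarrow> a \<in> K \<Longrightarrow> R \<theta> (sc a x) = sc a (R \<theta> x)"
    and "\<And>\<theta>. \<theta> \<in> space W \<Longrightarrow> \<exists>L. L-lipschitz_on UNIV (\<omega> \<theta>)"
    and "(\<lambda>\<theta>. onorm (R \<theta>)) \<in> borel_measurable W"
    and "integrable W (\<lambda>\<theta>. onorm (R \<theta>) * (1 + lip_const (\<omega> \<theta>)))"
    and "\<And>(f :: 't \<Rightarrow>\<^sub>C 'x) t.
           bochner_integrable W (\<lambda>\<theta>. R \<theta> (apply_bcontfun f (\<omega> \<theta> t)))"
  shows "linear_on_cabv K sc (H_op ip W \<omega> R :: ('t set \<Rightarrow> 'x) \<Rightarrow> ('t set \<Rightarrow> 'x))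
    \<and> MK_continuous ip (H_op ip W \<omega> R :: ('t set \<Rightarrow> 'x) \<Rightarrow> ('t set \<Rightarrow> 'x))
    \<and> MK_onorm ip (H_op ip W \<omega> R :: ('t set \<Rightarrow> 'x) \<Rightarrow> ('t set \<Rightarrow> 'x))
        \<le> ereal (\<integral>\<theta>. onorm (R \<theta>) * (1 + lip_const (\<omega> \<theta>)) \<partial>W)"
proof -
  interpret random_operator K sc ip W \<omega> R
    using assms by (intro random_operator.intro random_operator_axioms.intro)
  show ?thesis
    using linear_on_cabv_H_op MK_continuous_H_op MK_onorm_H_op_le by blast
qed

end
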